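(* Let $4\le s\le n-2$ be integers and let $\mathcal{F}\subseteq 2^{[n]}$ be an $s$-union family such that $\mathcal{F}\nsubseteq \mathcal{K}(n,s)$ and $\mathcal{F}\nsubseteq\mathcal{H}(n,s)$ (where $\subseteq$ between families is understood up to a permutation of $[n]$). Then the following statements hold. (1) If $s=2d$ for an integer $d\ge 2$, and further $\mathcal{F}\nsubseteq \mathcal{H}^*(n,4)$ in the case $s=4$, then $$|\mathcal{F}|\le \sum_{0\le i\le d}\binom{n}{i}-\binom{n-d-1}{d}-\binom{n-d-2}{d-1}+2.$$ For $s=6$, equality holds if and only if $\mathcal{F}$ is isomorphic to $\mathcal{W}(n,6)$ or $\mathcal{W}^*(n,6)$ or $\mathcal{W}^{**}(n,6)$; for every other $s=2d$, equality holds if and only if $\mathcal{F}$ is isomorphic to $\mathcal{W}(n,2d)$. (2) If $s=2d+1$ for an integer $d\ge 2$, and further $\mathcal{F}\nsubseteq\mathcal{T}(n,5)$ in the case $s=5$, then $$|\mathcal{F}|\le \sum_{0\le i\le d}\binom{n}{i}+\binom{n-1}{d}-\binom{n-d-2}{d}-\binom{n-d-3}{d-1}+2.$$ For $s=7$, equality holds if and only if $\mathcal{F}$ is isomorphic to $\mathcal{W}(n,7)$ or $\mathcal{W}^*(n,7)$ or $\mathcal{W}^{**}(n,7)$; for every other $s=2d+1$, equality holds if and only if $\mathcal{F}$ is isomorphic to $\mathcal{W}(n,2d+1)$.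
   Context: Notation: $[n]=\{1,\dots,n\}$, $[a,b]=\{a,a+1,\dots,b\}$, $2^{[n]}$ is the power set of $[n]$, $\binom{[n]}{k}$ is the collection of all $k$-element subsets of $[n]$, and $\binom{[n]}{\le k}$ is the collection of all subsets of $[n]$ of size at most $k$. A family $\mathcal{F}\subseteq 2^{[n]}$ is $s$-union if $|F\cup F'|\le s$ for every pair $F,F'\in\mathcal{F}$. For a permutation $\sigma$ of $[n]$ and $G\subseteq[n]$, $\sigma(G)=\{\sigma(g):g\in G\}$. Families $\mathcal{G},\mathcal{H}\subseteq 2^{[n]}$ are isomorphic if $\{\sigma(G):G\in\mathcal{G}\}=\mathcal{H}$ for some permutation $\sigma$ of $[n]$. The family $\mathcal{G}$ is a subfamily of $\mathcal{H}$, written $\mathcal{G}\subseteq\mathcal{H}$, if there is a permutation $\sigma$ of $[n]$ with $\sigma(G)\in\mathcal{H}$ for every $G\in\mathcal{G}$; $\mathcal{G}\nsubseteq\mathcal{H}$ means that no such permutation exists. The families below are defined up to isomorphism (i.e. the choice of the fixed elements and sets does not matter). Katona families: $\mathcal{K}(n,2d)=\binom{[n]}{\le d}$, and $\mathcal{K}(n,2d+1)=\binom{[n]}{\le d}\cup\{F\in\binom{[n]}{d+1}: y\in F\}$ for a fixed $y\in[n]$. Frankl families: $\mathcal{H}(n,2d)=\binom{[n]}{\le d-1}\cup\{D\}\cup\{H\in\binom{[n]}{d}: H\cap D\ne\emptyset\}$ for a fixed $D\in\binom{[n]}{d+1}$; and $\mathcal{H}(n,2d+1)=\binom{[n]}{\le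 d}\cup\{D\}\cup\{H\in\binom{[n]}{d+1}: y\in H,\ H\cap D\ne\emptyset\}$ for a fixed $y\in[n]$ and a fixed $D\subseteq[n]\setminus\{y\}$ with $|D|=d+1$. Exceptional families for $s=4,5$: $\mathcal{H}^*(n,4)=\binom{[n]}{\le 1}\cup\{H\in\binom{[n]}{2}: H\cap[2]\ne\emptyset\}\cup\{\{1,2,i\}: i\in[3,n]\}$ and $\mathcal{T}(n,5)=\binom{[n]}{\le 2}\cup\{F\in\binom{[n]}{3}: |F\cap[3]|\ge 2\}$. The families $\mathcal{W}$ (for $d\ge 2$): $\mathcal{W}(n,2d)=\binom{[n]}{\le d-1}\cup\{D_1,D_2\}\cup\{H\in\binom{[n]}{d}: H\cap D_1\ne\emptyset \text{ and } H\cap D_2\ne\emptyset\}$, where $D_1,D_2\subseteq[n]$ are fixed with $|D_1|=|D_2|=d+1$ and $|D_1\cap D_2|=d$. $\mathcal{W}(n,2d+1)=\binom{[n]}{\le d}\cup\mathcal{J}_2(n,d+1)$, where $\mathcal{J}_2(n,k)$ is defined as follows: fix a $(k-1)$-element set $E\subseteq[n]$, a $3$-element set $J\subseteq[n]\setminus E$, an element $x_0\in J$, and put $J_2=J\setminus\{x_0\}$; then $$\mathcal{J}_2(n,k)=\Bigl\{G\in\tbinom{[n]}{k}: x_0\in G,\ G\cap(E\cup\{j\})\ne\emptyset\text{ for each }j\in J_2\Bigr\}\cup\{E\cup\{j\}: j\in J_2\}.$$ Exceptional families for $s=6$: $\mathcal{W}^*(n,6)=\binom{[n]}{\le 2}\cup\{F\in\binom{[n]}{3}: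 F\cap[3]\ne\emptyset\}\cup\{H\in\binom{[n]}{4}: [3]\subseteq H\}$, $\mathcal{W}^{**}(n,6)=\binom{[n]}{\le 2}\cup\{F\in\binom{[n]}{3}: F\cap[2]\ne\emptyset\}\cup\{H\in\binom{[n]}{4}: [2]\subseteq H\}$. Exceptional families for $s=7$: $\mathcal{W}^*(n,7)=\binom{[n]}{\le 3}\cup\{H\in\binom{[n]}{4}: \{2,3\}\subseteq H\}\cup\{H\in\binom{[n]}{4}: 1\in H,\ H\cap\{2,3\}\ne\emptyset\}$, $\mathcal{W}^{**}(n,7)=\binom{[n]}{\le 3}\cup\{H\in\binom{[n]}{4}: \{2,3,4\}\subseteq H\}\cup\{H\in\binom{[n]}{4}: 1\in H,\ H\cap\{2,3,4\}\ne\emptyset\}$. *)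

theory Defs
  imports "HOL-Combinatorics.Permutations" "HOL-Library.Ramsey"
begin

text \<open>
  Families on \<open>[n] = {1..n}\<close> have type \<open>nat set set\<close>. The \<open>k\<close>-subsets of \<open>A\<close> are
  \<open>nsets A k\<close>, from \<open>HOL-Library.Ramsey\<close>.
\<close>

definition subsets_le :: "nat \<Rightarrow> nat \<Rightarrow> nat set set" where
  "subsets_le n k = {A. A \<subseteq> {1..n} \<and> card A \<le> k}"

definition s_union :: "nat \<Rightarrow> nat set set \<Rightarrow> bool" where
  "s_union s \<F> \<longleftrightarrow> (\<forall>F\<in>\<F>. \<forall>F'\<in>\<F>. card (F \<union> F') \<le> s)"

definition isomorphic_fam :: "nat \<Rightarrow> nat set set \<Rightarrow> nat set set \<Rightarrow> bool" where
  "isomorphic_fam n \<G> \<H> \<longleftrightarrow> (\<exists>\<sigma>. \<sigma> permutes {1..n} \<and> {\<sigma> ` G |G. G \<in> \<G>} = \<H>)"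

definition subfamily :: "nat \<Rightarrow> nat set set \<Rightarrow> nat set set \<Rightarrow> bool" where
  "subfamily n \<G> \<H> \<longleftrightarrow> (\<exists>\<sigma>. \<sigma> permutes {1..n} \<and> (\<forall>G\<in>\<G>. \<sigma> ` G \<in> \<H>))"

text \<open>
  The families \<open>\<K>(n,s)\<close>, \<open>\<H>(n,s)\<close> and \<open>\<W>(n,s)\<close> depend on a choice of fixed elements and
  sets, and are determined only up to isomorphism. They are rendered as predicates that hold of
  the family obtained from any admissible choice: \<open>katona n s \<K>\<close> says that \<open>\<K>\<close> is \<open>\<K>(n,s)\<close>
  for some choice of \<open>y\<close>, and similarly for the others.
\<close>

inductive katona :: "nat \<Rightarrow> nat \<Rightarrow> nat set set \<Rightarrow> bool" for n where
  katona_even: "katona n (2 * d) (subsets_le n d)"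
| katona_odd: "y \<in> {1..n} \<Longrightarrow>
    katona n (2 * d + 1) (subsets_le n d \<union> {F \<in> nsets {1..n} (d + 1). y \<in> F})"

inductive frankl :: "nat \<Rightarrow> nat \<Rightarrow> nat set set \<Rightarrow> bool" for n where
  frankl_even: "1 \<le> d \<Longrightarrow> D \<in> nsets {1..n} (d + 1) \<Longrightarrow>
    frankl n (2 * d)
      (subsets_le n (d - 1) \<union> {D} \<union> {H \<in> nsets {1..n} d. H \<inter> D \<noteq> {}})"
| frankl_odd: "y \<in> {1..n} \<Longrightarrow> D \<in> nsets ({1..n} - {y}) (d + 1) \<Longrightarrow>
    frankl n (2 * d + 1)
      (subsets_le n d \<union> {D} \<union> {H \<in> nsets {1..n} (d + 1). y \<in> H \<and> H \<inter> D \<noteq> {}})"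

definition \<J>\<^sub>2 :: "nat \<Rightarrow> nat \<Rightarrow> nat set \<Rightarrow> nat set \<Rightarrow> nat \<Rightarrow> nat set set" where
  "\<J>\<^sub>2 n k E J x\<^sub>0 =
     {G \<in> nsets {1..n} k. x\<^sub>0 \<in> G \<and> (\<forall>j \<in> J - {x\<^sub>0}. G \<inter> (E \<union> {j}) \<noteq> {})}
     \<union> {E \<union> {j} |j. j \<in> J - {x\<^sub>0}}"

inductive w_family :: "nat \<Rightarrow> nat \<Rightarrow> nat set set \<Rightarrow> bool" for n where
  w_even: "2 \<le> d \<Longrightarrow> D\<^sub>1 \<in> nsets {1..n} (d + 1) \<Longrightarrow> D\<^sub>2 \<in> nsets {1..n} (d + 1) \<Longrightarrow>
      card (D\<^sub>1 \<inter> D\<^sub>2) = d \<Longrightarrow>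
    w_family n (2 * d)
      (subsets_le n (d - 1) \<union> {D\<^sub>1, D\<^sub>2} \<union>
       {H \<in> nsets {1..n} d. H \<inter> D\<^sub>1 \<noteq> {} \<and> H \<inter> D\<^sub>2 \<noteq> {}})"
| w_odd: "2 \<le> d \<Longrightarrow> E \<in> nsets {1..n} d \<Longrightarrow> J \<in> nsets ({1..n} - E) 3 \<Longrightarrow> x\<^sub>0 \<in> J \<Longrightarrow>
    w_family n (2 * d + 1) (subsets_le n d \<union> \<J>\<^sub>2 n (d + 1) E J x\<^sub>0)"

definition H_star_4 :: "nat \<Rightarrow> nat set set" where
  "H_star_4 n = subsets_le n 1 \<union> {H \<in> nsets {1..n} 2. H \<inter> {1..2} \<noteq> {}}
     \<union> {{1, 2, i} |i. i \<in> {3..n}}"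

definition T_5 :: "nat \<Rightarrow> nat set set" where
  "T_5 n = subsets_le n 2 \<union> {F \<in> nsets {1..n} 3. card (F \<inter> {1..3}) \<ge> 2}"

definition W_star_6 :: "nat \<Rightarrow> nat set set" where
  "W_star_6 n = subsets_le n 2 \<union> {F \<in> nsets {1..n} 3. F \<inter> {1..3} \<noteq> {}}
     \<union> {H \<in> nsets {1..n} 4. {1..3} \<subseteq> H}"

definition W_star_star_6 :: "nat \<Rightarrow> nat set set" where
  "W_star_star_6 n = subsets_le n 2 \<union> {F \<in> nsets {1..n} 3. F \<inter> {1..2} \<noteq> {}}
     \<union> {H \<in> nsets {1..n} 4. {1..2} \<subseteq> H}"

definition W_star_7 :: "nat \<Rightarrow> nat set set" where
  "W_star_7 n = subsets_le n 3 \<union> {H \<in> nsets {1..n} 4. {2, 3} \<subseteq> H}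
     \<union> {H \<in> nsets {1..n} 4. 1 \<in> H \<and> H \<inter> {2, 3} \<noteq> {}}"

definition W_star_star_7 :: "nat \<Rightarrow> nat set set" where
  "W_star_star_7 n = subsets_le n 3 \<union> {H \<in> nsets {1..n} 4. {2, 3, 4} \<subseteq> H}
     \<union> {H \<in> nsets {1..n} 4. 1 \<in> H \<and> H \<inter> {2, 3, 4} \<noteq> {}}"

text \<open>Admissible choices exist in the range of parameters of interest.\<close>

lemma katona_exists:
  assumes "1 \<le> n"
  shows "\<exists>\<K>. katona n s \<K>"
proof (cases "even s")
  case True
  then show ?thesis by (metis evenE katona_even)
next
  case False
  then obtain d where "s = 2 * d + 1" by (elim oddE)
  with katona_odd[of 1 n d] assms show ?thesis by auto
qed

lemma frankl_exists:
  assumes "4 \<le> s" "s + 2 \<le> n"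
  shows "\<exists>\<H>. frankl n s \<H>"
proof (cases "even s")
  case True
  then obtain d where d: "s = 2 * d" by (elim evenE)
  have "{1..d + 1} \<in> nsets {1..n} (d + 1)"
    using assms d by (auto simp: nsets_def)
  with frankl_even[of d "{1..d + 1}" n] assms d show ?thesis by auto
next
  case False
  then obtain d where d: "s = 2 * d + 1" by (elim oddE)
  have "{2..d + 2} \<in> nsets ({1..n} - {1}) (d + 1)"
    using assms d by (auto simp: nsets_def)
  moreover have "1 \<in> {1..n}" using assms by auto
  ultimately show ?thesis using frankl_odd d by blast
qed

lemma w_family_exists:
  assumes "4 \<le> s" "s + 2 \<le> n"
  shows "\<exists>\<W>. w_family n s \<W>"
proof (cases "even s")
  case True
  then obtain d where d: "s = 2 * d" by (elim evenE)
  have "{1..d + 1} \<in> nsets {1..n} (d + 1)" "{2..d + 2} \<in> nsets {1..n} (d + 1)" "2 \<le> d"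
    using assms d by (auto simp: nsets_def)
  moreover have "{1..d + 1} \<inter> {2..d + 2} = {2..d + 1}" by auto
  then have "card ({1..d + 1} \<inter> {2..d + 2}) = d" by simp
  ultimately show ?thesis using w_even d by blast
next
  case False
  then obtain d where d: "s = 2 * d + 1" by (elim oddE)
  have "{1..d} \<in> nsets {1..n} d" "{d + 1..d + 3} \<in> nsets ({1..n} - {1..d}) 3" "2 \<le> d"
    "d + 1 \<in> {d + 1..d + 3}"
    using assms d by (auto simp: nsets_def)
  then show ?thesis using w_odd d by blast
qed

end

(*
  An s-union family may be replaced by its down-closure. If F is s-union, the layers of sizes a and
  b with a + b = s + 1 and b \<le> a are cross-intersecting and layer a is (a - b + 1)-intersecting,
  so that pairing the layers reduces everything to the middle: to the layers d and d + 1 for s = 2d,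
  and to an intersecting family of (d + 1)-sets for s = 2d + 1.

  For a cross-intersecting pair (A, B) of this kind, |A| + |B| is estimated by shifting A and B
  simultaneously and by induction on the size of the ground set, deleting its largest element. If
  |A| \<ge> 2, equality forces |A| = 2 unless b = 3, where A may also consist of all a-sets containing a
  fixed set E. Shifting preserves |A|, and the second kind of pair is recognised after a single
  reverse shift.

  An intersecting family F of k-sets is the pair of its members avoiding and containing a point c.
  If F is stable under all shifts towards c, the members avoiding c are 2-intersecting and the bound
  for pairs applies. If for some i and j neither of the shifts between i and j amounts to an
  isomorphism, then either F is strictly below the bound, by the corresponding estimate for pairs of
  families of (k - 1)-sets on the remaining points, or the shifted family is again nontrivial and
  induction applies. For k = 3 the extremal problem is solved directly in terms of covers by two points.
*)
theory Submission
  imports Defs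
begin

subsection \<open>Counting sets that meet given sets\<close>

text \<open>Two facts about the largest point \<open>m\<close> drive the induction on stable pairs:
  since \<open>a + b\<close> is at most the size of the ground set, some point is free to replace
  \<open>m\<close>, so links at \<open>m\<close> keep their intersection properties; and
  \<open>a + 1 = b + t\<close> also holds for \<open>a - 1\<close> and \<open>b - 1\<close>. The
  constants 1 and 2 in the bounds stand for one or two members of \<open>A\<close> surviving the
  deletion of \<open>m\<close>. The links must obey the estimate without the constant, and Pascal's
  rule leaves just the surplus needed. In the two-member bound this surplus is a binomial equal to 1
  only for \<open>b = 3\<close>, the origin of the exceptional families for s = 6 and 7. For
  intersecting families the obstacle is a reverse shift when the centre of the extremal structure is
  \<open>i\<close> or \<open>j\<close>. It is avoided by asking whether the members avoiding both
  points are 3-intersecting: if not, neither point can be a centre. In the odd case the middle layer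
  may be trivial although the family is not; then a set of size \<open>d + 2\<close> exists, and the
  losses in the middle layer and in the layers \<open>d\<close> and \<open>d + 2\<close> together
  exceed what the bound allows.\<close>

lemma nsetsI: "F \<subseteq> V \<Longrightarrow> finite V \<Longrightarrow> card F = k \<Longrightarrow> F \<in> nsets V k"
  by (auto simp: nsets_def intro: finite_subset)

lemma nsetsD:
  assumes "F \<in> nsets V k"
  shows "F \<subseteq> V" "finite F" "card F = k"
  using assms by (auto simp: nsets_def)

lemma finite_nsets [simp]: "finite V \<Longrightarrow> finite (nsets V k)"
  by (rule finite_imp_finite_nsets)

lemma card_nsets:
  assumes "finite V"
  shows "card (nsets V k) = card V choose k"
proof -
  have "nsets V k = {F. F \<subseteq> V \<and> card F = k}"
    using assms by (auto simp: nsets_def intro: finite_subset)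
  then show ?thesis using n_subsets[OF assms] by simp
qed

lemma card_disjoint:
  assumes "finite V" "P \<subseteq> V"
  shows "card {G \<in> nsets V b. G \<inter> P = {}} = (card V - card P) choose b"
proof -
  have "{G \<in> nsets V b. G \<inter> P = {}} = nsets (V - P) b"
    by (auto simp: nsets_def)
  then show ?thesis
    using assms card_nsets[of "V - P" b] by (simp add: card_Diff_subset finite_subset)
qed

lemma card_meeting:
  assumes "finite V" "P \<subseteq> V"
  shows "card {G \<in> nsets V b. G \<inter> P \<noteq> {}} + ((card V - card P) choose b) = card V choose b"
proof -
  have "{G \<in> nsets V b. G \<inter> P \<noteq> {}} \<union> {G \<in> nsets V b. G \<inter> P = {}} = nsets V b" by auto
  moreover have "card ({G \<in> nsets V b. G \<inter> P \<noteq> {}} \<union> {G \<in> nsets V b. G \<inter> P = {}})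
    = card {G \<in> nsets V b. G \<inter> P \<noteq> {}} + card {G \<in> nsets V b. G \<inter> P = {}}"
    by (rule card_Un_disjoint) (use assms in auto)
  ultimately show ?thesis
    using card_disjoint[OF assms] card_nsets[OF assms(1)] by metis
qed

lemma card_supersets:
  assumes "finite V" "E \<subseteq> V" "card E \<le> a"
  shows "card {F \<in> nsets V a. E \<subseteq> F} = (card V - card E) choose (a - card E)"
proof -
  have fE: "finite E" using assms finite_subset by blast
  have "bij_betw (\<lambda>F. F - E) {F \<in> nsets V a. E \<subseteq> F} (nsets (V - E) (a - card E))"
    by (rule bij_betw_byWitness[where f' = "\<lambda>F. F \<union> E"])
      (use assms fE in \<open>auto simp: nsets_def card_Diff_subset card_Un_disjoint Int_commute
         disjoint_iff subset_iff\<close>)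
  then have "card {F \<in> nsets V a. E \<subseteq> F} = card (nsets (V - E) (a - card E))"
    by (rule bij_betw_same_card)
  then show ?thesis
    using assms fE card_nsets[of "V - E"] by (simp add: card_Diff_subset)
qed

lemma ex_nset: "finite V \<Longrightarrow> k \<le> card V \<Longrightarrow> \<exists>R. R \<in> nsets V k"
  using nsets_eq_empty_iff[of V k] by fastforce

lemma insert_in_nsets:
  assumes "R \<in> nsets W k" "W \<subseteq> V" "e \<in> V" "e \<notin> W"
  shows "insert e R \<in> nsets V (Suc k)"
proof -
  have "e \<notin> R" using assms by (auto simp: nsets_def)
  then show ?thesis using assms by (auto simp: nsets_def)
qed

text \<open>Three kinds of \<open>b\<close>-sets are disjoint: those meeting both sets, those
  missing \<open>P\<close>, and those missing \<open>Q\<close> but containing a fixed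
  \<open>p\<close> of \<open>P - Q\<close>. The last two contribute the two binomials. If there is
  room, the three kinds exhaust all \<open>b\<close>-sets precisely when \<open>P - Q\<close> is the
  single point \<open>p\<close>; this is what the equality clauses express.\<close>

lemma card_meeting_two:
  fixes V :: "'a set"
  assumes fV: "finite V" and P: "P \<in> nsets V a" and Q: "Q \<in> nsets V a" and "P \<noteq> Q" and b: "1 \<le> b"
  defines "M \<equiv> {G \<in> nsets V b. G \<inter> P \<noteq> {} \<and> G \<inter> Q \<noteq> {}}"
  shows "card M + ((card V - a) choose b) + ((card V - a - 1) choose (b - 1)) \<le> card V choose b"
    and "card (P \<inter> Q) = a - 1 \<Longrightarrow>
      card M + ((card V - a) choose b) + ((card V - a - 1) choose (b - 1)) = card V choose b"
    and "a + b < card V \<Longrightarrow>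
      card M + ((card V - a) choose b) + ((card V - a - 1) choose (b - 1)) = card V choose b \<Longrightarrow>
      card (P \<inter> Q) = a - 1"
proof -
  have fP: "finite P" "finite Q" "card P = a" "card Q = a" "P \<subseteq> V" "Q \<subseteq> V"
    using nsetsD[OF P] nsetsD[OF Q] by auto
  obtain p where p: "p \<in> P" "p \<notin> Q"
    using fP \<open>P \<noteq> Q\<close> by (metis card_subset_eq subsetI)
  let ?D = "{G \<in> nsets V b. G \<inter> P = {}}"
  let ?S = "{G \<in> nsets (V - Q) b. {p} \<subseteq> G}"
  have fM: "finite M" unfolding M_def using fV by simp
  have cD: "card ?D = (card V - a) choose b" using card_disjoint fV fP by metis
  have cS: "card ?S = (card V - a - 1) choose (b - 1)"
    using card_supersets[of "V - Q" "{p}" b] p fP fV b by (simp add: card_Diff_subset subset_iff)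
  have sub: "M \<union> ?D \<union> ?S \<subseteq> nsets V b" unfolding M_def by (auto simp: nsets_def)
  have c3: "card (M \<union> ?D \<union> ?S) = card M + card ?D + card ?S"
  proof -
    have "card (M \<union> ?D \<union> ?S) = card (M \<union> ?D) + card ?S"
      by (rule card_Un_disjoint) (use fV fM p in \<open>auto simp: M_def nsets_def\<close>)
    moreover have "card (M \<union> ?D) = card M + card ?D"
      by (rule card_Un_disjoint) (use fV fM p in \<open>auto simp: M_def nsets_def\<close>)
    ultimately show ?thesis by simp
  qed
  show le: "card M + ((card V - a) choose b) + ((card V - a - 1) choose (b - 1)) \<le> card V choose b"
    using card_mono[OF _ sub] c3 cD cS card_nsets[OF fV, of b] fV by simp
  show "card M + ((card V - a) choose b) + ((card V - a - 1) choose (b - 1)) = card V choose b"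
    if "card (P \<inter> Q) = a - 1"
  proof -
    have "0 < a" using p fP(1,3) card_gt_0_iff by blast
    have "card (P - Q) = 1"
      using card_Diff_subset_Int[of P Q] fP(1,3) that \<open>0 < a\<close> by simp
    then obtain x where "P - Q = {x}" by (rule card_1_singletonE)
    moreover have "p \<in> P - Q" using p by simp
    ultimately have PQ: "P - Q = {p}" by simp
    have "nsets V b \<subseteq> M \<union> ?D \<union> ?S"
    proof
      fix G assume G: "G \<in> nsets V b"
      show "G \<in> M \<union> ?D \<union> ?S"
      proof (cases "G \<inter> P = {} \<or> G \<inter> Q \<noteq> {}")
        case True then show ?thesis using G by (auto simp: M_def)
      next
        case False
        then obtain x where "x \<in> G" "x \<in> P - Q" by blast
        then have "p \<in> G" using PQ by simp
        then show ?thesis using G False by (auto simp: nsets_def)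
      qed
    qed
    then have "nsets V b = M \<union> ?D \<union> ?S" using sub by auto
    then show ?thesis using c3 cD cS card_nsets[OF fV, of b] by simp
  qed
  show "card (P \<inter> Q) = a - 1"
    if N: "a + b < card V"
      and eq: "card M + ((card V - a) choose b) + ((card V - a - 1) choose (b - 1)) = card V choose b"
  proof -
    have "nsets V b = M \<union> ?D \<union> ?S"
      using card_subset_eq[OF _ sub] c3 cD cS card_nsets[OF fV, of b] eq fV by simp
    have "P - Q = {p}"
    proof (rule ccontr)
      assume "P - Q \<noteq> {p}"
      \<comment> \<open>A \<open>b\<close>-set through a second point \<open>p'\<close> of
        \<open>P - Q\<close> that avoids \<open>p\<close> and \<open>Q\<close> belongs to none of
        the three kinds.\<close>
      then obtain p' where p': "p' \<in> P" "p' \<notin> Q" "p' \<noteq> p" using p by blast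
      have "card (V - Q - {p, p'}) = card V - a - 2"
        using fP p p' fV by (subst card_Diff_subset) (auto simp: card_Diff_subset)
      then have "b - 1 \<le> card (V - Q - {p, p'})" using N b by linarith
      then obtain R where R: "R \<in> nsets (V - Q - {p, p'}) (b - 1)"
        using ex_nset[of "V - Q - {p, p'}" "b - 1"] finite_Diff[OF finite_Diff[OF fV]] by metis
      have "insert p' R \<in> nsets V b"
        using insert_in_nsets[OF R, of V p'] p' fP b by auto
      moreover have "insert p' R \<notin> M \<union> ?D \<union> ?S"
        using nsetsD[OF R] p' by (auto simp: M_def)
      ultimately show False using \<open>nsets V b = M \<union> ?D \<union> ?S\<close> by blast
    qed
    then have "card (P - Q) = 1" by simp
    then show ?thesis using fP card_Int_Diff[of P Q] by linarith
  qed
qed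

text \<open>If \<open>S\<close> omits a point of \<open>P \<inter> Q\<close>, then \<open>G\<close>
  is taken through that point. Otherwise \<open>S\<close> contains \<open>P \<inter> Q\<close>;
  being of the same size as \<open>P\<close> and \<open>Q\<close> and different from both, it omits
  the remaining point of each, and \<open>G\<close> is taken through these two points. The lemma
  rules out a third member of \<open>A\<close> when \<open>B\<close> contains everything that meets
  \<open>P\<close> and \<open>Q\<close>.\<close>

lemma third_set_missed:
  fixes V :: "'a set"
  assumes fV: "finite V" and P: "P \<in> nsets V a" and Q: "Q \<in> nsets V a" and S: "S \<in> nsets V a"
    and neq: "S \<noteq> P" "S \<noteq> Q" "P \<noteq> Q" and PQ: "card (P \<inter> Q) = a - 1" and b: "2 \<le> b"
    and N: "a + b < card V"
  obtains G where "G \<in> nsets V b" "G \<inter> P \<noteq> {}" "G \<inter> Q \<noteq> {}" "G \<inter> S = {}"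
proof -
  have f: "finite P" "finite Q" "finite S" "card P = a" "card Q = a" "card S = a"
    "P \<subseteq> V" "Q \<subseteq> V" "S \<subseteq> V"
    using nsetsD[OF P] nsetsD[OF Q] nsetsD[OF S] by auto
  show ?thesis
  proof (cases "P \<inter> Q \<subseteq> S")
    case False
    then obtain e where e: "e \<in> P" "e \<in> Q" "e \<notin> S" by auto
    have "card (V - S - {e}) = card V - a - 1"
      using f e fV by (subst card_Diff_subset) (auto simp: card_Diff_subset)
    then have "b - 1 \<le> card (V - S - {e})" using N b by linarith
    then obtain R where R: "R \<in> nsets (V - S - {e}) (b - 1)"
      using ex_nset[of "V - S - {e}" "b - 1"] finite_Diff[OF finite_Diff[OF fV]] by metis
    have "insert e R \<in> nsets V b"
      using insert_in_nsets[OF R, of V e] e f b by auto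
    then show ?thesis using that[of "insert e R"] nsetsD[OF R] e by auto
  next
    case True
    obtain p where p: "p \<in> P" "p \<notin> Q" using f neq by (metis card_subset_eq subsetI)
    obtain q where q: "q \<in> Q" "q \<notin> P" using f neq by (metis card_subset_eq subsetI)
    have a: "0 < a" using p f(1,4) card_gt_0_iff by blast
    have Pp: "insert p (P \<inter> Q) = P"
      by (rule card_subset_eq) (use f p PQ a in auto)
    have Qq: "insert q (P \<inter> Q) = Q"
      by (rule card_subset_eq) (use f q PQ a in auto)
    have "p \<notin> S"
    proof
      assume "p \<in> S"
      then have "insert p (P \<inter> Q) \<subseteq> S" using True by simp
      then have "P \<subseteq> S" using Pp by simp
      then show False using neq f card_subset_eq by metis
    qed
    moreover have "q \<notin> S"
    proof
      assume "q \<in> S"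
      then have "insert q (P \<inter> Q) \<subseteq> S" using True by simp
      then have "Q \<subseteq> S" using Qq by simp
      then show False using neq f card_subset_eq by metis
    qed
    ultimately have pq: "p \<notin> S" "q \<notin> S" "p \<noteq> q" using p q by auto
    have "card (V - S - {p, q}) = card V - a - 2"
      using f p q pq fV by (subst card_Diff_subset) (auto simp: card_Diff_subset)
    then have "b - 2 \<le> card (V - S - {p, q})" using N b by linarith
    then obtain R where R: "R \<in> nsets (V - S - {p, q}) (b - 2)"
      using ex_nset[of "V - S - {p, q}" "b - 2"] finite_Diff[OF finite_Diff[OF fV]] by metis
    have "insert q R \<in> nsets (V - S - {p}) (Suc (b - 2))"
      by (rule insert_in_nsets[OF R]) (use q pq f in auto)
    then have "insert p (insert q R) \<in> nsets V (Suc (Suc (b - 2)))"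
      by (rule insert_in_nsets) (use p f in auto)
    moreover have "Suc (Suc (b - 2)) = b" using b by simp
    ultimately have "insert p (insert q R) \<in> nsets V b" by simp
    then show ?thesis using that[of "insert p (insert q R)"] nsetsD[OF R] p q pq by auto
  qed
qed

subsection \<open>Shifting\<close>

definition crossing :: "nat \<Rightarrow> 'a set set \<Rightarrow> 'a set set \<Rightarrow> bool" where
  "crossing t A B \<longleftrightarrow> (\<forall>F\<in>A. \<forall>G\<in>B. t \<le> card (F \<inter> G))"

definition del :: "'a \<Rightarrow> 'a set set \<Rightarrow> 'a set set" where
  "del c F = {G \<in> F. c \<notin> G}"

definition link :: "'a \<Rightarrow> 'a set set \<Rightarrow> 'a set set" where
  "link c F = {G. c \<notin> G \<and> insert c G \<in> F}"

text \<open>Membership is decided on the pair formed by \<open>F\<close> and its image under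
  \<open>transpose i j\<close>: if one of the two is in \<open>A\<close>, the result contains the
  one with \<open>i\<close>; if both are, it contains both. Sets fixed by the transposition keep
  their status. The symmetric form makes it easy to see that shifting commutes with
  \<open>del\<close> and \<open>link\<close> at other points.\<close>

definition shift :: "'a \<Rightarrow> 'a \<Rightarrow> 'a set set \<Rightarrow> 'a set set" where
  "shift i j A = {F. if i \<in> F then F \<in> A \<or> transpose i j ` F \<in> A
                     else F \<in> A \<and> transpose i j ` F \<in> A}"

lemma crossing_mono: "crossing t A B \<Longrightarrow> A' \<subseteq> A \<Longrightarrow> B' \<subseteq> B \<Longrightarrow> crossing t A' B'"
  by (auto simp: crossing_def)

lemma crossing_sym: "crossing t A B \<Longrightarrow> crossing t B A"
  unfolding crossing_def by (metis Int_commute)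

lemma transpose_image_move:
  assumes "j \<in> F" "i \<notin> F"
  shows "transpose i j ` F = insert i (F - {j})"
proof -
  have "transpose i j ` F = insert i (transpose i j ` (F - {j}))"
    using assms by (metis image_insert insert_Diff transpose_apply_second)
  moreover have "transpose i j ` (F - {j}) = F - {j}"
    using assms by (intro transpose_image_eq) auto
  ultimately show ?thesis by simp
qed

lemma transpose_image_twice [simp]: "transpose i j ` transpose i j ` F = F"
  by (simp add: image_image)

lemma card_transpose_image [simp]: "card (transpose i j ` F) = card F"
  by (simp add: card_image)

lemma card_transpose_Int:
  "card (transpose i j ` F \<inter> transpose i j ` G) = card (F \<inter> G)"
  by (metis card_transpose_image image_Int inj_transpose)

lemma transpose_image_nsets:
  assumes "F \<in> nsets V k" "i \<in> V" "j \<in> V"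
  shows "transpose i j ` F \<in> nsets V k"
proof -
  have "transpose i j ` F \<subseteq> transpose i j ` V" using nsetsD(1)[OF assms(1)] by (rule image_mono)
  then have "transpose i j ` F \<subseteq> V" using assms by (simp add: transpose_image_eq)
  then show ?thesis using assms by (auto simp: nsets_def)
qed

lemma shift_subset_nsets:
  assumes "A \<subseteq> nsets V k" "i \<in> V" "j \<in> V"
  shows "shift i j A \<subseteq> nsets V k"
proof
  fix F assume "F \<in> shift i j A"
  then have "F \<in> A \<or> transpose i j ` F \<in> A" by (auto simp: shift_def split: if_splits)
  then show "F \<in> nsets V k"
    using assms transpose_image_nsets[of "transpose i j ` F" V k i j] by auto
qed

text \<open>The customary description, from which cardinality and weight are computed. A member
  without \<open>i\<close> whose image is not in \<open>A\<close> is not fixed by the transposition,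
  so it contains \<open>j\<close> and its image contains \<open>i\<close>.\<close>

lemma shift_eq:
  "shift i j A = (A - {F \<in> A. i \<notin> F \<and> transpose i j ` F \<notin> A}) \<union>
     (`) (transpose i j) ` {F \<in> A. i \<notin> F \<and> transpose i j ` F \<notin> A}" (is "_ = (A - ?M) \<union> ?f ` ?M")
proof (intro equalityI subsetI)
  fix F assume F: "F \<in> shift i j A"
  show "F \<in> (A - ?M) \<union> ?f ` ?M"
  proof (cases "F \<in> A")
    case True then show ?thesis using F by (auto simp: shift_def split: if_splits)
  next
    case False
    then have *: "i \<in> F" "transpose i j ` F \<in> A" using F by (auto simp: shift_def split: if_splits)
    have "i \<notin> transpose i j ` F"
    proof
      assume "i \<in> transpose i j ` F"
      then have "j \<in> F" by (simp add: in_transpose_image_iff)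
      then have "transpose i j ` F = F" using * by (simp add: transpose_image_eq)
      then show False using * False by simp
    qed
    then have "transpose i j ` F \<in> ?M" using * False by simp
    then have "?f (transpose i j ` F) \<in> ?f ` ?M" by (rule imageI)
    then show ?thesis by simp
  qed
next
  fix F assume "F \<in> (A - ?M) \<union> ?f ` ?M"
  then show "F \<in> shift i j A"
  proof
    assume "F \<in> A - ?M" then show ?thesis by (auto simp: shift_def)
  next
    assume "F \<in> ?f ` ?M"
    then obtain G where G: "G \<in> A" "i \<notin> G" "transpose i j ` G \<notin> A" "F = transpose i j ` G" by auto
    have "j \<in> G" using G transpose_image_eq[of i G j] by (metis)
    then have "i \<in> F" using G by (simp add: in_transpose_image_iff)
    then show ?thesis using G by (simp add: shift_def)
  qed
qed

lemma card_shift: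
  assumes "finite A"
  shows "card (shift i j A) = card A"
proof -
  let ?M = "{F \<in> A. i \<notin> F \<and> transpose i j ` F \<notin> A}"
  have inj: "inj_on ((`) (transpose i j)) ?M"
    by (rule inj_on_inverseI[where g = "(`) (transpose i j)"]) simp
  have "card (shift i j A) = card (A - ?M) + card ((`) (transpose i j) ` ?M)"
    unfolding shift_eq by (rule card_Un_disjoint) (use assms in auto)
  also have "card ((`) (transpose i j) ` ?M) = card ?M"
    by (rule card_image[OF inj])
  also have "card (A - ?M) = card A - card ?M"
    by (rule card_Diff_subset) (use assms in auto)
  also have "card A - card ?M + card ?M = card A"
    by (rule le_add_diff_inverse2) (rule card_mono, use assms in auto)
  finally show ?thesis .
qed

text \<open>\<open>F\<close> is newly created, so its image under the transposition lies in
  \<open>A\<close>. Either the image of \<open>G\<close> lies in \<open>B\<close> as well, and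
  transposing both sets keeps the size of the intersection, or \<open>G\<close> is a member of
  \<open>B\<close> containing \<open>i\<close> but not \<open>j\<close>; then exchanging
  \<open>j\<close> for \<open>i\<close> in the member of \<open>A\<close> loses no common
  point.\<close>

lemma crossing_shift_aux:
  assumes cr: "\<And>F G. F \<in> A \<Longrightarrow> G \<in> B \<Longrightarrow> t \<le> card (F \<inter> G)"
    and F: "F \<in> shift i j A" "F \<notin> A" and G: "G \<in> shift i j B" and "finite F"
  shows "t \<le> card (F \<inter> G)"
proof -
  have iF: "i \<in> F" and tF: "transpose i j ` F \<in> A" using F by (auto simp: shift_def split: if_splits)
  have jF: "j \<notin> F" using F iF tF transpose_image_eq[of i F j] by metis
  then have "i \<noteq> j" using iF by auto
  have tFeq: "transpose i j ` F = insert j (F - {i})"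
    using transpose_image_move[of i F j] iF jF by (simp add: transpose_commute)
  show ?thesis
  proof (cases "transpose i j ` G \<in> B")
    case True
    then show ?thesis using cr[OF tF True] by (simp add: card_transpose_Int)
  next
    case False
    then have GB: "G \<in> B" "i \<in> G" using G by (auto simp: shift_def split: if_splits)
    have "j \<notin> G" using False GB transpose_image_eq[of i G j] by metis
    then have "transpose i j ` F \<inter> G \<subseteq> F \<inter> G" using tFeq by auto
    then have "card (transpose i j ` F \<inter> G) \<le> card (F \<inter> G)"
      using \<open>finite F\<close> by (intro card_mono) auto
    then show ?thesis using cr[OF tF GB(1)] by simp
  qed
qed

lemma crossing_shift:
  assumes cr: "crossing t A B" and "\<And>F. F \<in> A \<union> B \<Longrightarrow> finite F"
  shows "crossing t (shift i j A) (shift i j B)"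
  unfolding crossing_def
proof (intro ballI)
  fix F G assume F: "F \<in> shift i j A" and G: "G \<in> shift i j B"
  have fin: "finite H" if "H \<in> shift i j A \<union> shift i j B" for H
  proof -
    have "H \<in> A \<union> B \<or> transpose i j ` H \<in> A \<union> B"
      using that by (auto simp: shift_def split: if_splits)
    then show ?thesis using assms(2) by (metis finite_imageI transpose_image_twice)
  qed
  show "t \<le> card (F \<inter> G)"
  proof (cases "F \<in> A")
    case False
    then show ?thesis using crossing_shift_aux[of A B t F i j G] F G cr fin
      by (auto simp: crossing_def)
  next
    case FA: True
    show ?thesis
    proof (cases "G \<in> B")
      case True then show ?thesis using FA cr by (auto simp: crossing_def)
    next
      case False
      then have "t \<le> card (G \<inter> F)"
        using crossing_shift_aux[of B A t G i j F] F G crossing_sym[OF cr] fin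
        by (auto simp: crossing_def)
      then show ?thesis by (simp add: Int_commute)
    qed
  qed
qed

lemma transpose_image_insert_other:
  "c \<noteq> i \<Longrightarrow> c \<noteq> j \<Longrightarrow> transpose i j ` insert c G = insert c (transpose i j ` G)"
  by (simp add: transpose_apply_other)

lemma del_shift:
  assumes "c \<noteq> i" "c \<noteq> j"
  shows "del c (shift i j A) = shift i j (del c A)"
  using assms by (auto simp: del_def shift_def in_transpose_image_iff transpose_apply_other
      split: if_splits)

lemma link_shift:
  assumes "c \<noteq> i" "c \<noteq> j"
  shows "link c (shift i j A) = shift i j (link c A)"
proof (rule set_eqI)
  fix G
  have "transpose i j ` insert c G = insert c (transpose i j ` G)"
    using assms by (rule transpose_image_insert_other)
  moreover have "c \<in> transpose i j ` G \<longleftrightarrow> c \<in> G"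
    using assms by (simp add: in_transpose_image_iff transpose_apply_other)
  ultimately show "G \<in> link c (shift i j A) \<longleftrightarrow> G \<in> shift i j (link c A)"
    using assms unfolding link_def shift_def by auto
qed

lemma del_subset: "del c F \<subseteq> F"
  by (auto simp: del_def)

lemma del_nsets: "F \<subseteq> nsets V k \<Longrightarrow> del c F \<subseteq> nsets (V - {c}) k"
  by (auto simp: del_def nsets_def)

lemma link_nsets:
  assumes "F \<subseteq> nsets V k"
  shows "link c F \<subseteq> nsets (V - {c}) (k - 1)"
proof
  fix G assume "G \<in> link c F"
  then have "c \<notin> G" "insert c G \<in> nsets V k" using assms by (auto simp: link_def)
  then show "G \<in> nsets (V - {c}) (k - 1)" by (auto simp: nsets_def)
qed

lemma card_del_link:
  assumes "finite F"
  shows "card F = card (del c F) + card (link c F)"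
proof -
  have "bij_betw (insert c) (link c F) {G \<in> F. c \<in> G}"
    by (rule bij_betw_byWitness[where f' = "\<lambda>G. G - {c}"])
      (auto simp: link_def insert_absorb)
  then have "card (link c F) = card {G \<in> F. c \<in> G}" by (rule bij_betw_same_card)
  moreover have "card (del c F \<union> {G \<in> F. c \<in> G}) = card (del c F) + card {G \<in> F. c \<in> G}"
    by (rule card_Un_disjoint) (use assms in \<open>auto simp: del_def\<close>)
  moreover have "del c F \<union> {G \<in> F. c \<in> G} = F" by (auto simp: del_def)
  ultimately show ?thesis by simp
qed

section \<open>Stable families and induction on the weight\<close>

definition shifted :: "nat set \<Rightarrow> nat set set \<Rightarrow> bool" where
  "shifted V A \<longleftrightarrow>
     (\<forall>F\<in>A. \<forall>i\<in>V. \<forall>j\<in>V. i < j \<longrightarrow> j \<in> F \<longrightarrow> i \<notin> F \<longrightarrow> insert i (F - {j}) \<in> A)"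

lemma shiftedD:
  "shifted V A \<Longrightarrow> F \<in> A \<Longrightarrow> i \<in> V \<Longrightarrow> j \<in> V \<Longrightarrow> i < j \<Longrightarrow> j \<in> F \<Longrightarrow> i \<notin> F
    \<Longrightarrow> insert i (F - {j}) \<in> A"
  by (auto simp: shifted_def)

definition weight :: "nat set set \<Rightarrow> nat" where
  "weight A = (\<Sum>F\<in>A. \<Sum>F)"

lemma sum_move_less:
  fixes F :: "nat set"
  assumes "finite F" "i < j" "j \<in> F" "i \<notin> F"
  shows "\<Sum>(insert i (F - {j})) < \<Sum>F"
proof -
  have "\<Sum>F = j + \<Sum>(F - {j})" using assms by (simp add: sum.remove)
  then show ?thesis using assms by simp
qed

lemma weight_shift:
  assumes fA: "finite A" and fin: "\<And>F. F \<in> A \<Longrightarrow> finite F" and ij: "i < j"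
  shows "weight (shift i j A) \<le> weight A"
    and "\<lbrakk>F \<in> A; j \<in> F; i \<notin> F; insert i (F - {j}) \<notin> A\<rbrakk> \<Longrightarrow> weight (shift i j A) < weight A"
proof -
  let ?M = "{F \<in> A. i \<notin> F \<and> transpose i j ` F \<notin> A}"
  have inj: "inj_on ((`) (transpose i j)) ?M"
    by (rule inj_on_inverseI[where g = "(`) (transpose i j)"]) simp
  have jM: "j \<in> F" if "F \<in> ?M" for F
    using that transpose_image_eq[of i F j] by (metis (mono_tags, lifting) mem_Collect_eq)
  have lt: "\<Sum>(transpose i j ` F) < \<Sum>F" if "F \<in> ?M" for F
    using sum_move_less[of F i j] transpose_image_move[of j F i] that jM[OF that] fin ij by auto
  have fM: "finite ?M" using fA by simp
  have eq1: "weight (shift i j A) = weight (A - ?M) + (\<Sum>F\<in>?M. \<Sum>(transpose i j ` F))"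
  proof -
    have "weight (shift i j A) = weight (A - ?M) + weight ((`) (transpose i j) ` ?M)"
      unfolding shift_eq weight_def by (rule sum.union_disjoint) (use fA in auto)
    also have "weight ((`) (transpose i j) ` ?M) = (\<Sum>F\<in>?M. \<Sum>(transpose i j ` F))"
      unfolding weight_def by (simp add: sum.reindex[OF inj])
    finally show ?thesis .
  qed
  have eq2: "weight A = weight (A - ?M) + (\<Sum>F\<in>?M. \<Sum>F)"
    unfolding weight_def by (rule sum.subset_diff) (use fA in auto)
  have "(\<Sum>F\<in>?M. \<Sum>(transpose i j ` F)) \<le> (\<Sum>F\<in>?M. \<Sum>F)"
    by (rule sum_mono) (use lt in \<open>auto intro: less_imp_le\<close>)
  then show "weight (shift i j A) \<le> weight A" using eq1 eq2 by simp
  assume F: "F \<in> A" "j \<in> F" "i \<notin> F" "insert i (F - {j}) \<notin> A"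
  then have "F \<in> ?M" using transpose_image_move[of j F i] by simp
  then have "(\<Sum>F\<in>?M. \<Sum>(transpose i j ` F)) < (\<Sum>F\<in>?M. \<Sum>F)"
    by (intro sum_strict_mono fM lt) auto
  then show "weight (shift i j A) < weight A" using eq1 eq2 by simp
qed

text \<open>Both families undergo the same shift, since otherwise crossing would not be preserved.
  The joint weight drops as soon as one of them really changes, because the weight of the other does
  not grow.\<close>

lemma shift_induct [consumes 3, case_names shifted shift]:
  assumes "finite V" "A \<subseteq> nsets V a" "B \<subseteq> nsets V b"
    and base: "\<And>A B. A \<subseteq> nsets V a \<Longrightarrow> B \<subseteq> nsets V b \<Longrightarrow> shifted V A \<Longrightarrow> shifted V B \<Longrightarrow> P A B"
    and step: "\<And>A B i j. A \<subseteq> nsets V a \<Longrightarrow> B \<subseteq> nsets V b \<Longrightarrow> i \<in> V \<Longrightarrow> j \<in> V \<Longrightarrow> i < j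
      \<Longrightarrow> P (shift i j A) (shift i j B) \<Longrightarrow> P A B"
  shows "P A B"
  using assms(2,3)
proof (induction "weight A + weight B" arbitrary: A B rule: less_induct)
  case less
  have fin: "finite A" "finite B" "\<And>F. F \<in> A \<Longrightarrow> finite F" "\<And>F. F \<in> B \<Longrightarrow> finite F"
    using less.prems assms(1) by (auto intro: finite_subset simp: nsets_def)
  show ?case
  proof (cases "shifted V A \<and> shifted V B")
    case True then show ?thesis using base less.prems by blast
  next
    case False
    then obtain F i j where F: "F \<in> A \<and> insert i (F - {j}) \<notin> A \<or> F \<in> B \<and> insert i (F - {j}) \<notin> B"
      "i \<in> V" "j \<in> V" "i < j" "j \<in> F" "i \<notin> F"
      unfolding shifted_def by blast
    have "weight (shift i j A) + weight (shift i j B) < weight A + weight B"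
      using F(1)
    proof
      assume "F \<in> A \<and> insert i (F - {j}) \<notin> A"
      then show ?thesis
        using weight_shift(2)[of A i j F] weight_shift(1)[of B i j] fin F by (simp add: add_less_le_mono)
    next
      assume "F \<in> B \<and> insert i (F - {j}) \<notin> B"
      then show ?thesis
        using weight_shift(2)[of B i j F] weight_shift(1)[of A i j] fin F by (simp add: add_le_less_mono)
    qed
    then have "P (shift i j A) (shift i j B)"
      by (rule less.hyps) (use less.prems F shift_subset_nsets in \<open>metis\<close>)+
    then show ?thesis using step less.prems F by blast
  qed
qed

subsection \<open>Cross-intersecting pairs of families\<close>

text \<open>Modelled on the layers of sizes \<open>a\<close> and \<open>b\<close> of an
  \<open>s\<close>-union family with \<open>a + b = s + 1\<close>: two \<open>a\<close>-sets then
  share at least \<open>2 * a - s = a - b + 1\<close> points, which is \<open>t\<close>. For stable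
  families the conditions pass to links at the largest point, with \<open>a\<close> and
  \<open>b\<close> lowered by one and \<open>t\<close> unchanged, and they pass to deletions while
  \<open>a + b < card V\<close>.\<close>

definition cross_pair :: "'a set \<Rightarrow> nat \<Rightarrow> nat \<Rightarrow> nat \<Rightarrow> 'a set set \<Rightarrow> 'a set set \<Rightarrow> bool" where
  "cross_pair V a b t A B \<longleftrightarrow> finite V \<and> A \<subseteq> nsets V a \<and> B \<subseteq> nsets V b \<and> a + 1 = b + t \<and>
     a + b \<le> card V \<and> crossing 1 A B \<and> crossing t A A"

lemma cross_pairD:
  assumes "cross_pair V a b t A B"
  shows "finite V" "A \<subseteq> nsets V a" "B \<subseteq> nsets V b" "a + 1 = b + t" "a + b \<le> card V"
    "crossing 1 A B" "crossing t A A" "finite A" "finite B"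
  using assms by (auto simp: cross_pair_def intro: finite_subset[OF _ finite_nsets])

lemma crossing_one_iff:
  assumes "A \<subseteq> nsets V a"
  shows "crossing 1 A B \<longleftrightarrow> (\<forall>F\<in>A. \<forall>G\<in>B. F \<inter> G \<noteq> {})"
proof -
  have "1 \<le> card (F \<inter> G) \<longleftrightarrow> F \<inter> G \<noteq> {}" if "F \<in> A" for F G
    using assms that by (auto simp: nsets_def Suc_le_eq card_gt_0_iff)
  then show ?thesis by (simp add: crossing_def)
qed

lemma crossing_subset_meeting:
  assumes "A \<subseteq> nsets V a" "B \<subseteq> nsets V b" "crossing 1 A B" "P \<in> A"
  shows "B \<subseteq> {G \<in> nsets V b. G \<inter> P \<noteq> {}}"
  using assms crossing_one_iff[OF assms(1), of B] by blast

lemma card_crossing_le: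
  assumes "finite V" "A \<subseteq> nsets V a" "B \<subseteq> nsets V b" "crossing 1 A B" "P \<in> A"
  shows "card B + ((card V - a) choose b) \<le> card V choose b"
proof -
  have "card B \<le> card {G \<in> nsets V b. G \<inter> P \<noteq> {}}"
    by (rule card_mono) (use assms crossing_subset_meeting[OF assms(2-5)] in auto)
  moreover have "P \<subseteq> V" "card P = a" using assms by (auto simp: nsets_def)
  ultimately show ?thesis using card_meeting[OF assms(1), of P b] by simp
qed

lemma card_crossing_le_two:
  assumes "finite V" "A \<subseteq> nsets V a" "B \<subseteq> nsets V b" "crossing 1 A B" "P \<in> A" "Q \<in> A" "P \<noteq> Q" "1 \<le> b"
  shows "card B + ((card V - a) choose b) + ((card V - a - 1) choose (b - 1)) \<le> card V choose b"
proof -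
  have "B \<subseteq> {G \<in> nsets V b. G \<inter> P \<noteq> {} \<and> G \<inter> Q \<noteq> {}}"
    using assms crossing_subset_meeting[OF assms(2-4)] by blast
  then have "card B \<le> card {G \<in> nsets V b. G \<inter> P \<noteq> {} \<and> G \<inter> Q \<noteq> {}}"
    by (rule card_mono[rotated]) (use assms in auto)
  moreover have "P \<in> nsets V a" "Q \<in> nsets V a" using assms by auto
  ultimately show ?thesis using card_meeting_two(1)[OF assms(1) _ _ assms(7,8), of a] by simp
qed

text \<open>Complementation embeds \<open>B\<close> into the \<open>a\<close>-sets, and the
  complement of a member of \<open>B\<close>, being disjoint from it, cannot belong to
  \<open>A\<close>. This is the smallest ground set in the inductions below.\<close>

lemma card_complementary:
  assumes "finite V" "A \<subseteq> nsets V a" "B \<subseteq> nsets V b" "crossing 1 A B" "card V = a + b"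
  shows "card A + card B \<le> card V choose b"
proof -
  let ?C = "(\<lambda>G. V - G) ` B"
  have inj: "inj_on (\<lambda>G. V - G) B"
    by (rule inj_on_inverseI[where g = "\<lambda>G. V - G"])
      (use assms(3) in \<open>auto simp: nsets_def\<close>)
  have sub: "?C \<subseteq> nsets V a"
    using assms by (auto simp: nsets_def card_Diff_subset)
  have "A \<inter> ?C = {}"
  proof -
    have "V - G \<notin> A" if "G \<in> B" for G
    proof
      assume "V - G \<in> A"
      then have "(V - G) \<inter> G \<noteq> {}" using assms(4) crossing_one_iff[OF assms(2)] that by metis
      then show False by auto
    qed
    then show ?thesis by auto
  qed
  then have "card (A \<union> ?C) = card A + card ?C"
    by (intro card_Un_disjoint) (use assms sub in \<open>auto intro: finite_subset[OF _ finite_nsets]\<close>)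
  moreover have "card (A \<union> ?C) \<le> card (nsets V a)"
    by (rule card_mono) (use assms sub in auto)
  moreover have "card (nsets V a) = card V choose b"
    using card_nsets[OF assms(1), of a] assms(5) binomial_symmetric[of b "a + b"] by simp
  ultimately show ?thesis by (simp add: card_image[OF inj])
qed

lemma del_link_meet:
  assumes "A \<subseteq> nsets V a" "crossing 1 A B" "F \<in> del m A" "G \<in> link m B"
  shows "F \<inter> G \<noteq> {}"
proof -
  have "F \<in> A" "m \<notin> F" "insert m G \<in> B" using assms by (auto simp: del_def link_def)
  then have "F \<inter> insert m G \<noteq> {}" using assms(2) crossing_one_iff[OF assms(1)] by metis
  then show ?thesis using \<open>m \<notin> F\<close> by auto
qed

lemma crossing_full_eq:
  assumes "A \<subseteq> nsets V a" "crossing a A A" "F \<in> A" "finite V"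
  shows "A = {F}"
proof -
  have "G = F" if "G \<in> A" for G
  proof -
    have f: "finite F" "finite G" "card F = a" "card G = a"
      using assms that by (auto simp: nsets_def)
    have "a \<le> card (F \<inter> G)" using assms that by (auto simp: crossing_def)
    then have "F \<inter> G = F" "F \<inter> G = G"
      using f by (intro card_seteq; simp)+
    then show ?thesis by simp
  qed
  then show ?thesis using assms(3) by blast
qed

lemma shifted_del:
  assumes "shifted V A"
  shows "shifted (V - {m}) (del m A)"
  using assms by (auto simp: shifted_def del_def)

lemma shifted_link:
  assumes "shifted V A"
  shows "shifted (V - {m}) (link m A)"
  unfolding shifted_def
proof (intro ballI impI)
  fix F i j
  assume *: "F \<in> link m A" "i \<in> V - {m}" "j \<in> V - {m}" "i < j" "j \<in> F" "i \<notin> F"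
  then have "insert i (insert m F - {j}) \<in> A"
    by (intro shiftedD[OF assms]) (auto simp: link_def)
  moreover have "insert i (insert m F - {j}) = insert m (insert i (F - {j}))" using * by auto
  ultimately show "insert i (F - {j}) \<in> link m A" using * by (auto simp: link_def)
qed

text \<open>If \<open>F\<close> and \<open>G\<close> met in only \<open>t - 1\<close> points, then
  \<open>F\<close>, \<open>G\<close> and \<open>m\<close> together would cover just
  \<open>a + b - t\<close> points, fewer than \<open>card V\<close>. Shifting \<open>m\<close> to an
  uncovered point \<open>v\<close> in the member of \<open>A\<close> would produce an intersection
  of size \<open>t - 1\<close>.\<close>

lemma crossing_link:
  assumes fV: "finite V" and A: "A \<subseteq> nsets V a" and B: "B \<subseteq> nsets V b"
    and sh: "shifted V A" and cr: "crossing t A B" and N: "a + b < card V + t" and V: "V \<noteq> {}"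
  defines "m \<equiv> Max V"
  shows "crossing t (link m A) (link m B)"
  unfolding crossing_def
proof (intro ballI)
  fix F G assume F: "F \<in> link m A" and G: "G \<in> link m B"
  then have FG: "m \<notin> F" "insert m F \<in> A" "m \<notin> G" "insert m G \<in> B" by (auto simp: link_def)
  have f: "finite F" "finite G" "card (insert m F) = a" "card (insert m G) = b"
    "insert m F \<subseteq> V" "insert m G \<subseteq> V"
    using FG A B by (auto dest!: subsetD[of _ "nsets V _"] simp: nsets_def)
  have "t \<le> card (insert m F \<inter> insert m G)" using cr FG unfolding crossing_def by blast
  moreover have "insert m F \<inter> insert m G = insert m (F \<inter> G)" by auto
  ultimately have t: "t \<le> Suc (card (F \<inter> G))" using FG f by simp
  show "t \<le> card (F \<inter> G)"
  proof (rule ccontr)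
    assume less: "\<not> t \<le> card (F \<inter> G)"
    have "card (F \<union> G) + card (F \<inter> G) = card F + card G"
      using card_Un_Int[OF f(1,2)] by simp
    then have "card (insert m (F \<union> G)) < card V" using f FG N less t by simp
    then have "\<not> V \<subseteq> insert m (F \<union> G)"
      using f by (metis card_mono finite_UnI finite_insert leD)
    then obtain v where v: "v \<in> V" "v \<noteq> m" "v \<notin> F" "v \<notin> G" by auto
    have mV: "m \<in> V" unfolding m_def using fV V by simp
    have "v < m" unfolding m_def using v fV m_def by (metis Max_ge le_neq_implies_less)
    then have "insert v (insert m F - {m}) \<in> A"
      by (intro shiftedD[OF sh FG(2)]) (use v mV in auto)
    then have "t \<le> card (insert v (insert m F - {m}) \<inter> insert m G)"
      using cr FG unfolding crossing_def by blast
    moreover have "insert v (insert m F - {m}) \<inter> insert m G = F \<inter> G" using v FG by auto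
    ultimately show False using less by simp
  qed
qed

lemma cross_pair_del:
  assumes "cross_pair V a b t A B" "a + b < card V" "m \<in> V"
  shows "cross_pair (V - {m}) a b t (del m A) (del m B)"
  using assms del_nsets[of A V a m] del_nsets[of B V b m]
    crossing_mono[OF _ del_subset del_subset, of _ A B m m]
    crossing_mono[OF _ del_subset del_subset, of _ A A m m]
  unfolding cross_pair_def by auto

lemma cross_pair_link:
  assumes cp: "cross_pair V a b t A B" and "shifted V A" "1 \<le> a" "1 \<le> b"
  shows "cross_pair (V - {Max V}) (a - 1) (b - 1) t (link (Max V) A) (link (Max V) B)"
proof -
  note D = cross_pairD[OF cp]
  have V: "V \<noteq> {}" using D assms by auto
  have "crossing 1 (link (Max V) A) (link (Max V) B)"
    by (rule crossing_link[OF D(1-3) assms(2) D(6)]) (use D V in auto)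
  moreover have "crossing t (link (Max V) A) (link (Max V) A)"
    by (rule crossing_link[OF D(1,2,2) assms(2) D(7)]) (use D assms V in auto)
  ultimately show ?thesis
    using D assms V link_nsets[OF D(2)] link_nsets[OF D(3)] Max_in[OF D(1) V]
    unfolding cross_pair_def by auto
qed

text \<open>A member containing the largest point omits some smaller one and can be shifted
  there.\<close>

lemma shifted_del_nonempty:
  assumes "finite V" "A \<subseteq> nsets V a" "shifted V A" "A \<noteq> {}" "a < card V"
  shows "del (Max V) A \<noteq> {}"
proof -
  obtain F where F: "F \<in> A" using assms by auto
  have f: "F \<subseteq> V" "finite F" "card F = a" using F assms by (auto simp: nsets_def)
  show ?thesis
  proof (cases "Max V \<in> F")
    case False then show ?thesis using F by (auto simp: del_def)
  next
    case True
    have "\<not> V \<subseteq> F" using f assms by (metis card_mono leD)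
    then obtain v where v: "v \<in> V" "v \<notin> F" by auto
    have "v \<le> Max V" using v assms by simp
    then have "v < Max V" using v True by (cases "v = Max V") auto
    then have "insert v (F - {Max V}) \<in> A"
      by (intro shiftedD[OF assms(3) F]) (use v True f in auto)
    moreover have "Max V \<notin> insert v (F - {Max V})" using \<open>v < Max V\<close> by auto
    ultimately show ?thesis unfolding del_def by blast
  qed
qed

text \<open>The member of least element sum admits no further downward move, so it is an initial
  segment of \<open>V\<close>.\<close>

lemma shifted_initial_member:
  assumes "X \<subseteq> nsets V d" "shifted V X" "X \<noteq> {}"
  obtains P where "P \<in> X" "\<And>i j. i \<in> V \<Longrightarrow> j \<in> P \<Longrightarrow> i < j \<Longrightarrow> i \<in> P"
proof -
  obtain P where P: "P \<in> X" "\<And>F. F \<in> X \<Longrightarrow> \<Sum>P \<le> \<Sum>F"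
    using ex_has_least_nat[of "\<lambda>F. F \<in> X" _ "\<lambda>F. \<Sum>F"] assms(3) by blast
  have f: "finite P" "P \<subseteq> V" using P(1) assms(1) by (auto simp: nsets_def)
  have "i \<in> P" if "i \<in> V" "j \<in> P" "i < j" for i j
  proof (rule ccontr)
    assume "i \<notin> P"
    then have "insert i (P - {j}) \<in> X"
      using shiftedD[OF assms(2) P(1), of i j] that f by blast
    then show False
      using P(2) sum_move_less[of P i j] that \<open>i \<notin> P\<close> f by (meson leD)
  qed
  then show ?thesis using that P(1) by blast
qed

text \<open>A downward move in the second member by element sum can lead only to \<open>P\<close>.
  Hence that member is one exchange away from \<open>P\<close>, and the exchange must involve the
  last point of \<open>P\<close> and the first point outside. The outcome depends on
  \<open>P\<close> alone, not on \<open>X\<close>, so two stable families with at least two members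
  each have their first two members in common.\<close>

lemma shifted_second_member:
  assumes fV: "finite V" and X: "X \<subseteq> nsets V d" and sh: "shifted V X" and "2 \<le> card X"
    and P: "P \<in> X" "\<And>i j. i \<in> V \<Longrightarrow> j \<in> P \<Longrightarrow> i < j \<Longrightarrow> i \<in> P"
  shows "insert (Min (V - P)) (P - {Max P}) \<in> X" "insert (Min (V - P)) (P - {Max P}) \<noteq> P"
proof -
  have f: "finite F" "card F = d" "F \<subseteq> V" if "F \<in> X" for F
    using that X by (auto simp: nsets_def)
  have "X - {P} \<noteq> {}" using assms(4) card_mono[of "{P}" X] by auto
  then obtain Q where Q: "Q \<in> X" "Q \<noteq> P" "\<And>F. F \<in> X \<Longrightarrow> F \<noteq> P \<Longrightarrow> \<Sum>Q \<le> \<Sum>F"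
    using ex_has_least_nat[of "\<lambda>F. F \<in> X - {P}" _ "\<lambda>F. \<Sum>F"] by blast
  have Q_move: "insert i (Q - {j}) = P" if "i \<in> V" "j \<in> Q" "i < j" "i \<notin> Q" for i j
  proof (rule ccontr)
    assume *: "insert i (Q - {j}) \<noteq> P"
    have "insert i (Q - {j}) \<in> X"
      using shiftedD[OF sh Q(1), of i j] that f(3)[OF Q(1)] by blast
    then show False
      using Q(3) * sum_move_less[of Q i j] that f(1)[OF Q(1)] by (meson leD)
  qed
  have "\<not> P \<subseteq> Q" "\<not> Q \<subseteq> P" using P(1) Q(1,2) f by (metis card_subset_eq)+
  then obtain p q where pq: "p \<in> P" "p \<notin> Q" "q \<in> Q" "q \<notin> P" by blast
  have "p < q"
  proof (rule ccontr)
    assume "\<not> p < q"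
    then have "q < p" using pq by (metis linorder_neqE_nat)
    then show False using P(2)[of q p] pq f(3)[OF Q(1)] by auto
  qed
  then have eq: "insert p (Q - {q}) = P" using Q_move pq f(3)[OF P(1)] by auto
  have "Max P = p"
  proof (rule Max_eqI)
    fix y assume y: "y \<in> P"
    show "y \<le> p"
    proof (rule ccontr)
      assume "\<not> y \<le> p"
      then have "p < y" by simp
      then have "y \<in> Q" using y eq by auto
      then have "insert p (Q - {y}) = P" using Q_move \<open>p < y\<close> pq f(3)[OF P(1)] by auto
      then show False using y \<open>p < y\<close> by auto
    qed
  qed (use f[OF P(1)] pq in auto)
  moreover have "Min (V - P) = q"
  proof (rule Min_eqI)
    fix y assume y: "y \<in> V - P"
    show "q \<le> y"
    proof (rule ccontr)
      assume "\<not> q \<le> y"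
      then have "y < q" by simp
      moreover have "y \<notin> Q" using y eq \<open>y < q\<close> by auto
      ultimately have "insert y (Q - {q}) = P" using Q_move y pq by auto
      then show False using y by auto
    qed
  qed (use f[OF Q(1)] pq fV in auto)
  moreover have "insert q (P - {p}) = Q" using eq pq by auto
  ultimately show "insert (Min (V - P)) (P - {Max P}) \<in> X" "insert (Min (V - P)) (P - {Max P}) \<noteq> P"
    using Q by auto
qed

text \<open>These are the first two members by element sum. They differ by one exchange, and since
  \<open>a + 1 < card V\<close> neither of them reaches the largest point.\<close>

lemma shifted_two_members:
  assumes fV: "finite V" and A: "A \<subseteq> nsets V a" and sh: "shifted V A" and cA: "2 \<le> card A"
    and N: "a + 1 < card V"
  obtains P Q where "P \<in> del (Max V) A" "Q \<in> del (Max V) A" "P \<noteq> Q" "card (P \<inter> Q) = a - 1"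
proof -
  have "A \<noteq> {}" using cA by auto
  obtain P where P: "P \<in> A" "\<And>i j. i \<in> V \<Longrightarrow> j \<in> P \<Longrightarrow> i < j \<Longrightarrow> i \<in> P"
    by (rule shifted_initial_member[OF A sh \<open>A \<noteq> {}\<close>]) blast
  define q where "q = Min (V - P)"
  define Q where "Q = insert q (P - {Max P})"
  have Q: "Q \<in> A" "Q \<noteq> P"
    using shifted_second_member[OF fV A sh cA P] unfolding Q_def q_def by auto
  have f: "finite P" "card P = a" "P \<subseteq> V" "finite Q" "card Q = a" using P Q A by (auto simp: nsets_def)
  have cVP: "card (V - P) = card V - a" using f fV by (simp add: card_Diff_subset)
  then have "card (V - P) \<noteq> 0" using N by linarith
  then have "V - P \<noteq> {}" by (metis card.empty)
  then have q: "q \<in> V - P" unfolding q_def using fV by (intro Min_in) auto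
  have "P \<noteq> {}"
  proof
    assume "P = {}"
    then show False using f Q by simp
  qed
  then have "Max P \<in> P" using f by simp
  moreover have "P \<inter> Q = P - {Max P}" using q unfolding Q_def by auto
  ultimately have c: "card (P \<inter> Q) = a - 1" using f by simp
  have le: "v \<le> Max V" if "v \<in> V" for v using that fV by simp
  have mP: "Max V \<notin> P"
  proof
    assume "Max V \<in> P"
    moreover have "q \<noteq> Max V" using q calculation by auto
    ultimately show False using P(2)[of q "Max V"] le[of q] q by auto
  qed
  have "q \<noteq> Max V"
  proof
    assume qm: "q = Max V"
    have "V - P \<subseteq> {q}"
    proof
      fix v assume v: "v \<in> V - P"
      then have "q \<le> v" unfolding q_def using fV by (intro Min_le) auto
      then show "v \<in> {q}" using le[of v] v qm by simp
    qed
    then have "card (V - P) \<le> 1" using card_mono[of "{q}"] by fastforce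
    then show False using cVP N by simp
  qed
  then have "Max V \<notin> Q" using mP unfolding Q_def by auto
  then show ?thesis using that[of P Q] P(1) Q c mP by (auto simp: del_def)
qed

section \<open>Bounds for stable pairs, by deleting the largest point\<close>

lemma choose_Suc_pos: "0 < n \<Longrightarrow> 0 < k \<Longrightarrow> n choose k = ((n - 1) choose (k - 1)) + ((n - 1) choose k)"
  by (cases n; cases k) auto

text \<open>The constant 1 on the right stands for one member of \<open>A\<close>. In the induction
  it is spent on the deleted families, so the links at the largest point must satisfy the
  corresponding inequality without it.\<close>

lemma shifted_cross_pair_bound:
  assumes "cross_pair V a b t A B" "shifted V A" "shifted V B" "A \<noteq> {}" "1 \<le> b"
  shows "card A + card B + ((card V - a) choose b) \<le> (card V choose b) + 1"
  using assms
proof (induction "card V" arbitrary: V A B a b)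
  case 0
  then show ?case by (auto simp: cross_pair_def)
next
  case (Suc c V A B a b)
  note D = cross_pairD[OF Suc.prems(1)] and cV = Suc.hyps(2)[symmetric]
  show ?case
  proof (cases "card V = a + b")
    case True
    then show ?thesis using card_complementary[OF D(1-3,6)] by simp
  next
    case False
    then have N: "a + b \<le> c" using D cV by simp
    show ?thesis
    proof (cases "b = 1")
      case True
      \<comment> \<open>Here \<open>b = 1\<close> forces \<open>t = a\<close>, so distinct members
        of \<open>A\<close> are impossible.\<close>
      obtain F where "F \<in> A" using Suc.prems by auto
      moreover have "A = {F}"
        by (rule crossing_full_eq[OF D(2) _ _ D(1)]) (use True D \<open>F \<in> A\<close> in auto)
      ultimately show ?thesis using card_crossing_le[OF D(1-3,6), of F] by simp
    next
      case False
      then obtain b' where b: "b = Suc b'" "1 \<le> b'" using Suc.prems by (cases b) auto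
      define m where "m = Max V"
      have V: "V \<noteq> {}" using cV by auto
      have m: "m \<in> V" unfolding m_def using V D by simp
      have cV': "card (V - {m}) = c" using m cV D by simp
      have cp0: "cross_pair (V - {m}) a b t (del m A) (del m B)"
        by (rule cross_pair_del[OF Suc.prems(1) _ m]) (use N cV in auto)
      have ne0: "del m A \<noteq> {}"
        unfolding m_def by (rule shifted_del_nonempty[OF D(1,2)]) (use Suc.prems N cV in auto)
      have B0: "card (del m A) + card (del m B) + ((c - a) choose b) \<le> (c choose b) + 1"
        using Suc.hyps(1)[OF cV'[symmetric] cp0] shifted_del ne0 Suc.prems cV' by metis
      have eqs: "card A = card (del m A) + card (link m A)" "card B = card (del m B) + card (link m B)"
        using card_del_link D by auto
      have Na: "card V - a = Suc (c - a)" using N cV by simp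
      \<comment> \<open>If the link of \<open>A\<close> is empty, one member of \<open>A\<close>
        avoiding \<open>m\<close> already limits the link of \<open>B\<close>. Otherwise induction
        applies with \<open>a - 1\<close>; the complement of an \<open>(a - 1)\<close>-set has one
        point more, and the resulting extra term \<open>(c - a) choose (b' - 1)\<close> absorbs the
        constant 1.\<close>
      have B1: "card (link m A) + card (link m B) + ((c - a) choose b') \<le> c choose b'"
      proof (cases "link m A = {}")
        case True
        obtain P where P: "P \<in> del m A" using ne0 by auto
        have "crossing 1 (del m A) (link m B)"
          using crossing_one_iff[OF cross_pairD(2)[OF cp0]] del_link_meet[OF D(2,6)] by metis
        then have "card (link m B) + ((card (V - {m}) - a) choose (b - 1)) \<le> card (V - {m}) choose (b - 1)"
          using card_crossing_le[OF cross_pairD(1,2)[OF cp0] link_nsets[OF D(3)] _ P] by simp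
        then show ?thesis using True b cV' by simp
      next
        case ne1: False
        have a: "1 \<le> a"
        proof (rule ccontr)
          assume "\<not> 1 \<le> a"
          then have "a = 0" by simp
          then have "A \<subseteq> {{}}" using D(2) by simp
          then show False using ne1 by (auto simp: link_def)
        qed
        have cp1: "cross_pair (V - {m}) (a - 1) b' t (link m A) (link m B)"
          using cross_pair_link[OF Suc.prems(1,2) a] b by (simp add: m_def)
        have bd: "card (link m A) + card (link m B) + ((card (V - {m}) - (a - 1)) choose b')
          \<le> (card (V - {m}) choose b') + 1"
          by (rule Suc.hyps(1)[OF cV'[symmetric] cp1])
            (use Suc.prems shifted_link ne1 b in auto)
        then have "card (link m A) + card (link m B) + (Suc (c - a) choose b') \<le> (c choose b') + 1"
        proof -
          have "card (V - {m}) - (a - 1) = Suc (c - a)" using a N cV' by simp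
          then show ?thesis using bd unfolding cV' by simp
        qed
        moreover have "(c - a) choose (b' - 1) \<ge> 1"
          using N b by (simp add: Suc_le_eq)
        moreover have "Suc (c - a) choose b' = ((c - a) choose (b' - 1)) + ((c - a) choose b')"
          using choose_Suc_pos[of "Suc (c - a)" b'] b by simp
        ultimately show ?thesis by linarith
      qed
      show ?thesis using B0 B1 eqs Na b cV by simp
    qed
  qed
qed

text \<open>If a member of \<open>B\<close> missed \<open>E\<close>, then
  \<open>a + b \<le> card V\<close> would leave enough points to complete \<open>E\<close> to an
  \<open>a\<close>-set disjoint from it.\<close>

lemma supersets_meeting:
  assumes "finite V" "E \<subseteq> V" "card E \<le> a" "a + b \<le> card V"
    and "B \<subseteq> nsets V b" "crossing 1 {F \<in> nsets V a. E \<subseteq> F} B"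
  shows "B \<subseteq> {G \<in> nsets V b. G \<inter> E \<noteq> {}}"
proof
  fix G assume G: "G \<in> B"
  have g: "G \<subseteq> V" "finite G" "card G = b" using G assms by (auto simp: nsets_def)
  have "G \<inter> E \<noteq> {}"
  proof
    assume GE: "G \<inter> E = {}"
    have fE: "finite E" using assms finite_subset by auto
    have "card (G \<union> E) = b + card E" using g fE GE by (simp add: card_Un_disjoint)
    then have "card (V - (G \<union> E)) = card V - b - card E"
      using g fE assms by (simp add: card_Diff_subset)
    then have "a - card E \<le> card (V - (G \<union> E))" using assms by linarith
    then obtain R where R: "R \<in> nsets (V - (G \<union> E)) (a - card E)"
      using ex_nset[of "V - (G \<union> E)"] assms(1) by (metis finite_Diff)
    have "card (R \<union> E) = a"
      using nsetsD[OF R] fE assms by (subst card_Un_disjoint) auto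
    then have "R \<union> E \<in> nsets V a"
      using nsetsD[OF R] assms by (intro nsetsI) auto
    then have "R \<union> E \<in> {F \<in> nsets V a. E \<subseteq> F}" by simp
    then have "1 \<le> card ((R \<union> E) \<inter> G)" using assms(6) G unfolding crossing_def by blast
    moreover have "(R \<union> E) \<inter> G = {}" using nsetsD[OF R] GE by auto
    ultimately show False by simp
  qed
  then show "G \<in> {G \<in> nsets V b. G \<inter> E \<noteq> {}}" using G assms by auto
qed

text \<open>Sets in \<open>A\<close> meet every \<open>T \<union> {v}\<close> in at least \<open>card T\<close> points. Omitting a point of \<open>T\<close> would
  force them to contain all of \<open>V - T\<close>.\<close>
lemma supersets_if_link_singleton:
  assumes fV: "finite V" and A: "A \<subseteq> nsets V (Suc t)" and sh: "shifted V A" and cr: "crossing t A A"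
    and V: "V \<noteq> {}" and N: "t + 3 < card V" and ne: "link (Max V) A \<noteq> {}"
  shows "\<exists>T\<subseteq>V. card T = t \<and> A = {F \<in> nsets V (Suc t). T \<subseteq> F}"
proof -
  define m where "m = Max V"
  obtain T where T: "T \<in> link m A" using ne m_def by auto
  then have mT: "m \<notin> T" "insert m T \<in> A" by (auto simp: link_def)
  then have t: "finite T" "T \<subseteq> V" "card T = t" using A by (auto simp: nsets_def)
  have ins: "insert v T \<in> A" if "v \<in> V" "v \<notin> T" for v
  proof (cases "v = m")
    case True then show ?thesis using mT by simp
  next
    case False
    then have "v < m" unfolding m_def using that fV m_def by (metis Max_ge le_neq_implies_less)
    then have "insert v (insert m T - {m}) \<in> A"
      by (intro shiftedD[OF sh mT(2)]) (use that fV V m_def False in auto)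
    then show ?thesis using mT by simp
  qed
  have "A = {F \<in> nsets V (Suc t). T \<subseteq> F}"
  proof (intro equalityI subsetI)
    fix F assume F: "F \<in> A"
    have f: "finite F" "F \<subseteq> V" "card F = Suc t" using F A by (auto simp: nsets_def)
    have "T \<subseteq> F"
    proof (rule ccontr)
      assume "\<not> T \<subseteq> F"
      then have "F \<inter> T \<subset> T" by auto
      then have "card (F \<inter> T) < t" using psubset_card_mono[OF t(1)] t by auto
      have vF: "v \<in> F" if v: "v \<in> V" "v \<notin> T" for v
      proof (rule ccontr)
        assume "v \<notin> F"
        then have "F \<inter> insert v T = F \<inter> T" by auto
        moreover have "t \<le> card (F \<inter> insert v T)" using cr F ins[OF v] unfolding crossing_def by blast
        ultimately show False using \<open>card (F \<inter> T) < t\<close> by simp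
      qed
      have c: "card (V - T) \<le> card (F - T)" by (rule card_mono) (use f vF in auto)
      have "card V - t \<le> card (F - T)" using c t fV by (simp add: card_Diff_subset)
      have "\<not> V \<subseteq> T"
      proof
        assume "V \<subseteq> T"
        then have "card V \<le> t" using t card_mono by metis
        then show False using N by simp
      qed
      then obtain v where v: "v \<in> V" "v \<notin> T" by auto
      have "t \<le> card (F \<inter> insert v T)" using cr F ins[OF v] unfolding crossing_def by blast
      also have "\<dots> \<le> card (insert v (F \<inter> T))" by (rule card_mono) (use f in auto)
      also have "\<dots> \<le> Suc (card (F \<inter> T))" using f by (simp add: card_insert_le_m1 card_insert_if)
      finally have "t \<le> Suc (card (F \<inter> T))" .
      moreover have "card F = card (F \<inter> T) + card (F - T)" using card_Int_Diff[OF f(1)] .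
      ultimately show False using \<open>card V - t \<le> card (F - T)\<close> f N by linarith
    qed
    then show "F \<in> {F \<in> nsets V (Suc t). T \<subseteq> F}" using F A by auto
  next
    fix F assume "F \<in> {F \<in> nsets V (Suc t). T \<subseteq> F}"
    then have F: "T \<subseteq> F" "finite F" "F \<subseteq> V" "card F = Suc t" by (auto simp: nsets_def)
    then have "card (F - T) = 1" using t by (simp add: card_Diff_subset)
    then obtain v where v: "F - T = {v}" by (rule card_1_singletonE)
    then have "F = insert v T" using F(1) by auto
    moreover have "v \<in> V" "v \<notin> T" using v F by auto
    ultimately show "F \<in> A" using ins by simp
  qed
  then show ?thesis using t by blast
qed

text \<open>If no member of \<open>A\<close> contains the largest point, tightness leaves at least
  \<open>t + 1\<close> singletons in the link of \<open>B\<close>. Each of these points lies in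
  every member of \<open>A\<close>, whereas two distinct members share at most \<open>t\<close>
  points. The result describes the links of tight pairs with \<open>b = 3\<close>.\<close>

lemma shifted_cross_pair_bound_eq:
  assumes cp: "cross_pair V (Suc t) 2 t A B" and sh: "shifted V A" "shifted V B" and "A \<noteq> {}"
    and N: "t + 3 < card V"
    and eq: "card A + card B + ((card V - Suc t) choose 2) = (card V choose 2) + 1"
  shows "card A = 1 \<or> (\<exists>T\<subseteq>V. card T = t \<and> A = {F \<in> nsets V (Suc t). T \<subseteq> F})"
proof -
  note D = cross_pairD[OF cp]
  define m where "m = Max V"
  have V: "V \<noteq> {}" using N by auto
  have m: "m \<in> V" unfolding m_def using V D by simp
  show ?thesis
  proof (cases "link m A = {}")
    case False
    then show ?thesis
      using supersets_if_link_singleton[OF D(1,2) sh(1) D(7) V] N m_def by auto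
  next
    case True
    obtain c where c: "card V = Suc c" using N by (cases "card V") auto
    have cV': "card (V - {m}) = c" using m c D by simp
    have cp0: "cross_pair (V - {m}) (Suc t) 2 t (del m A) (del m B)"
      by (rule cross_pair_del[OF cp _ m]) (use N in auto)
    have eqs: "card A = card (del m A) + card (link m A)" "card B = card (del m B) + card (link m B)"
      using card_del_link D by auto
    have ne0: "del m A \<noteq> {}" using eqs(1) True \<open>A \<noteq> {}\<close> D by auto
    have B0: "card (del m A) + card (del m B) + ((c - Suc t) choose 2) \<le> (c choose 2) + 1"
      using shifted_cross_pair_bound[OF cp0 shifted_del shifted_del ne0] sh cV' by simp
    have Na: "card V - Suc t = Suc (c - Suc t)" using N c by simp
    have "Suc (Suc 0) = 2" by simp
    then have "card V choose 2 = c + (c choose 2)"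
      "(card V - Suc t) choose 2 = (c - Suc t) + ((c - Suc t) choose 2)"
      using c Na binomial_Suc_Suc[of _ 1] by (metis One_nat_def choose_one)+
    then have B1: "Suc t \<le> card (link m B)" using eq B0 eqs True N c by simp
    have "card A = 1"
    proof (rule ccontr)
      assume "card A \<noteq> 1"
      obtain P where P: "P \<in> del m A" using ne0 by auto
      have "del m A \<noteq> {P}" using \<open>card A \<noteq> 1\<close> eqs True by auto
      then obtain Q where PQ: "P \<in> del m A" "Q \<in> del m A" "P \<noteq> Q" using P by blast
      have f: "finite P" "card P = Suc t" "finite Q" "card Q = Suc t"
        using PQ cross_pairD(2)[OF cp0] by (auto simp: nsets_def)
      have sub: "link m B \<subseteq> (\<lambda>y. {y}) ` (P \<inter> Q)"
      proof
        fix G assume G: "G \<in> link m B"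
        then have "G \<in> nsets (V - {m}) 1" using link_nsets[OF D(3)] by auto
        then obtain y where y: "G = {y}" "y \<noteq> m" by (auto simp: nsets_def card_1_singleton_iff)
        have "y \<in> F" if "F \<in> del m A" for F
          using del_link_meet[OF D(2,6) that G] y by auto
        then show "G \<in> (\<lambda>y. {y}) ` (P \<inter> Q)" using y PQ by auto
      qed
      have "card (link m B) \<le> card ((\<lambda>y. {y}) ` (P \<inter> Q))"
        by (rule card_mono[OF _ sub]) (use f in auto)
      also have "\<dots> \<le> card (P \<inter> Q)" by (rule card_image_le) (use f in auto)
      also have "\<dots> < Suc t"
      proof -
        have "\<not> P \<subseteq> Q" using card_subset_eq[OF f(3), of P] f PQ(3) by auto
        then have "P \<inter> Q \<subset> P" by auto
        then show ?thesis using psubset_card_mono[OF f(1)] f by auto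
      qed
      finally show False using B1 by simp
    qed
    then show ?thesis by simp
  qed
qed

lemma choose_two_Suc: "Suc n choose 2 = n + (n choose 2)"
  using binomial_Suc_Suc[of n 1] by (simp add: numeral_2_eq_2)

lemma choose_three_Suc: "Suc n choose 3 = (n choose 2) + (n choose 3)"
  using binomial_Suc_Suc[of n 2] by (simp add: numeral_3_eq_3)

text \<open>The constant 2 belongs to two members of \<open>A\<close> avoiding the largest point, so
  the deleted families satisfy the hypotheses with the same \<open>a\<close> and \<open>b\<close>.
  The links must then do without the constant. If the link of \<open>A\<close> is non-empty, the
  one-member bound for the links is already strong enough, because Pascal's rule leaves a
  surplus.\<close>

lemma shifted_cross_pair_bound_two:
  assumes "cross_pair V a b t A B" "shifted V A" "shifted V B" "2 \<le> card A" "3 \<le> b"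
  shows "card A + card B + ((card V - a) choose b) + ((card V - a - 1) choose (b - 1))
    \<le> (card V choose b) + 2"
    and "a + b < card V \<Longrightarrow>
      card A + card B + ((card V - a) choose b) + ((card V - a - 1) choose (b - 1))
        = (card V choose b) + 2 \<Longrightarrow>
      card A = 2 \<or> (b = 3 \<and> (\<exists>E\<subseteq>V. (card E = t \<or> card E = t + 1) \<and>
         A = {F \<in> nsets V a. E \<subseteq> F} \<and> B = {G \<in> nsets V b. G \<inter> E \<noteq> {}}))"
proof -
  \<comment> \<open>The contribution of the links together with its equality case. It requires no
    induction and serves both the bound and the description of tight pairs.\<close>
  have step: "card (link (Max V) A) + card (link (Max V) B) + ((card V - 1 - a) choose (b - 1))
      + ((card V - 1 - a - 1) choose (b - 1 - 1)) \<le> ((card V - 1) choose (b - 1)) \<and>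
    (card (link (Max V) A) + card (link (Max V) B) + ((card V - 1 - a) choose (b - 1))
      + ((card V - 1 - a - 1) choose (b - 1 - 1)) = ((card V - 1) choose (b - 1)) \<longrightarrow>
      card A = 2 \<or> (b = 3 \<and> (\<exists>E\<subseteq>V. (card E = t \<or> card E = t + 1) \<and> A = {F \<in> nsets V a. E \<subseteq> F})))"
    if cp: "cross_pair V a b t A B" and sh: "shifted V A" "shifted V B" and cA: "2 \<le> card A"
      and b: "3 \<le> b" and N: "a + b < card V" for V a b and A B :: "nat set set"
  proof -
    note D = cross_pairD[OF cp]
    define m where "m = Max V"
    define c where "c = card V - 1"
    have c: "card V = Suc c" using N c_def by simp
    have V: "V \<noteq> {}" using N by auto
    have m: "m \<in> V" unfolding m_def using V D by simp
    have cV': "card (V - {m}) = c" using m c D by simp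
    have cp0: "cross_pair (V - {m}) a b t (del m A) (del m B)"
      by (rule cross_pair_del[OF cp N m])
    note D0 = cross_pairD[OF cp0]
    have ld: "F \<inter> G \<noteq> {}" if "F \<in> del m A" "G \<in> link m B" for F G
      using del_link_meet[OF D(2,6) that] .
    have cr01: "crossing 1 (del m A) (link m B)"
      using ld crossing_one_iff[OF D0(2)] by blast
    have lB: "link m B \<subseteq> nsets (V - {m}) (b - 1)" by (rule link_nsets[OF D(3)])
    have cAB: "card A = card (del m A) + card (link m A)" using card_del_link D by auto
    show ?thesis
    proof (cases "link m A = {}")
      case l0: True
      obtain P Q where PQ: "P \<in> del m A" "Q \<in> del m A" "P \<noteq> Q" "card (P \<inter> Q) = a - 1"
        by (rule shifted_two_members[OF D(1,2) sh(1) cA]) (use N b in \<open>auto simp: m_def\<close>)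
      have PQn: "P \<in> nsets (V - {m}) a" "Q \<in> nsets (V - {m}) a" using PQ D0(2) by auto
      define M where "M = {G \<in> nsets (V - {m}) (b - 1). G \<inter> P \<noteq> {} \<and> G \<inter> Q \<noteq> {}}"
      have sub: "link m B \<subseteq> M"
        using crossing_subset_meeting[OF D0(2) lB cr01] PQ unfolding M_def by blast
      have fM: "finite M" unfolding M_def using D by simp
      have cM: "card M + ((c - a) choose (b - 1)) + ((c - a - 1) choose (b - 1 - 1)) = c choose (b - 1)"
        using card_meeting_two(2)[OF _ PQn PQ(3) _ PQ(4), of "b - 1"] b D cV' unfolding M_def by simp
      have "card (link m B) \<le> card M" by (rule card_mono[OF fM sub])
      \<comment> \<open>Here the link of \<open>B\<close> consists of all sets meeting
        \<open>P\<close> and \<open>Q\<close>, and a third member of \<open>A\<close> would be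
        disjoint from one of them.\<close>
      moreover have "card A = 2" if "card (link m B) = card M"
      proof (rule ccontr)
        assume "card A \<noteq> 2"
        then have "card (del m A) > card {P, Q}" using cAB l0 cA PQ(3) by simp
        then have "\<not> del m A \<subseteq> {P, Q}" by (metis card_mono finite.emptyI finite_insert leD)
        then obtain S where S: "S \<in> del m A" "S \<noteq> P" "S \<noteq> Q" by auto
        obtain G where "G \<in> nsets (V - {m}) (b - 1)" "G \<inter> P \<noteq> {}" "G \<inter> Q \<noteq> {}" "G \<inter> S = {}"
          by (rule third_set_missed[OF D0(1) PQn _ S(2,3) PQ(3,4), of "b - 1"])
            (use S D0 b N cV' c in auto)
        moreover have "link m B = M" using card_subset_eq[OF fM sub that] .
        ultimately show False using ld[OF S(1), of G] by (auto simp: M_def)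
      qed
      ultimately show ?thesis using cM l0 unfolding m_def[symmetric] c_def[symmetric] by auto
    next
      case l1: False
      have a: "2 \<le> a"
      proof (rule ccontr)
        assume "\<not> 2 \<le> a"
        then show False using D(4) b by simp
      qed
      have cp1: "cross_pair (V - {m}) (a - 1) (b - 1) t (link m A) (link m B)"
        using cross_pair_link[OF cp sh(1)] a b by (simp add: m_def)
      note D1 = cross_pairD[OF cp1]
      define r where "r = c - a - 1"
      have r: "c - (a - 1) = Suc (Suc r)" "c - a = Suc r" "c - a - 1 = r" "b \<le> Suc r"
        using N a b c r_def by auto
      have "card (link m A) + card (link m B) + ((card (V - {m}) - (a - 1)) choose (b - 1))
        \<le> (card (V - {m}) choose (b - 1)) + 1"
        by (rule shifted_cross_pair_bound[OF cp1 shifted_link shifted_link l1]) (use sh b in auto)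
      then have bd: "card (link m A) + card (link m B) + (Suc (Suc r) choose (b - 1)) \<le> (c choose (b - 1)) + 1"
        unfolding cV' r(1) .
      \<comment> \<open>Pascal's rule, applied twice, splits
        \<open>Suc (Suc r) choose (b - 1)\<close> into the two required binomials and
        \<open>r choose q\<close>. The last term pays for the constant 1; since
        \<open>q < r\<close>, it equals 1 only for \<open>q = 0\<close>. Hence tightness with a
        non-empty link of \<open>A\<close> occurs only for \<open>b = 3\<close>.\<close>
      define q where "q = b - 3"
      have q: "b = Suc (Suc (Suc q))" using b q_def by simp
      have slack: "r choose q \<ge> 1" using r q by (simp add: Suc_le_eq)
      have le: "card (link m A) + card (link m B) + ((c - a) choose (b - 1)) + ((c - a - 1) choose (b - 1 - 1))
        \<le> (c choose (b - 1))"
        using bd slack r q by simp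
      have "card A = 2 \<or> (b = 3 \<and> (\<exists>E\<subseteq>V. (card E = t \<or> card E = t + 1) \<and> A = {F \<in> nsets V a. E \<subseteq> F}))"
        if eq: "card (link m A) + card (link m B) + ((c - a) choose (b - 1)) + ((c - a - 1) choose (b - 1 - 1))
        = (c choose (b - 1))"
      proof -
        have eq1: "card (link m A) + card (link m B) + (Suc (Suc r) choose (b - 1)) = (c choose (b - 1)) + 1"
          and "r choose q = 1"
          using eq bd slack r q by simp_all
        have "q = 0"
        proof (rule ccontr)
          assume "q \<noteq> 0"
          then have "r choose q = ((r - 1) choose (q - 1)) + ((r - 1) choose q)"
            using choose_Suc_pos[of r q] r q by simp
          moreover have "(r - 1) choose (q - 1) \<ge> 1" "(r - 1) choose q \<ge> 1"
            using r q by (auto simp: Suc_le_eq)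
          ultimately show False using \<open>r choose q = 1\<close> by simp
        qed
        then have b3: "b = 3" using q by simp
        then have at: "a = Suc (Suc t)" using D by simp
        \<comment> \<open>The links attain the one-member bound, so
          \<open>shifted_cross_pair_bound_eq\<close> applies. If the link of \<open>A\<close> has a
          single member, that member itself is taken as \<open>T\<close>; this is how kernels of
          size \<open>t + 1\<close> arise.\<close>
        obtain T where T: "T \<subseteq> V - {m}" "card T = t \<or> card T = t + 1"
          "link m A = {F \<in> nsets (V - {m}) (Suc t). T \<subseteq> F}"
        proof -
          have "card (link m A) = 1 \<or> (\<exists>T\<subseteq>V - {m}. card T = t \<and> link m A = {F \<in> nsets (V - {m}) (Suc t). T \<subseteq> F})"
          proof (rule shifted_cross_pair_bound_eq[where B = "link m B"])
            show "cross_pair (V - {m}) (Suc t) 2 t (link m A) (link m B)" using cp1 b3 at by simp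
            have "c - Suc t = Suc (Suc r)" using r at by simp
            then show "card (link m A) + card (link m B) + ((card (V - {m}) - Suc t) choose 2)
              = (card (V - {m}) choose 2) + 1" using eq1 b3 unfolding cV' by simp
          qed (use shifted_link sh l1 N cV' c b3 at in auto)
          then show ?thesis
          proof
            assume "card (link m A) = 1"
            then obtain T where T: "link m A = {T}" by (rule card_1_singletonE)
            then have T': "T \<in> nsets (V - {m}) (Suc t)" using D1 at by auto
            have "{F \<in> nsets (V - {m}) (Suc t). T \<subseteq> F} = {T}"
            proof -
              have "F = T" if "F \<in> nsets (V - {m}) (Suc t)" "T \<subseteq> F" for F
                using card_subset_eq[of F T] that T' by (auto simp: nsets_def)
              then show ?thesis using T' by auto
            qed
            then show ?thesis using that[of T] T T' by (auto simp: nsets_def)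
          next
            assume "\<exists>T\<subseteq>V - {m}. card T = t \<and> link m A = {F \<in> nsets (V - {m}) (Suc t). T \<subseteq> F}"
            then show ?thesis using that by blast
          qed
        qed
        have fT: "finite T" using T D(1) finite_subset by (metis finite_Diff)
        \<comment> \<open>Every pair in the link of \<open>B\<close> meets \<open>T\<close>, and the
          tight total leaves no room to omit a pair that does.\<close>
        have lBfull: "link m B = {G \<in> nsets (V - {m}) 2. G \<inter> T \<noteq> {}}"
        proof (rule card_subset_eq)
          show sub: "link m B \<subseteq> {G \<in> nsets (V - {m}) 2. G \<inter> T \<noteq> {}}"
            by (rule supersets_meeting[where a = "Suc t"])
              (use D1 T b3 at cV' N c in auto)
          have "card (link m A) = (c - card T) choose (Suc t - card T)"
            using card_supersets[of "V - {m}" T "Suc t"] T D cV' by auto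
          moreover have "card {G \<in> nsets (V - {m}) 2. G \<inter> T \<noteq> {}} + ((c - card T) choose 2) = c choose 2"
            using card_meeting[of "V - {m}" T 2] T D cV' by auto
          moreover have "c - Suc t = Suc (Suc r)" "c - t = Suc (Suc (Suc r))" using r at by simp_all
          ultimately show "card (link m B) = card {G \<in> nsets (V - {m}) 2. G \<inter> T \<noteq> {}}"
            using eq1 b3 at T(2) by (auto simp: choose_two_Suc)
        qed (use D in simp)
        have "A = {F \<in> nsets V a. T \<subseteq> F}"
        proof (intro equalityI subsetI)
          fix F assume F: "F \<in> A"
          have f: "finite F" "F \<subseteq> V" "card F = a" using F D by (auto simp: nsets_def)
          have "T \<subseteq> F"
          proof (cases "m \<in> F")
            case True
            then have "F - {m} \<in> link m A" using F by (simp add: link_def insert_absorb)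
            then show ?thesis using T by auto
          next
            case False
            show ?thesis
            proof (rule subsetI, rule ccontr)
              \<comment> \<open>A member of \<open>A\<close> avoiding \<open>m\<close> and a point
                \<open>y\<close> of \<open>T\<close> would be missed by a pair \<open>{y, v}\<close>
                in the link of \<open>B\<close>.\<close>
              fix y assume y: "y \<in> T" "y \<notin> F"
              have "card (insert m (insert y F)) < card V"
                using f N b card_insert_le_m1[of "card F + 3" "insert y F" m] by (simp add: card_insert_if)
              then have "\<not> V \<subseteq> insert m (insert y F)" using f by (metis card_mono finite_insert leD)
              then obtain v where v: "v \<in> V" "v \<noteq> m" "v \<noteq> y" "v \<notin> F" by auto
              have "{y, v} \<in> link m B" unfolding lBfull using v y T by auto
              then show False using ld[of F "{y, v}"] F False y v by (auto simp: del_def)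
            qed
          qed
          then show "F \<in> {F \<in> nsets V a. T \<subseteq> F}" using F D by auto
        next
          fix F assume "F \<in> {F \<in> nsets V a. T \<subseteq> F}"
          then have F: "T \<subseteq> F" "finite F" "F \<subseteq> V" "card F = a" by (auto simp: nsets_def)
          show "F \<in> A"
          proof (cases "m \<in> F")
            case True
            then have "F - {m} \<in> link m A" using F T at by (auto simp: nsets_def)
            then show ?thesis using True by (simp add: link_def insert_absorb)
          next
            case False
            \<comment> \<open>Exchanging a point \<open>x\<close> outside \<open>T\<close> for
              \<open>m\<close> leads to the part of \<open>A\<close> already known from the link;
              the shift from \<open>m\<close> to \<open>x\<close> then returns to
              \<open>F\<close>.\<close>
            have "card T < card F" using T(2) F at by auto
            then obtain x where x: "x \<in> F" "x \<notin> T" using fT by (metis card_mono leD subsetI)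
            have "F - {x} \<in> link m A" using F T at x False by (auto simp: nsets_def)
            then have "insert m (F - {x}) \<in> A" by (simp add: link_def)
            moreover have "x < m" unfolding m_def using x F False m_def D(1)
              by (metis Max_ge le_neq_implies_less subsetD)
            ultimately have "insert x (insert m (F - {x}) - {m}) \<in> A"
              using shiftedD[OF sh(1), of "insert m (F - {x})" x m] x F m by blast
            moreover have "insert x (insert m (F - {x}) - {m}) = F" using x False by auto
            ultimately show ?thesis by simp
          qed
        qed
        then show ?thesis using b3 T by blast
      qed
      then show ?thesis using le unfolding m_def[symmetric] c_def[symmetric] by blast
    qed
  qed
  have bound: "card A + card B + ((card V - a) choose b) + ((card V - a - 1) choose (b - 1))
    \<le> (card V choose b) + 2"
    if "cross_pair V a b t A B" "shifted V A" "shifted V B" "2 \<le> card A" "3 \<le> b" for V and A B :: "nat set set"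
    using that
  proof (induction "card V" arbitrary: V A B)
    case 0
    then show ?case by (auto simp: cross_pair_def)
  next
    case (Suc c V A B)
    note D = cross_pairD[OF Suc.prems(1)] and cV = Suc.hyps(2)[symmetric]
    show ?case
    proof (cases "card V = a + b")
      case True
      then show ?thesis using card_complementary[OF D(1-3,6)] by simp
    next
      case False
      then have N: "a + b < card V" using D by simp
      define m where "m = Max V"
      have V: "V \<noteq> {}" using cV by auto
      have m: "m \<in> V" unfolding m_def using V D by simp
      have cV': "card (V - {m}) = c" using m cV D by simp
      obtain P Q where PQ: "P \<in> del m A" "Q \<in> del m A" "P \<noteq> Q"
        by (rule shifted_two_members[OF D(1,2) Suc.prems(2,4)])
          (use N Suc.prems(5) in \<open>auto simp: m_def\<close>)
      have cp0: "cross_pair (V - {m}) a b t (del m A) (del m B)"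
        by (rule cross_pair_del[OF Suc.prems(1) N m])
      have "card {P, Q} \<le> card (del m A)"
        by (rule card_mono) (use PQ cross_pairD[OF cp0] in auto)
      then have c0: "2 \<le> card (del m A)" using PQ by simp
      have B0: "card (del m A) + card (del m B) + ((c - a) choose b) + ((c - a - 1) choose (b - 1))
        \<le> (c choose b) + 2"
        using Suc.hyps(1)[OF cV'[symmetric] cp0 shifted_del shifted_del c0] Suc.prems cV' by simp
      have B1: "card (link m A) + card (link m B) + ((c - a) choose (b - 1)) + ((c - a - 1) choose (b - 1 - 1))
         \<le> (c choose (b - 1))"
        using step[OF Suc.prems N] cV unfolding m_def by simp
      have eqs: "card A = card (del m A) + card (link m A)" "card B = card (del m B) + card (link m B)"
        using card_del_link D by auto
      have "card V choose b = (c choose (b - 1)) + (c choose b)"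
        "(card V - a) choose b = ((c - a) choose (b - 1)) + ((c - a) choose b)"
        "(card V - a - 1) choose (b - 1) = ((c - a - 1) choose (b - 1 - 1)) + ((c - a - 1) choose (b - 1))"
        using choose_Suc_pos[of "card V" b] choose_Suc_pos[of "card V - a" b]
          choose_Suc_pos[of "card V - a - 1" "b - 1"] cV N Suc.prems(5) by (auto simp: diff_commute)
      then show ?thesis using B0 B1 eqs by linarith
    qed
  qed
  show "card A + card B + ((card V - a) choose b) + ((card V - a - 1) choose (b - 1))
    \<le> (card V choose b) + 2" by (rule bound[OF assms])
  assume N: "a + b < card V" and eq: "card A + card B + ((card V - a) choose b)
      + ((card V - a - 1) choose (b - 1)) = (card V choose b) + 2"
  note D = cross_pairD[OF assms(1)]
  define m where "m = Max V"
  have V: "V \<noteq> {}" using N by auto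
  have m: "m \<in> V" unfolding m_def using V D by simp
  define c where "c = card V - 1"
  have cV: "card V = Suc c" using N c_def by simp
  have cV': "card (V - {m}) = c" using m cV D by simp
  obtain P Q where PQ: "P \<in> del m A" "Q \<in> del m A" "P \<noteq> Q"
    by (rule shifted_two_members[OF D(1,2) assms(2,4)]) (use N assms(5) in \<open>auto simp: m_def\<close>)
  have cp0: "cross_pair (V - {m}) a b t (del m A) (del m B)"
    by (rule cross_pair_del[OF assms(1) N m])
  have "card {P, Q} \<le> card (del m A)"
    by (rule card_mono) (use PQ cross_pairD[OF cp0] in auto)
  then have c0: "2 \<le> card (del m A)" using PQ by simp
  have B0: "card (del m A) + card (del m B) + ((c - a) choose b) + ((c - a - 1) choose (b - 1))
    \<le> (c choose b) + 2"
    using bound[OF cp0 shifted_del shifted_del c0] assms cV' by simp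
  have eqs: "card A = card (del m A) + card (link m A)" "card B = card (del m B) + card (link m B)"
    using card_del_link D by auto
  have "card V choose b = (c choose (b - 1)) + (c choose b)"
    "(card V - a) choose b = ((c - a) choose (b - 1)) + ((c - a) choose b)"
    "(card V - a - 1) choose (b - 1) = ((c - a - 1) choose (b - 1 - 1)) + ((c - a - 1) choose (b - 1))"
    using choose_Suc_pos[of "card V" b] choose_Suc_pos[of "card V - a" b]
      choose_Suc_pos[of "card V - a - 1" "b - 1"] cV N assms(5) by (auto simp: diff_commute)
  moreover note S = step[OF assms N, folded m_def c_def]
  ultimately have "card (link m A) + card (link m B) + ((c - a) choose (b - 1))
      + ((c - a - 1) choose (b - 1 - 1)) = c choose (b - 1)"
    using conjunct1[OF S] B0 eqs eq by linarith
  then have "card A = 2 \<or> (b = 3 \<and> (\<exists>E\<subseteq>V. (card E = t \<or> card E = t + 1) \<and> A = {F \<in> nsets V a. E \<subseteq> F}))"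
    using conjunct2[OF S] by blast
  then show "card A = 2 \<or> (b = 3 \<and> (\<exists>E\<subseteq>V. (card E = t \<or> card E = t + 1) \<and>
         A = {F \<in> nsets V a. E \<subseteq> F} \<and> B = {G \<in> nsets V b. G \<inter> E \<noteq> {}}))"
  proof
    assume "b = 3 \<and> (\<exists>E\<subseteq>V. (card E = t \<or> card E = t + 1) \<and> A = {F \<in> nsets V a. E \<subseteq> F})"
    then obtain E where b: "b = 3" and
      E: "E \<subseteq> V" "card E = t \<or> card E = t + 1" "A = {F \<in> nsets V a. E \<subseteq> F}"
      by blast
    \<comment> \<open>With \<open>card V = r + t + 3\<close> and \<open>a = t + 2\<close> the
      binomials can be expanded. For either size of \<open>E\<close> the two star families together
      attain the tight total, so \<open>B\<close> omits no set meeting \<open>E\<close>.\<close>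
    define r where "r = card V - t - 3"
    have a: "a = t + 2" using b D by simp
    have V3: "card V = Suc (Suc (Suc (r + t)))" using N a b r_def by simp
    have cE: "card E \<le> a" using E a by auto
    have sub: "B \<subseteq> {G \<in> nsets V 3. G \<inter> E \<noteq> {}}"
      by (rule supersets_meeting[OF D(1) E(1) cE]) (use D b E in auto)
    have cA: "card A = (card V - card E) choose (a - card E)"
      using card_supersets[OF D(1) E(1) cE] E by simp
    have cM: "card {G \<in> nsets V 3. G \<inter> E \<noteq> {}} + ((card V - card E) choose 3) = card V choose 3"
      by (rule card_meeting[OF D(1) E(1)])
    have "card V - a = Suc r" "card V - a - 1 = r" using V3 a by auto
    then have eq': "card A + card B + (Suc r choose 3) + (r choose 2) = (card V choose 3) + 2"
      using eq b by simp
    have "card {G \<in> nsets V 3. G \<inter> E \<noteq> {}} \<le> card B"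
      using E(2)
    proof
      assume E: "card E = t"
      then have "card V - card E = Suc (Suc (Suc r))" using V3 by simp
      then show ?thesis using eq' cA cM E a by (simp add: choose_two_Suc choose_three_Suc)
    next
      assume E: "card E = t + 1"
      then have "card V - card E = Suc (Suc r)" using V3 by simp
      then show ?thesis using eq' cA cM E a by (simp add: choose_two_Suc choose_three_Suc)
    qed
    then have "B = {G \<in> nsets V 3. G \<inter> E \<noteq> {}}"
      using sub D(1) by (intro card_seteq) auto
    then show ?thesis using b E by blast
  qed simp
qed

section \<open>Undoing shifts: bounds for arbitrary pairs\<close>

lemma cross_pair_shift:
  assumes "cross_pair V a b t A B" "i \<in> V" "j \<in> V"
  shows "cross_pair V a b t (shift i j A) (shift i j B)"
proof -
  note D = cross_pairD[OF assms(1)]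
  have fin: "finite F" if "F \<in> A \<union> B" for F using that D by (auto simp: nsets_def)
  show ?thesis
    using D assms shift_subset_nsets[OF D(2)] shift_subset_nsets[OF D(3)]
      crossing_shift[OF D(6), of i j] crossing_shift[OF D(7), of i j] fin
    unfolding cross_pair_def by auto
qed

lemma cross_pair_bound:
  fixes V :: "nat set"
  assumes cp: "cross_pair V a b t A B" and "A \<noteq> {}" "1 \<le> b"
  shows "card A + card B + ((card V - a) choose b) \<le> (card V choose b) + 1"
proof -
  have "cross_pair V a b t A B \<longrightarrow> A \<noteq> {} \<longrightarrow>
    card A + card B + ((card V - a) choose b) \<le> (card V choose b) + 1"
  proof (rule shift_induct[OF cross_pairD(1-3)[OF cp]], goal_cases)
    case (1 A B)
    then show ?case using shifted_cross_pair_bound assms(3) by blast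
  next
    case (2 A B i j)
    show ?case
    proof (intro impI)
      assume c: "cross_pair V a b t A B" and "A \<noteq> {}"
      have e: "card (shift i j A) = card A" "card (shift i j B) = card B"
        using card_shift cross_pairD[OF c] by auto
      have "shift i j A \<noteq> {}"
        using e(1) \<open>A \<noteq> {}\<close> cross_pairD(8)[OF c] by auto
      then show "card A + card B + ((card V - a) choose b) \<le> (card V choose b) + 1"
        using 2(6) cross_pair_shift[OF c 2(3,4)] e by simp
    qed
  qed
  then show ?thesis using assms by blast
qed

text \<open>Exchanging one point at a time leads from \<open>T1\<close> to \<open>T2\<close>.
  Somewhere on the way membership in \<open>X\<close> is lost between two sets that differ by a
  single exchange.\<close>

lemma johnson_boundary:
  assumes "finite V" "T1 \<in> nsets V k" "T1 \<in> X" "T2 \<in> nsets V k" "T2 \<notin> X"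
  shows "\<exists>T T'. T \<in> nsets V k \<and> T \<in> X \<and> T' \<in> nsets V k \<and> T' \<notin> X \<and> card (T \<union> T') = k + 1"
  using assms(2,3)
proof (induction "card (T1 - T2)" arbitrary: T1 rule: less_induct)
  case less
  have f: "finite T1" "finite T2" "card T1 = k" "card T2 = k" "T1 \<subseteq> V" "T2 \<subseteq> V"
    using less.prems assms by (auto simp: nsets_def)
  have "T1 \<noteq> T2" using less.prems assms by auto
  then have "\<not> T1 \<subseteq> T2" "\<not> T2 \<subseteq> T1" using f card_subset_eq by metis+
  then obtain x y where xy: "x \<in> T1" "x \<notin> T2" "y \<in> T2" "y \<notin> T1" by blast
  let ?T = "insert y (T1 - {x})"
  have kpos: "0 < k" using xy f card_gt_0_iff by blast
  have T: "?T \<in> nsets V k" using f xy kpos assms(1) by (intro nsetsI) auto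
  show ?case
  proof (cases "?T \<in> X")
    case True
    have "?T - T2 \<subset> T1 - T2" using xy by auto
    then have "card (?T - T2) < card (T1 - T2)" using f by (intro psubset_card_mono) auto
    then show ?thesis using less.hyps T True by blast
  next
    case False
    have "T1 \<union> ?T = insert y T1" using xy by auto
    then have "card (T1 \<union> ?T) = k + 1" using f xy by simp
    then show ?thesis using less.prems T False by blast
  qed
qed

text \<open>Every member of \<open>A\<close> contains \<open>E\<close> or, if
  \<open>i \<in> E\<close> and \<open>j \<notin> E\<close>, the set obtained from \<open>E\<close>
  by exchanging \<open>i\<close> for \<open>j\<close>. If neither kernel sufficed for all of
  \<open>A\<close>, two completions differing by one exchange would behave differently under the
  shift, and some member of \<open>B\<close> would then miss a member of \<open>A\<close>.\<close>

lemma unshift_supersets: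
  assumes fV: "finite V" and A: "A \<subseteq> nsets V a" and B: "B \<subseteq> nsets V b" and cr: "crossing 1 A B"
    and N: "a + b < card V" and ij: "i \<in> V" "j \<in> V" and E: "E \<subseteq> V" "card E < a" and b: "1 \<le> b"
    and sA: "shift i j A = {F \<in> nsets V a. E \<subseteq> F}"
    and sB: "shift i j B = {G \<in> nsets V b. G \<inter> E \<noteq> {}}"
  shows "\<exists>E'\<subseteq>V. card E' = card E \<and> A = {F \<in> nsets V a. E' \<subseteq> F} \<and> B = {G \<in> nsets V b. G \<inter> E' \<noteq> {}}"
proof -
  have fAB: "finite A" "finite B" using A B fV by (auto intro: finite_subset[OF _ finite_nsets])
  have fE: "finite E" using E fV finite_subset by auto
  \<comment> \<open>One inclusion suffices: shifting preserves cardinalities, and star families over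
    kernels of equal size are equally large.\<close>
  have finish: ?thesis
    if E': "E' \<subseteq> V" "card E' = card E" and sub: "A \<subseteq> {F \<in> nsets V a. E' \<subseteq> F}" for E'
  proof -
    have "card A = card {F \<in> nsets V a. E \<subseteq> F}" using card_shift[OF fAB(1), of i j] sA by simp
    also have "\<dots> = card {F \<in> nsets V a. E' \<subseteq> F}"
      using card_supersets[OF fV E(1), of a] card_supersets[OF fV E'(1), of a] E E' by simp
    finally have Aeq: "A = {F \<in> nsets V a. E' \<subseteq> F}" by (intro card_subset_eq sub) (use fV in auto)
    have "B \<subseteq> {G \<in> nsets V b. G \<inter> E' \<noteq> {}}"
      by (rule supersets_meeting[OF fV E'(1)]) (use E E' N B cr Aeq in auto)
    moreover have "card B = card {G \<in> nsets V b. G \<inter> E' \<noteq> {}}"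
      using card_shift[OF fAB(2), of i j] sB card_meeting[OF fV E(1), of b] card_meeting[OF fV E'(1), of b] E'
      by simp
    ultimately have "B = {G \<in> nsets V b. G \<inter> E' \<noteq> {}}" by (intro card_subset_eq) (use fV in auto)
    then show ?thesis using E' Aeq by blast
  qed
  have moved: "j \<in> F \<and> i \<notin> F \<and> insert i (F - {j}) \<notin> A \<and> E \<subseteq> insert i (F - {j})"
    if F: "F \<in> A" "\<not> E \<subseteq> F" for F
  proof -
    have "F \<notin> shift i j A" using sA F by auto
    then have *: "i \<notin> F" "transpose i j ` F \<notin> A" using F(1) by (auto simp: shift_def split: if_splits)
    then have jF: "j \<in> F" using F transpose_image_eq[of i F j] by metis
    have eq: "transpose i j ` F = insert i (F - {j})" by (rule transpose_image_move[OF jF *(1)])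
    have "transpose i j ` F \<in> shift i j A"
      using F jF * by (simp add: shift_def in_transpose_image_iff)
    then show ?thesis using * jF eq sA by auto
  qed
  show ?thesis
  proof (cases "i \<in> E \<and> j \<notin> E")
    case False
    have "A \<subseteq> {F \<in> nsets V a. E \<subseteq> F}"
    proof
      fix F assume F: "F \<in> A"
      have "E \<subseteq> F" using moved[OF F] False by blast
      then show "F \<in> {F \<in> nsets V a. E \<subseteq> F}" using F A by auto
    qed
    then show ?thesis using finish[of E] E by simp
  next
    case iE: True
    then have ne: "i \<noteq> j" by auto
    define E' where "E' = insert j (E - {i})"
    have E': "E' \<subseteq> V" "finite E'" using E ij fE unfolding E'_def by auto
    have cE': "card E' = card E"
      using iE fE card_Suc_Diff1[of E i] unfolding E'_def by simp
    consider "A \<subseteq> {F \<in> nsets V a. E \<subseteq> F}" | "A \<subseteq> {F \<in> nsets V a. E' \<subseteq> F}"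
      | "\<exists>F1\<in>A. \<exists>F2\<in>A. \<not> E' \<subseteq> F1 \<and> \<not> E \<subseteq> F2" using A by blast
    then show ?thesis
    proof cases
      case 1 then show ?thesis using finish[of E] E by simp
    next
      case 2 then show ?thesis using finish[of E'] E' cE' by simp
    next
      case 3
      then obtain F1 F2 where F: "F1 \<in> A" "F2 \<in> A" "\<not> E' \<subseteq> F1" "\<not> E \<subseteq> F2" by blast
      have F1: "E \<subseteq> F1" "j \<notin> F1"
      proof -
        show "E \<subseteq> F1" using moved[OF F(1)] F(3) unfolding E'_def by blast
        then show "j \<notin> F1" using F(3) unfolding E'_def by blast
      qed
      have F2: "E' \<subseteq> F2" "i \<notin> F2" "insert i (F2 - {j}) \<notin> A"
        using moved[OF F(2,4)] unfolding E'_def by auto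
      have fF: "finite F1" "finite F2" "card F1 = a" "card F2 = a" "F1 \<subseteq> V" "F2 \<subseteq> V"
        using F A by (auto simp: nsets_def)
      define W where "W = V - E - {j}"
      define k where "k = a - card E"
      \<comment> \<open>\<open>X\<close> collects the completions of \<open>E\<close> that lay in
        \<open>A\<close> before the shift. \<open>F1\<close> provides one inside \<open>X\<close>,
        and the image of \<open>F2\<close> one outside.\<close>
      define X where "X = {T. E \<union> T \<in> A}"
      have T1: "F1 - E \<in> nsets W k" "F1 - E \<in> X"
        using fF F1 F(1) fE fV unfolding W_def k_def X_def
        by (auto simp: nsets_def card_Diff_subset Un_absorb1 Un_Diff_cancel)
      have "insert i (F2 - {j}) = E \<union> (F2 - E')" using F2 iE unfolding E'_def by auto
      then have T2: "F2 - E' \<in> nsets W k" "F2 - E' \<notin> X"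
        using fF F2 E' cE' fV iE unfolding W_def k_def X_def
        by (auto simp: nsets_def card_Diff_subset E'_def[symmetric]) (auto simp: E'_def)
      obtain T T' where T: "T \<in> nsets W k" "T \<in> X" "T' \<in> nsets W k" "T' \<notin> X" "card (T \<union> T') = k + 1"
        using johnson_boundary[of W "F1 - E" k X "F2 - E'"] T1 T2 fV W_def by auto
      have tW: "T \<subseteq> W" "T' \<subseteq> W" "finite T" "finite T'" "card T' = k" using T by (auto simp: nsets_def)
      have cW: "card W = card V - card E - 1"
        unfolding W_def using fV fE E ij iE by (simp add: card_Diff_subset)
      have "card (W - (T \<union> T')) = card W - (k + 1)"
        using tW T(5) by (simp add: card_Diff_subset)
      \<comment> \<open>Because \<open>T\<close> and \<open>T'\<close> differ by one exchange, their
        union has only \<open>k + 1\<close> points. This is exactly what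
        \<open>a + b < card V\<close> allows while leaving \<open>b - 1\<close> points for
        \<open>S\<close>.\<close>
      then have "b - 1 \<le> card (W - (T \<union> T'))" using cW N E unfolding k_def by linarith
      then obtain S where S: "S \<in> nsets (W - (T \<union> T')) (b - 1)"
        using ex_nset[of "W - (T \<union> T')" "b - 1"] fV W_def by (metis finite_Diff)
      have s: "S \<subseteq> W" "S \<inter> T = {}" "S \<inter> T' = {}" "finite S" using S by (auto simp: nsets_def)
      have "insert i S \<in> nsets V b"
        using insert_in_nsets[OF S, of V i] ij b iE unfolding W_def by auto
      then have "insert i S \<in> shift i j B" using sB iE by auto
      moreover have "transpose i j ` insert i S = insert j S"
      proof -
        have "i \<notin> S" "j \<notin> S" using s iE unfolding W_def by auto
        then have "transpose j i ` insert i S = insert j (insert i S - {i})"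
          using ne by (intro transpose_image_move) auto
        then show ?thesis using \<open>i \<notin> S\<close> by (simp add: transpose_commute)
      qed
      \<comment> \<open>Both alternatives fail: a set of \<open>B\<close> through \<open>j\<close>
        misses \<open>E \<union> T\<close>, and one through \<open>i\<close> misses the member of
        \<open>A\<close> that was shifted to \<open>E \<union> T'\<close>.\<close>
      ultimately have "insert i S \<in> B \<or> insert j S \<in> B" by (simp add: shift_def)
      then show ?thesis
      proof
        assume "insert j S \<in> B"
        moreover have "E \<union> T \<in> A" using T X_def by simp
        ultimately have "(E \<union> T) \<inter> insert j S \<noteq> {}" using cr crossing_one_iff[OF A] by metis
        then show ?thesis using s tW iE unfolding W_def by auto
      next
        assume iSB: "insert i S \<in> B"
        have "E \<inter> T' = {}" using tW unfolding W_def by auto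
        then have "card (E \<union> T') = a"
          using tW fE E unfolding k_def by (simp add: card_Un_disjoint)
        then have "E \<union> T' \<in> nsets V a"
          using tW E fV unfolding W_def by (intro nsetsI) auto
        then have "E \<union> T' \<in> shift i j A" using sA by auto
        then have "transpose i j ` (E \<union> T') \<in> A"
          using T(4) iE unfolding X_def shift_def by auto
        moreover have "transpose i j ` (E \<union> T') = insert j ((E \<union> T') - {i})"
          using transpose_image_move[of i "E \<union> T'" j] iE tW unfolding W_def
          by (auto simp: transpose_commute)
        ultimately have "insert j ((E \<union> T') - {i}) \<inter> insert i S \<noteq> {}"
          using iSB cr crossing_one_iff[OF A] by metis
        then show ?thesis using s tW iE ne unfolding W_def by auto
      qed
    qed
  qed
qed

text \<open>Tightness turns two inequalities into equalities at once: \<open>B\<close> contains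
  everything that meets both sets, and the number of such sets is the maximum in
  \<open>card_meeting_two\<close>, which forces the two sets to share \<open>a - 1\<close>
  points.\<close>

lemma card_two_full:
  assumes fV: "finite V" and A: "A \<subseteq> nsets V a" and B: "B \<subseteq> nsets V b" and cr: "crossing 1 A B"
    and N: "a + b < card V" and b: "1 \<le> b" and cA: "card A = 2"
    and eq: "card A + card B + ((card V - a) choose b) + ((card V - a - 1) choose (b - 1))
        = (card V choose b) + 2"
  shows "\<exists>P Q. P \<noteq> Q \<and> A = {P, Q} \<and> card (P \<inter> Q) = a - 1 \<and>
    B = {G \<in> nsets V b. G \<inter> P \<noteq> {} \<and> G \<inter> Q \<noteq> {}}"
proof -
  obtain P Q where PQ: "A = {P, Q}" "P \<noteq> Q" using cA by (auto simp: card_2_iff)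
  have PQn: "P \<in> nsets V a" "Q \<in> nsets V a" using PQ A by auto
  let ?M = "{G \<in> nsets V b. G \<inter> P \<noteq> {} \<and> G \<inter> Q \<noteq> {}}"
  have sub: "B \<subseteq> ?M" using crossing_subset_meeting[OF A B cr] PQ by blast
  have fM: "finite ?M" using fV by simp
  have le: "card B \<le> card ?M" by (rule card_mono[OF fM sub])
  have m1: "card ?M + ((card V - a) choose b) + ((card V - a - 1) choose (b - 1)) \<le> card V choose b"
    by (rule card_meeting_two(1)[OF fV PQn PQ(2) b])
  have cB: "card B = card ?M" using le m1 eq cA by linarith
  then have "B = ?M" by (rule card_subset_eq[OF fM sub])
  moreover have "card (P \<inter> Q) = a - 1"
    by (rule card_meeting_two(3)[OF fV PQn PQ(2) b N]) (use cB eq cA in linarith)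
  ultimately show ?thesis using PQ by blast
qed

lemma cross_pair_bound_two:
  fixes V :: "nat set"
  assumes cp: "cross_pair V a b t A B" and cA: "2 \<le> card A" and b: "3 \<le> b"
  shows "card A + card B + ((card V - a) choose b) + ((card V - a - 1) choose (b - 1))
      \<le> (card V choose b) + 2"
    and "a + b < card V \<Longrightarrow>
      card A + card B + ((card V - a) choose b) + ((card V - a - 1) choose (b - 1))
        = (card V choose b) + 2 \<Longrightarrow>
      card A = 2 \<or> (b = 3 \<and> (\<exists>E\<subseteq>V. (card E = t \<or> card E = t + 1) \<and>
         A = {F \<in> nsets V a. E \<subseteq> F} \<and> B = {G \<in> nsets V b. G \<inter> E \<noteq> {}}))"
proof -
  define bd where "bd A B \<longleftrightarrow> card A + card B + ((card V - a) choose b) + ((card V - a - 1) choose (b - 1))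
      \<le> (card V choose b) + 2" for A B :: "nat set set"
  define eq where "eq A B \<longleftrightarrow> card A + card B + ((card V - a) choose b) + ((card V - a - 1) choose (b - 1))
      = (card V choose b) + 2" for A B :: "nat set set"
  define ext where "ext A B \<longleftrightarrow> card A = 2 \<or> (b = 3 \<and> (\<exists>E\<subseteq>V. (card E = t \<or> card E = t + 1) \<and>
         A = {F \<in> nsets V a. E \<subseteq> F} \<and> B = {G \<in> nsets V b. G \<inter> E \<noteq> {}}))" for A B
  have "cross_pair V a b t A B \<longrightarrow> 2 \<le> card A \<longrightarrow> bd A B \<and> (a + b < card V \<longrightarrow> eq A B \<longrightarrow> ext A B)"
  proof (rule shift_induct[OF cross_pairD(1-3)[OF cp]], goal_cases)
    case (1 A B)
    then show ?case
      using shifted_cross_pair_bound_two[of V a b t A B] b unfolding bd_def eq_def ext_def by blast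
  next
    case (2 A B i j)
    show ?case
    proof (intro impI)
      assume c: "cross_pair V a b t A B" and cA: "2 \<le> card A"
      note D = cross_pairD[OF c]
      have e: "card (shift i j A) = card A" "card (shift i j B) = card B"
        using card_shift D by auto
      have IH: "bd (shift i j A) (shift i j B) \<and>
        (a + b < card V \<longrightarrow> eq (shift i j A) (shift i j B) \<longrightarrow> ext (shift i j A) (shift i j B))"
        using 2(6) cross_pair_shift[OF c 2(3,4)] e cA by simp
      have "ext A B" if N: "a + b < card V" and eqAB: "eq A B"
      proof -
        have "ext (shift i j A) (shift i j B)" using IH N eqAB e unfolding eq_def by simp
        then consider "card A = 2" | E where "b = 3" "E \<subseteq> V" "card E = t \<or> card E = t + 1"
          "shift i j A = {F \<in> nsets V a. E \<subseteq> F}" "shift i j B = {G \<in> nsets V b. G \<inter> E \<noteq> {}}"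
          unfolding ext_def e by blast
        then show ?thesis
        proof cases
          case 1 then show ?thesis by (simp add: ext_def)
        next
          case (2 E)
          have "card E < a" using 2 D by auto
          then obtain E' where "E' \<subseteq> V" "card E' = card E"
            "A = {F \<in> nsets V a. E' \<subseteq> F}" "B = {G \<in> nsets V b. G \<inter> E' \<noteq> {}}"
            using unshift_supersets[OF D(1-3,6) N \<open>i \<in> V\<close> \<open>j \<in> V\<close> 2(2) _ _ 2(4,5)] b by auto
          then have "E' \<subseteq> V \<and> (card E' = t \<or> card E' = t + 1) \<and>
            A = {F \<in> nsets V a. E' \<subseteq> F} \<and> B = {G \<in> nsets V b. G \<inter> E' \<noteq> {}}"
            using 2(3) by simp
          then show ?thesis using 2(1) unfolding ext_def by blast
        qed
      qed
      then show "bd A B \<and> (a + b < card V \<longrightarrow> eq A B \<longrightarrow> ext A B)"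
        using IH e unfolding bd_def by simp
    qed
  qed
  then have "bd A B \<and> (a + b < card V \<longrightarrow> eq A B \<longrightarrow> ext A B)" using cp cA by blast
  then show "card A + card B + ((card V - a) choose b) + ((card V - a - 1) choose (b - 1))
      \<le> (card V choose b) + 2"
    and "a + b < card V \<Longrightarrow>
      card A + card B + ((card V - a) choose b) + ((card V - a - 1) choose (b - 1))
        = (card V choose b) + 2 \<Longrightarrow>
      card A = 2 \<or> (b = 3 \<and> (\<exists>E\<subseteq>V. (card E = t \<or> card E = t + 1) \<and>
         A = {F \<in> nsets V a. E \<subseteq> F} \<and> B = {G \<in> nsets V b. G \<inter> E \<noteq> {}}))"
    unfolding bd_def eq_def ext_def by blast+
qed

section \<open>Two cross-intersecting families of sets of the same size\<close>

lemma initial_unique: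
  fixes P Q :: "nat set"
  assumes "P \<in> nsets V d" "Q \<in> nsets V d"
    and "\<And>i j. i \<in> V \<Longrightarrow> j \<in> P \<Longrightarrow> i < j \<Longrightarrow> i \<in> P"
    and "\<And>i j. i \<in> V \<Longrightarrow> j \<in> Q \<Longrightarrow> i < j \<Longrightarrow> i \<in> Q"
  shows "P = Q"
proof (rule ccontr)
  assume ne: "P \<noteq> Q"
  have f: "finite P" "finite Q" "card P = d" "card Q = d" "P \<subseteq> V" "Q \<subseteq> V"
    using assms by (auto simp: nsets_def)
  have "\<not> P \<subseteq> Q" "\<not> Q \<subseteq> P" using f ne card_subset_eq by metis+
  then obtain p q where pq: "p \<in> P" "p \<notin> Q" "q \<in> Q" "q \<notin> P" by blast
  then have "p \<noteq> q" by auto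
  then consider "p < q" | "q < p" by linarith
  then show False using assms(3)[of q p] assms(4)[of p q] pq f by cases auto
qed

text \<open>The last \<open>d\<close>-set through the least point of \<open>V\<close> lies in one of the families. By shiftedness that
  family then contains every \<open>d\<close>-set through this point, so the other family is a star.\<close>
lemma shifted_comparable:
  fixes V :: "nat set"
  assumes fV: "finite V" and X: "X \<subseteq> nsets V d" "Y \<subseteq> nsets V d" and cr: "crossing 1 X Y"
    and sh: "shifted V X" "shifted V Y" and N: "2 * d < card V" and d: "1 \<le> d"
    and full: "{G \<in> nsets V d. Min V \<in> G} \<subseteq> X \<union> Y"
  shows "X \<subseteq> Y \<or> Y \<subseteq> X"
proof -
  define v where "v = Min V"
  define C where "C = {G \<in> nsets V d. v \<in> G}"
  have V: "V \<noteq> {}" using N by auto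
  have v: "v \<in> V" "\<And>x. x \<in> V \<Longrightarrow> v \<le> x" using fV V v_def by auto
  have fC: "finite C" unfolding C_def using fV by simp
  have cf: "finite G" "G \<subseteq> V" "card G = d" "v \<in> G" if "G \<in> C" for G
    using that by (auto simp: C_def nsets_def)
  have "card (V - {v}) = card V - 1" using v fV by simp
  then have "d - 1 \<le> card (V - {v})" using N by linarith
  then obtain R where R: "R \<in> nsets (V - {v}) (d - 1)"
    using ex_nset[of "V - {v}" "d - 1"] fV by auto
  have "insert v R \<in> nsets V d" using insert_in_nsets[OF R, of V v] v d by auto
  then have neC: "C \<noteq> {}" unfolding C_def by auto
  have "Max ((\<lambda>F. \<Sum>F) ` C) \<in> (\<lambda>F. \<Sum>F) ` C" using fC neC by (intro Max_in) auto
  then obtain S where S: "S \<in> C" "\<Sum>S = Max ((\<lambda>F. \<Sum>F) ` C)" by auto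
  have Smax: "\<Sum>F \<le> \<Sum>S" if "F \<in> C" for F using S that fC by (auto intro: Max_ge)
  have main: "Y' \<subseteq> X'"
    if X': "X' \<subseteq> nsets V d" "Y' \<subseteq> nsets V d" and cr': "crossing 1 X' Y'" and sh': "shifted V X'"
      and SX: "S \<in> X'" for X' Y'
  proof -
    have CX: "C \<subseteq> X'"
    proof (rule ccontr)
      assume "\<not> C \<subseteq> X'"
      then have ne: "C - X' \<noteq> {}" by auto
      have "Max ((\<lambda>F. \<Sum>F) ` (C - X')) \<in> (\<lambda>F. \<Sum>F) ` (C - X')" using fC ne by (intro Max_in) auto
      \<comment> \<open>\<open>G\<close> is a missing set of largest element sum and differs from
        the last set \<open>S\<close>. Either a point of \<open>G\<close> can be raised to a point
        of \<open>S\<close>; the result is in \<open>X'\<close> by the choice of \<open>G\<close>,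
        and a downward shift returns to \<open>G\<close>. Or a point of \<open>S\<close> can be
        raised to a point of \<open>G\<close>, contrary to the choice of \<open>S\<close>.\<close>
      then obtain G where G: "G \<in> C" "G \<notin> X'" "\<Sum>G = Max ((\<lambda>F. \<Sum>F) ` (C - X'))" by auto
      have Gmax: "\<Sum>F \<le> \<Sum>G" if "F \<in> C" "F \<notin> X'" for F using G that fC by (auto intro: Max_ge)
      have "G \<noteq> S" using G SX by auto
      then have "\<not> G \<subseteq> S" "\<not> S \<subseteq> G" using cf[OF G(1)] cf[OF S(1)] by (metis card_subset_eq)+
      then obtain g l where gl: "g \<in> G" "g \<notin> S" "l \<in> S" "l \<notin> G" by blast
      have nv: "g \<noteq> v" "l \<noteq> v" using gl cf(4)[OF G(1)] cf(4)[OF S(1)] by auto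
      have "g \<noteq> l" using gl by auto
      then consider "g < l" | "l < g" by linarith
      then show False
      proof cases
        case 1
        define G' where "G' = insert l (G - {g})"
        have restore: "insert g (G' - {l}) = G" using gl unfolding G'_def by auto
        have "G' \<in> nsets V d"
          using cf[OF G(1)] cf[OF S(1)] gl fV d card_Suc_Diff1[of G g] unfolding G'_def
          by (intro nsetsI) auto
        then have "G' \<in> C" using nv cf(4)[OF G(1)] unfolding C_def G'_def by simp
        moreover have "\<Sum>G < \<Sum>G'"
          using sum_move_less[of G' g l] 1 gl cf(1)[OF G(1)] restore unfolding G'_def by auto
        ultimately have "G' \<in> X'" using Gmax by (meson leD)
        then have "insert g (G' - {l}) \<in> X'"
          using shiftedD[OF sh', of G' g l] 1 gl cf(2)[OF G(1)] cf(2)[OF S(1)] unfolding G'_def by blast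
        then show False using restore G by simp
      next
        case 2
        define S' where "S' = insert g (S - {l})"
        have restore: "insert l (S' - {g}) = S" using gl unfolding S'_def by auto
        have "S' \<in> nsets V d"
          using cf[OF G(1)] cf[OF S(1)] gl fV d card_Suc_Diff1[of S l] unfolding S'_def
          by (intro nsetsI) auto
        then have "S' \<in> C" using nv cf(4)[OF S(1)] unfolding C_def S'_def by simp
        moreover have "\<Sum>S < \<Sum>S'"
          using sum_move_less[of S' l g] 2 gl cf(1)[OF S(1)] restore unfolding S'_def by auto
        ultimately show False using Smax by (meson leD)
      qed
    qed
    show ?thesis
    proof
      fix Q assume Q: "Q \<in> Y'"
      have q: "finite Q" "Q \<subseteq> V" "card Q = d" using Q X' by (auto simp: nsets_def)
      have "v \<in> Q"
      proof (rule ccontr)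
        assume vQ: "v \<notin> Q"
        have "card (V - insert v Q) = card V - (d + 1)"
          using q v fV vQ by (subst card_Diff_subset) auto
        then have "d - 1 \<le> card (V - insert v Q)" using N by linarith
        then obtain R where R: "R \<in> nsets (V - insert v Q) (d - 1)"
          using ex_nset[of "V - insert v Q" "d - 1"] fV by auto
        have "insert v R \<in> C"
          using insert_in_nsets[OF R, of V v] v d unfolding C_def by auto
        then have "insert v R \<inter> Q \<noteq> {}" using CX Q cr' crossing_one_iff[OF X'(1)] by blast
        then show False using vQ nsetsD(1)[OF R] by auto
      qed
      then have "Q \<in> C" using Q X' unfolding C_def by auto
      then show "Q \<in> X'" using CX by auto
    qed
  qed
  have "S \<in> X \<or> S \<in> Y" using S full unfolding C_def v_def by auto
  then show ?thesis using main[of X Y] main[of Y X] X cr crossing_sym[OF cr] sh by blast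
qed

text \<open>Intersection and union of the two families form a cross pair with
  \<open>a = b = d\<close> and \<open>t = 1\<close>, of the same total size. A shift may turn
  incomparable families into comparable ones, so the induction carries the explicit shapes
  \<open>ext\<close> instead of comparability, which is read off only at the end.\<close>

lemma cross_same_size:
  fixes V :: "nat set"
  assumes fV: "finite V" and X: "X \<subseteq> nsets V d" "Y \<subseteq> nsets V d" and cr: "crossing 1 X Y"
    and d: "3 \<le> d" and N: "2 * d < card V" and c2: "2 \<le> card X" "2 \<le> card Y"
  shows "card X + card Y + ((card V - d) choose d) + ((card V - d - 1) choose (d - 1))
      \<le> (card V choose d) + 2"
    and "card X + card Y + ((card V - d) choose d) + ((card V - d - 1) choose (d - 1))
        = (card V choose d) + 2 \<Longrightarrow> X \<subseteq> Y \<or> Y \<subseteq> X"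
proof -
  define bd where "bd X Y \<longleftrightarrow> card X + card Y + ((card V - d) choose d) + ((card V - d - 1) choose (d - 1))
      \<le> (card V choose d) + 2" for X Y :: "nat set set"
  define eq where "eq X Y \<longleftrightarrow> card X + card Y + ((card V - d) choose d) + ((card V - d - 1) choose (d - 1))
      = (card V choose d) + 2" for X Y :: "nat set set"
  define star where "star E X Y \<longleftrightarrow> E \<subseteq> V \<and> card E < d \<and> X = {F \<in> nsets V d. E \<subseteq> F} \<and> Y = {G \<in> nsets V d. G \<inter> E \<noteq> {}}"
    for E X Y
  define ext where "ext X Y \<longleftrightarrow> card X = 2 \<or> card Y = 2 \<or> (\<exists>E. star E X Y \<or> star E Y X)" for X Y
  have V: "V \<noteq> {}" using N by auto
  have NN: "d + d < card V" using N by simp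
  have "crossing 1 X Y \<longrightarrow> 2 \<le> card X \<longrightarrow> 2 \<le> card Y \<longrightarrow> bd X Y \<and> (eq X Y \<longrightarrow> ext X Y)"
  proof (rule shift_induct[OF fV X], goal_cases)
    case (1 X Y)
    note XY = 1(1,2) and sh = 1(3,4)
    show ?case
    proof (intro impI)
      assume cr: "crossing 1 X Y" and c: "2 \<le> card X" "2 \<le> card Y"
      have fXY: "finite X" "finite Y" using XY fV by (auto intro: finite_subset[OF _ finite_nsets])
      define A where "A = X \<inter> Y"
      define B where "B = X \<union> Y"
      have AB: "A \<subseteq> nsets V d" "B \<subseteq> nsets V d" using XY by (auto simp: A_def B_def)
      have crAB: "crossing 1 A B" "crossing 1 A A"
        using cr crossing_sym[OF cr] unfolding A_def B_def crossing_def by auto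
      have cp: "cross_pair V d d 1 A B"
        using AB crAB fV NN unfolding cross_pair_def by auto
      have shAB: "shifted V A" "shifted V B" using sh unfolding A_def B_def shifted_def by auto
      have "X \<noteq> {}" "Y \<noteq> {}" using c by auto
      obtain P where P: "P \<in> X" "\<And>i j. i \<in> V \<Longrightarrow> j \<in> P \<Longrightarrow> i < j \<Longrightarrow> i \<in> P"
        by (rule shifted_initial_member[OF XY(1) sh(1) \<open>X \<noteq> {}\<close>]) blast
      obtain Q where Q: "Q \<in> Y" "\<And>i j. i \<in> V \<Longrightarrow> j \<in> Q \<Longrightarrow> i < j \<Longrightarrow> i \<in> Q"
        by (rule shifted_initial_member[OF XY(2) sh(2) \<open>Y \<noteq> {}\<close>]) blast
      have "P = Q" by (rule initial_unique[of P V d Q]) (use P Q XY in auto)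
      define P' where "P' = insert (Min (V - P)) (P - {Max P})"
      have "P' \<in> X" "P' \<noteq> P" "P' \<in> Y"
        using shifted_second_member[OF fV XY(1) sh(1) c(1) P] shifted_second_member[OF fV XY(2) sh(2) c(2) Q]
          \<open>P = Q\<close> unfolding P'_def by auto
      \<comment> \<open>The first two members of a stable family are determined by \<open>V\<close>
        and \<open>d\<close>, so \<open>X\<close> and \<open>Y\<close> share them.\<close>
      then have sub: "{P, P'} \<subseteq> A" using P Q \<open>P = Q\<close> unfolding A_def by auto
      have fA: "finite A" using fXY unfolding A_def by simp
      have cA: "2 \<le> card A" using card_mono[OF fA sub] \<open>P' \<noteq> P\<close> by simp
      have sum: "card X + card Y = card A + card B"
        using card_Un_Int[OF fXY] unfolding A_def B_def by simp
      note core = shifted_cross_pair_bound_two[OF cp shAB cA d]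
      have "ext X Y" if e: "eq X Y"
      proof -
        have e': "card A + card B + ((card V - d) choose d) + ((card V - d - 1) choose (d - 1))
          = (card V choose d) + 2" using e sum unfolding eq_def by simp
        define v where "v = Min V"
        have v: "v \<in> V" "\<And>x. x \<in> V \<Longrightarrow> v \<le> x" using fV V v_def by auto
        \<comment> \<open>Prepares \<open>shifted_comparable\<close>. In either extremal shape the
          least point \<open>v\<close> lies in all members of \<open>A\<close> or in the kernel
          \<open>E\<close>, so every \<open>d\<close>-set through \<open>v\<close> satisfies the
          condition defining \<open>B\<close>.\<close>
        have sub: "{G \<in> nsets V d. v \<in> G} \<subseteq> B \<and> (card A = 2 \<or> (\<exists>E. star E A B))"
          using core(2)[OF NN e']
        proof
          assume A2: "card A = 2"
          obtain P Q where PQ: "P \<noteq> Q" "A = {P, Q}" "B = {G \<in> nsets V d. G \<inter> P \<noteq> {} \<and> G \<inter> Q \<noteq> {}}"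
            using card_two_full[OF fV AB crAB(1) NN _ A2 e'] d by auto
          have "v \<in> F" if F: "F \<in> A" for F
          proof (rule ccontr)
            assume vF: "v \<notin> F"
            have f: "finite F" "card F = d" "F \<subseteq> V" using F AB by (auto simp: nsets_def)
            \<comment> \<open>Replacing either of two points of \<open>F\<close> by \<open>v\<close>
              would give two further members of \<open>A\<close>.\<close>
            obtain S where "S \<in> nsets F 2" using ex_nset[of F 2] f d by auto
            then obtain j j' where j: "j \<in> F" "j' \<in> F" "j \<noteq> j'" by (auto simp: nsets_def card_2_iff)
            have "insert v (F - {x}) \<in> A" if "x \<in> F" for x
            proof -
              have "v < x" using v that f vF by (metis le_neq_implies_less subsetD)
              then show ?thesis using shiftedD[OF shAB(1) F, of v x] v that f vF by blast
            qed
            then have "{F, insert v (F - {j}), insert v (F - {j'})} \<subseteq> A" using j F by auto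
            then have "card {F, insert v (F - {j}), insert v (F - {j'})} \<le> 2"
              using card_mono[OF fA] A2 by metis
            moreover have "insert v (F - {j}) \<noteq> insert v (F - {j'})" using j vF by auto
            moreover have "F \<noteq> insert v (F - {j})" "F \<noteq> insert v (F - {j'})" using vF by auto
            ultimately show False by simp
          qed
          then show ?thesis using PQ A2 by auto
        next
          assume "d = 3 \<and> (\<exists>E\<subseteq>V. (card E = 1 \<or> card E = 1 + 1) \<and>
            A = {F \<in> nsets V d. E \<subseteq> F} \<and> B = {G \<in> nsets V d. G \<inter> E \<noteq> {}})"
          then obtain E where E: "d = 3" "E \<subseteq> V" "card E = 1 \<or> card E = 2"
            "A = {F \<in> nsets V d. E \<subseteq> F}" "B = {G \<in> nsets V d. G \<inter> E \<noteq> {}}" by auto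
          have "v \<in> E"
          proof (rule ccontr)
            assume vE: "v \<notin> E"
            have fE: "finite E" using E(2) fV finite_subset by auto
            obtain e where e: "e \<in> E" using E(3) by fastforce
            have "card (V - {v} - E) = card V - 1 - card E"
              using fE v vE E(2) fV by (subst card_Diff_subset) auto
            then have "3 - card E \<le> card (V - {v} - E)" using N E by auto
            then obtain R where R: "R \<in> nsets (V - {v} - E) (3 - card E)"
              using ex_nset[of "V - {v} - E" "3 - card E"] fV by auto
            have r: "R \<inter> E = {}" "v \<notin> R" "R \<subseteq> V" "finite R" "card R = 3 - card E" using R by (auto simp: nsets_def)
            have "card (R \<union> E) = 3" using r fE E(3) by (auto simp: card_Un_disjoint)
            then have "R \<union> E \<in> A" using E r fV fE by (auto intro!: nsetsI)
            \<comment> \<open>Shifting \<open>e\<close> to \<open>v\<close> keeps the set in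
              \<open>A\<close>, although it no longer contains \<open>E\<close>.\<close>
            moreover have "v < e" using v(2)[of e] e E(2) vE by (metis le_neq_implies_less subsetD)
            ultimately have "insert v (R \<union> E - {e}) \<in> A"
              using shiftedD[OF shAB(1), of "R \<union> E" v e] v e E(2) r vE by blast
            then have "E \<subseteq> insert v (R \<union> E - {e})" using E(4) by auto
            then show False using e vE by auto
          qed
          then have "{G \<in> nsets V d. v \<in> G} \<subseteq> B" using E(5) by auto
          moreover have "star E A B" using E d unfolding star_def by auto
          ultimately show ?thesis by blast
        qed
        then have "X \<subseteq> Y \<or> Y \<subseteq> X"
          using shifted_comparable[OF fV XY cr sh N] d unfolding v_def B_def by auto
        then have "A = X \<and> B = Y \<or> A = Y \<and> B = X" unfolding A_def B_def by auto
        then show ?thesis using sub unfolding ext_def by blast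
      qed
      then show "bd X Y \<and> (eq X Y \<longrightarrow> ext X Y)" using core(1) sum unfolding bd_def by simp
    qed
  next
    case (2 X Y i j)
    note XY = 2(1,2) and ij = 2(3,4)
    show ?case
    proof (intro impI)
      assume cr: "crossing 1 X Y" and c: "2 \<le> card X" "2 \<le> card Y"
      have fXY: "finite X" "finite Y" using XY fV by (auto intro: finite_subset[OF _ finite_nsets])
      have e: "card (shift i j X) = card X" "card (shift i j Y) = card Y"
        using card_shift[OF fXY(1)] card_shift[OF fXY(2)] by auto
      have "crossing 1 (shift i j X) (shift i j Y)"
        by (rule crossing_shift[OF cr]) (use XY in \<open>auto simp: nsets_def\<close>)
      then have IH: "bd (shift i j X) (shift i j Y) \<and> (eq (shift i j X) (shift i j Y) \<longrightarrow> ext (shift i j X) (shift i j Y))"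
        using 2(6) e c by simp
      have un: "\<exists>E. star E X' Y'" if "star E (shift i j X') (shift i j Y')" "X' \<subseteq> nsets V d" "Y' \<subseteq> nsets V d"
        "crossing 1 X' Y'" for E X' Y'
      proof -
        note that0 = that
        have s: "E \<subseteq> V" "card E < d" "shift i j X' = {F \<in> nsets V d. E \<subseteq> F}"
          "shift i j Y' = {G \<in> nsets V d. G \<inter> E \<noteq> {}}" using that0(1) unfolding star_def by blast+
        obtain E' where "E' \<subseteq> V" "card E' = card E" "X' = {F \<in> nsets V d. E' \<subseteq> F}"
          "Y' = {G \<in> nsets V d. G \<inter> E' \<noteq> {}}"
          using unshift_supersets[OF fV that0(2,3,4) NN ij s(1,2) _ s(3,4)] d by auto
        then have "star E' X' Y'" using s(2) unfolding star_def by simp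
        then show ?thesis by blast
      qed
      have "ext X Y" if "eq X Y"
      proof -
        have "ext (shift i j X) (shift i j Y)" using IH that e unfolding eq_def by simp
        then show ?thesis
          using un[of _ X Y] un[of _ Y X] XY cr crossing_sym[OF cr] e unfolding ext_def by metis
      qed
      then show "bd X Y \<and> (eq X Y \<longrightarrow> ext X Y)" using IH e unfolding bd_def by simp
    qed
  qed
  then have *: "bd X Y" "eq X Y \<Longrightarrow> ext X Y" using cr c2 by auto
  then show "card X + card Y + ((card V - d) choose d) + ((card V - d - 1) choose (d - 1))
      \<le> (card V choose d) + 2" unfolding bd_def by simp
  assume e: "card X + card Y + ((card V - d) choose d) + ((card V - d - 1) choose (d - 1))
        = (card V choose d) + 2"
  \<comment> \<open>Two \<open>d\<close>-sets sharing \<open>d - 1\<close> points meet each other,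
    so both belong to the family of all sets meeting both.\<close>
  have two: "X' \<subseteq> Y'" if X': "X' \<subseteq> nsets V d" "Y' \<subseteq> nsets V d" "crossing 1 X' Y'" "card X' = 2" "eq X' Y'" for X' Y'
  proof -
    obtain P Q where PQ: "X' = {P, Q}" "card (P \<inter> Q) = d - 1"
      "Y' = {G \<in> nsets V d. G \<inter> P \<noteq> {} \<and> G \<inter> Q \<noteq> {}}"
      using card_two_full[OF fV X'(1-3) NN _ X'(4)] X'(5) d unfolding eq_def by auto
    have "P \<inter> Q \<noteq> {}" using PQ(2) d by auto
    then show ?thesis using PQ X'(1) by auto
  qed
  have st: "X' \<subseteq> Y'" if "star E X' Y'" "2 \<le> card Y'" for E X' Y'
  proof -
    have "E \<noteq> {}" using that unfolding star_def by auto
    then show ?thesis using that unfolding star_def by auto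
  qed
  have "ext X Y" using * e unfolding eq_def by simp
  moreover have "eq X Y" "eq Y X" using e unfolding eq_def by auto
  ultimately show "X \<subseteq> Y \<or> Y \<subseteq> X"
    using two[OF X cr] two[OF X(2,1) crossing_sym[OF cr]] st c2 unfolding ext_def by blast
qed

subsection \<open>Nontrivial intersecting families\<close>

lemma finite_del: "finite F \<Longrightarrow> finite (del c F)"
  by (simp add: del_def)

lemma del_link_commute: "i \<noteq> j \<Longrightarrow> del i (link j F) = link j (del i F)"
  by (auto simp: del_def link_def)

lemma crossing_del_link:
  assumes F: "F \<subseteq> nsets V k" and cr: "crossing 1 F F"
  shows "crossing 1 (del c F) (link c F)"
  using del_link_meet[OF F cr] crossing_one_iff[OF subset_trans[OF del_subset F]] by metis

lemma binomial_ge_two: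
  assumes "0 < k" "k < m"
  shows "2 \<le> m choose k"
proof -
  have "m choose k = ((m - 1) choose (k - 1)) + ((m - 1) choose k)"
    using choose_Suc_pos assms by simp
  moreover have "(m - 1) choose (k - 1) \<ge> 1" "(m - 1) choose k \<ge> 1"
    using assms by (auto simp: Suc_le_eq)
  ultimately show ?thesis by simp
qed

text \<open>\<open>Q\<close> meets itself but is absent from \<open>X\<close>. Hence
  \<open>X\<close> has at least one member fewer than the family of all sets meeting
  \<open>Q\<close>, and the count for \<open>Y\<close> fits into the gap.\<close>

lemma card_cross_singleton:
  assumes "finite V" "X \<subseteq> nsets V d" "Y = {Q}" "Q \<in> nsets V d" "Q \<notin> X" "crossing 1 X Y" "1 \<le> d"
  shows "card X + card Y + ((card V - d) choose d) \<le> card V choose d"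
proof -
  have q: "Q \<subseteq> V" "card Q = d" "finite Q" using assms by (auto simp: nsets_def)
  have Y: "Y \<subseteq> nsets V d" using assms by auto
  have "X \<subseteq> {G \<in> nsets V d. G \<inter> Q \<noteq> {}}"
    by (rule crossing_subset_meeting[OF Y assms(2) crossing_sym[OF assms(6)]]) (use assms in simp)
  moreover have "Q \<in> {G \<in> nsets V d. G \<inter> Q \<noteq> {}}" using assms q by auto
  ultimately have "insert Q X \<subseteq> {G \<in> nsets V d. G \<inter> Q \<noteq> {}}" by blast
  then have "card (insert Q X) \<le> card {G \<in> nsets V d. G \<inter> Q \<noteq> {}}"
    by (rule card_mono[rotated]) (use assms in simp)
  moreover have "card (insert Q X) = card X + 1"
    using assms finite_subset[OF assms(2) finite_nsets[OF assms(1)]] by simp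
  ultimately show ?thesis using card_meeting[OF assms(1) q(1), of d] q assms(3) by simp
qed

lemma card_pair_split:
  assumes "finite F" "i \<noteq> j"
  shows "card (del j F) = card (del i (del j F)) + card (link i (del j F))"
    and "card (del i F) = card (del i (del j F)) + card (link j (del i F))"
    and "card F = card (del i (del j F)) + card (link i (del j F)) + card (link j (del i F))
      + card (link i (link j F))"
proof -
  show cj: "card (del j F) = card (del i (del j F)) + card (link i (del j F))"
    by (intro card_del_link finite_del assms)
  have "del j (del i F) = del i (del j F)" by (auto simp: del_def)
  then show "card (del i F) = card (del i (del j F)) + card (link j (del i F))"
    using card_del_link[OF finite_del[OF assms(1)], of i j] by simp
  have "finite (link j F)"
    by (rule finite_imageD[of "insert j"])
      (auto simp: link_def inj_on_def intro: finite_subset[OF _ assms(1)])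
  then have "card (link j F) = card (link j (del i F)) + card (link i (link j F))"
    using card_del_link[of "link j F" i] del_link_commute[OF assms(2)] by simp
  then show "card F = card (del i (del j F)) + card (link i (del j F)) + card (link j (del i F))
      + card (link i (link j F))"
    using card_del_link[OF assms(1), of j] cj by simp
qed

lemma link_pair_meet:
  assumes F: "F \<subseteq> nsets V k" and cr: "crossing 1 F F"
    and P: "P \<in> link i (del j F)" and Q: "Q \<in> link j (del i F)"
  shows "P \<inter> Q \<noteq> {}"
proof -
  have "insert i P \<in> F" "insert j Q \<in> F" "i \<notin> insert j Q" "j \<notin> insert i P" "i \<noteq> j"
    using P Q by (auto simp: link_def del_def)
  then have "insert i P \<inter> insert j Q \<noteq> {}" using cr crossing_one_iff[OF F] by blast
  then show ?thesis using \<open>i \<notin> insert j Q\<close> \<open>j \<notin> insert i P\<close> by auto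
qed

text \<open>The inequality is strict. This lets the induction below undo a shift: when the shifted family is
  extremal, the two traces of the original family on the sets meeting \<open>{i, j}\<close> in one point
  cannot be incomparable.\<close>
lemma incomparable_bound:
  fixes V :: "nat set"
  assumes fV: "finite V" and F: "F \<subseteq> nsets V k" and cr: "crossing 1 F F" and k: "4 \<le> k"
    and n: "2 * k < card V" and ij: "i \<in> V" "j \<in> V" "i \<noteq> j"
    and two: "2 \<le> card (del i F)" "2 \<le> card (del j F)"
    and W: "crossing 3 (del i (del j F)) (del i (del j F))"
    and inc: "\<not> link i (del j F) \<subseteq> link j (del i F)" "\<not> link j (del i F) \<subseteq> link i (del j F)"
  shows "card F + ((card V - 1 - k) choose (k - 1)) + ((card V - 1 - k - 1) choose (k - 2))
    < ((card V - 1) choose (k - 1)) + 2"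
proof -
  \<comment> \<open>\<open>F\<close> is split by the trace of its members on \<open>{i, j}\<close>:
    \<open>X\<close> comes from those containing only \<open>i\<close>, \<open>Y\<close> from those
    containing only \<open>j\<close>, \<open>Z\<close> from those containing both, and
    \<open>W\<close> from those containing neither.\<close>
  define X where "X = link i (del j F)"
  define Y where "Y = link j (del i F)"
  define Z where "Z = link i (link j F)"
  define W where "W = del i (del j F)"
  define U where "U = V - {i} - {j}"
  define N where "N = card U"
  define d where "d = k - 1"
  have fF: "finite F" using F fV by (auto intro: finite_subset[OF _ finite_nsets])
  have fU: "finite U" using fV U_def by simp
  have U': "V - {j} - {i} = U" unfolding U_def by auto
  have nN: "card V = N + 2" using ij fV n k unfolding N_def U_def by simp
  have d: "k = Suc d" "3 \<le> d" using k d_def by auto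
  have sub: "X \<subseteq> nsets U d" "Y \<subseteq> nsets U d" "Z \<subseteq> nsets U (d - 1)" "W \<subseteq> nsets U k"
    using link_nsets[OF del_nsets[OF F], of i j] link_nsets[OF del_nsets[OF F], of j i]
      link_nsets[OF link_nsets[OF F], of i j] del_nsets[OF del_nsets[OF F], of i j] U' d
    unfolding X_def Y_def Z_def W_def U_def[symmetric] by auto
  have fin: "finite X" "finite Y" "finite Z" "finite W"
    using sub fU by (auto intro: finite_subset[OF _ finite_nsets])
  have cj: "card (del j F) = card W + card X" and ci: "card (del i F) = card W + card Y"
    and cF: "card F = card W + card X + card Y + card Z"
    using card_pair_split[OF fF ij(3)] unfolding W_def X_def Y_def Z_def by auto
  have meet: "G \<inter> H \<noteq> {}" if "G \<in> F" "H \<in> F" for G H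
    using that cr crossing_one_iff[OF F] by blast
  have crXY: "crossing 1 X Y"
    using link_pair_meet[OF F cr, of _ i j] crossing_one_iff[OF sub(1)] unfolding X_def Y_def by blast
  have crWZ: "crossing 1 W Z"
    unfolding crossing_one_iff[OF sub(4)]
  proof (intro ballI)
    fix P Q assume "P \<in> W" "Q \<in> Z"
    then have "P \<inter> insert j (insert i Q) \<noteq> {}" "i \<notin> P" "j \<notin> P"
      using meet[of P "insert j (insert i Q)"] by (auto simp: W_def Z_def link_def del_def)
    then show "P \<inter> Q \<noteq> {}" by auto
  qed
  have ne: "X \<noteq> {}" "Y \<noteq> {}" "\<not> X \<subseteq> Y" "\<not> Y \<subseteq> X"
    using inc unfolding X_def[symmetric] Y_def[symmetric] by auto
  have NN: "2 * d < N" using n nN d by simp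
  have pas: "(card V - 1) choose (k - 1) = (N choose d) + (N choose (d - 1))"
    using nN d choose_Suc_pos[of "N + 1" d] by simp
  have ar: "card V - 1 - k = N - d" "card V - 1 - k - 1 = N - d - 1" "k - 1 = d" "k - 2 = d - 1"
    using nN d by auto
  \<comment> \<open>Strict, because equality in \<open>cross_same_size\<close> would make
    \<open>X\<close> and \<open>Y\<close> comparable.\<close>
  have two': "card X + card Y + ((N - d) choose d) + ((N - d - 1) choose (d - 1)) < (N choose d) + 2"
    if "2 \<le> card X" "2 \<le> card Y"
    using cross_same_size[OF fU sub(1,2) crXY d(2) _ that] NN ne unfolding N_def by fastforce
  show ?thesis
  proof (cases "W = {}")
    case True
    \<comment> \<open>Without \<open>W\<close>, the sizes of \<open>X\<close> and \<open>Y\<close>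
      are the numbers of members avoiding \<open>j\<close> and \<open>i\<close>, hence at least 2,
      and the trivial bound for \<open>Z\<close> is enough.\<close>
    have "card Z \<le> N choose (d - 1)"
      using card_mono[OF _ sub(3)] card_nsets[OF fU] fU unfolding N_def by simp
    moreover have "2 \<le> card X" "2 \<le> card Y" using two ci cj True by auto
    ultimately show ?thesis using two' cF True pas ar by simp
  next
    case False
    \<comment> \<open>The sizes \<open>k\<close> and \<open>k - 2\<close> of the members of
      \<open>W\<close> and \<open>Z\<close> call for \<open>t = 3\<close>; this is where
      3-intersection of \<open>W\<close> enters.\<close>
    have cp: "cross_pair U k (d - 1) 3 W Z"
      using fU sub crWZ W d NN unfolding cross_pair_def W_def[symmetric] N_def by auto
    have WZ: "card W + card Z + ((N - d - 1) choose (d - 1)) \<le> (N choose (d - 1)) + 1"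
      using cross_pair_bound[OF cp False] d unfolding N_def[symmetric] by simp
    show ?thesis
    proof (cases "2 \<le> card X \<and> 2 \<le> card Y")
      case True
      have "2 \<le> (N - d - 1) choose (d - 1)" by (rule binomial_ge_two) (use d NN in linarith)+
      then show ?thesis using True two' WZ cF pas ar by simp
    next
      case False
      \<comment> \<open>One of \<open>X\<close> and \<open>Y\<close> is a singleton not contained in
        the other, which removes the constant from their joint bound. The second binomial of the
        claim is then supplied by the bound for \<open>W\<close> and \<open>Z\<close>.\<close>
      have "card X \<noteq> 0" "card Y \<noteq> 0" using ne fin by auto
      with False have "card X = 1 \<or> card Y = 1" by linarith
      then have "card X + card Y + ((N - d) choose d) \<le> N choose d"
      proof
        assume "card Y = 1"
        then obtain Q where Q: "Y = {Q}" by (rule card_1_singletonE)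
        then show ?thesis
          using card_cross_singleton[OF fU sub(1) Q _ _ crXY] sub ne d unfolding N_def by auto
      next
        assume "card X = 1"
        then obtain Q where Q: "X = {Q}" by (rule card_1_singletonE)
        then show ?thesis
          using card_cross_singleton[OF fU sub(2) Q _ _ crossing_sym[OF crXY]] sub ne d unfolding N_def by auto
      qed
      then show ?thesis using WZ cF pas ar by simp
    qed
  qed
qed

section \<open>Nontrivial intersecting families of sets of size at least four\<close>

text \<open>The four-element layer of \<open>W_star_7\<close> in symmetric form: each of the three
  points of \<open>T\<close> can serve as its centre. Some point of \<open>T\<close> therefore lies
  outside any given pair \<open>{i, j}\<close>, which is what undoing a shift requires.\<close>

definition two_of_three :: "'a set \<Rightarrow> 'a set set \<Rightarrow> bool" where
  "two_of_three V F \<longleftrightarrow> (\<exists>T\<subseteq>V. card T = 3 \<and> F = {G \<in> nsets V 4. 2 \<le> card (G \<inter> T)})"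

lemma family_eqI:
  assumes "del c F = del c G" "link c F = link c G"
  shows "F = G"
proof -
  have *: "H = del c H \<union> insert c ` link c H" for H
  proof (intro equalityI subsetI)
    fix x assume "x \<in> H"
    then show "x \<in> del c H \<union> insert c ` link c H"
      by (cases "c \<in> x") (auto simp: del_def link_def insert_absorb intro!: image_eqI[of _ _ "x - {c}"])
  qed (auto simp: del_def link_def)
  show ?thesis using *[of F] *[of G] assms by simp
qed

lemma two_of_three_parts:
  assumes "finite V" "c \<in> V" "E \<subseteq> V - {c}" "card E = 2"
  shows "del c {G \<in> nsets V 4. 2 \<le> card (G \<inter> insert c E)} = {F \<in> nsets (V - {c}) 4. E \<subseteq> F}"
    and "link c {G \<in> nsets V 4. 2 \<le> card (G \<inter> insert c E)} = {G \<in> nsets (V - {c}) 3. G \<inter> E \<noteq> {}}"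
proof -
  have fE: "finite E" "c \<notin> E" using assms finite_subset by auto
  have e2: "2 \<le> card (G \<inter> E) \<longleftrightarrow> E \<subseteq> G" for G
  proof
    assume "2 \<le> card (G \<inter> E)"
    then have "G \<inter> E = E" using fE assms(4) by (intro card_seteq) auto
    then show "E \<subseteq> G" by auto
  next
    assume "E \<subseteq> G" then show "2 \<le> card (G \<inter> E)" using assms(4) by (simp add: Int_absorb1)
  qed
  show "del c {G \<in> nsets V 4. 2 \<le> card (G \<inter> insert c E)} = {F \<in> nsets (V - {c}) 4. E \<subseteq> F}"
  proof -
    have "G \<in> nsets (V - {c}) 4 \<longleftrightarrow> G \<in> nsets V 4 \<and> c \<notin> G" for G by (auto simp: nsets_def)
    moreover have "c \<notin> G \<Longrightarrow> G \<inter> insert c E = G \<inter> E" for G by simp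
    ultimately show ?thesis using e2 unfolding del_def by auto
  qed
  show "link c {G \<in> nsets V 4. 2 \<le> card (G \<inter> insert c E)} = {G \<in> nsets (V - {c}) 3. G \<inter> E \<noteq> {}}"
  proof (rule set_eqI)
    fix G
    show "G \<in> link c {G \<in> nsets V 4. 2 \<le> card (G \<inter> insert c E)} \<longleftrightarrow>
      G \<in> {G \<in> nsets (V - {c}) 3. G \<inter> E \<noteq> {}}"
    proof (cases "c \<in> G")
      case True then show ?thesis by (auto simp: link_def nsets_def)
    next
      case False
      have "insert c G \<inter> insert c E = insert c (G \<inter> E)" by auto
      then have "card (insert c G \<inter> insert c E) = Suc (card (G \<inter> E))" using False fE by simp
      then have "2 \<le> card (insert c G \<inter> insert c E) \<longleftrightarrow> G \<inter> E \<noteq> {}"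
        using fE by (simp add: numeral_2_eq_2 Suc_le_eq card_gt_0_iff)
      moreover have "insert c G \<in> nsets V 4 \<longleftrightarrow> G \<in> nsets (V - {c}) 3"
        using False assms by (auto simp: nsets_def)
      ultimately show ?thesis using False by (simp add: link_def)
    qed
  qed
qed

lemma two_of_threeI:
  assumes "finite V" "c \<in> V" "E \<subseteq> V - {c}" "card E = 2"
    and "del c F = {F \<in> nsets (V - {c}) 4. E \<subseteq> F}" "link c F = {G \<in> nsets (V - {c}) 3. G \<inter> E \<noteq> {}}"
  shows "two_of_three V F"
proof -
  have "F = {G \<in> nsets V 4. 2 \<le> card (G \<inter> insert c E)}"
    by (rule family_eqI[of c]) (simp_all add: two_of_three_parts[OF assms(1-4)] assms(5,6))
  moreover have "card (insert c E) = 3"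
  proof -
    have "finite E" "c \<notin> E" using assms finite_subset by auto
    then show ?thesis using assms(4) by simp
  qed
  ultimately show ?thesis using assms unfolding two_of_three_def by (intro exI[of _ "insert c E"]) auto
qed

text \<open>The first alternative records only a cardinality, since together with a tight total
  \<open>card_two_full\<close> recovers the two sets and the link of \<open>c\<close>. The second is
  the four-element layer of \<open>W_star_star_7\<close> up to isomorphism.\<close>

definition nontrivial_extremal :: "'a set \<Rightarrow> nat \<Rightarrow> 'a set set \<Rightarrow> bool" where
  "nontrivial_extremal V k F \<longleftrightarrow> (\<exists>c\<in>V. card (del c F) = 2) \<or>
     (k = 4 \<and> (\<exists>c\<in>V. \<exists>E\<subseteq>V - {c}. card E = 3 \<and> del c F = {F \<in> nsets (V - {c}) 4. E \<subseteq> F} \<and>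
        link c F = {G \<in> nsets (V - {c}) 3. G \<inter> E \<noteq> {}})) \<or>
     (k = 4 \<and> two_of_three V F)"

text \<open>For an incomparable pair \<open>i\<close>, \<open>j\<close> the matter is decided by the
  members \<open>W\<close> avoiding both points. If they are 3-intersecting,
  \<open>incomparable_bound\<close> gives strict inequality. Otherwise \<open>W\<close> has two
  members, survives the shift unchanged and keeps the shifted family nontrivial. It also prevents
  \<open>i\<close> and \<open>j\<close> from being centres of the shifted extremal family, so the
  shift can be undone separately in the deletion and in the link at a centre.\<close>

theorem nontrivial_intersecting_bound:
  fixes V :: "nat set"
  assumes fV: "finite V" and k: "4 \<le> k" and n: "2 * k < card V"
    and "F \<subseteq> nsets V k" "crossing 1 F F" "\<And>x. x \<in> V \<Longrightarrow> 2 \<le> card (del x F)"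
  shows "card F + ((card V - 1 - k) choose (k - 1)) + ((card V - 1 - k - 1) choose (k - 2))
      \<le> ((card V - 1) choose (k - 1)) + 2 \<and>
    (card F + ((card V - 1 - k) choose (k - 1)) + ((card V - 1 - k - 1) choose (k - 2))
      = ((card V - 1) choose (k - 1)) + 2 \<longrightarrow> nontrivial_extremal V k F)"
  using assms(4-6)
proof (induction "weight F" arbitrary: F rule: less_induct)
  case less
  note F = less.prems(1) and cr = less.prems(2) and dv = less.prems(3)
  have fF: "finite F" using F fV by (auto intro: finite_subset[OF _ finite_nsets])
  have ff: "finite G" if "G \<in> F" for G using that F by (auto simp: nsets_def)
  define bnd where "bnd G \<longleftrightarrow> card G + ((card V - 1 - k) choose (k - 1)) + ((card V - 1 - k - 1) choose (k - 2))
      \<le> ((card V - 1) choose (k - 1)) + 2" for G :: "nat set set"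
  define tight where "tight G \<longleftrightarrow> card G + ((card V - 1 - k) choose (k - 1)) + ((card V - 1 - k - 1) choose (k - 2))
      = ((card V - 1) choose (k - 1)) + 2" for G :: "nat set set"
  have meet: "G \<inter> H \<noteq> {}" if "G \<in> F" "H \<in> F" for G H
    using that cr crossing_one_iff[OF F] by blast
  have "bnd F \<and> (tight F \<longrightarrow> nontrivial_extremal V k F)"
  proof (cases "\<forall>i\<in>V. \<forall>j\<in>V. i \<noteq> j \<longrightarrow>
      link i (del j F) \<subseteq> link j (del i F) \<or> link j (del i F) \<subseteq> link i (del j F)")
    case comp: True
    have V: "V \<noteq> {}" using n by auto
    \<comment> \<open>\<open>c\<close> is a point of maximum degree. For every \<open>j\<close>,
      comparability of the traces together with this choice makes \<open>F\<close> stable under the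
      shift from \<open>j\<close> to \<open>c\<close>.\<close>
    have "Max ((\<lambda>x. card (link x F)) ` V) \<in> (\<lambda>x. card (link x F)) ` V"
      using fV V by (intro Max_in) auto
    then obtain c where c: "c \<in> V" "card (link c F) = Max ((\<lambda>x. card (link x F)) ` V)" by auto
    have cmax: "card (link x F) \<le> card (link c F)" if "x \<in> V" for x
      using that c fV by (auto intro: Max_ge)
    have move: "insert c (P - {j}) \<in> F" if P: "P \<in> F" "j \<in> P" "c \<notin> P" for P j
    proof -
      have jV: "j \<in> V" using P F by (auto simp: nsets_def)
      have ne: "c \<noteq> j" using P by auto
      have fl: "finite (link x F)" for x
        using link_nsets[OF F] fV by (auto intro: finite_subset[OF _ finite_nsets])
      have e1: "card (link c F) = card (link c (del j F)) + card (link c (link j F))"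
      proof -
        have "link j (link c F) = link c (link j F)" using ne
          by (auto simp: link_def insert_commute)
        then show ?thesis
          using card_del_link[OF fl, of c j] del_link_commute[of j c F] ne by simp
      qed
      have e2: "card (link j F) = card (link j (del c F)) + card (link c (link j F))"
        using card_del_link[OF fl, of j c] del_link_commute[of c j F] ne by simp
      have le: "card (link j (del c F)) \<le> card (link c (del j F))"
        using cmax[OF jV] e1 e2 by simp
      have fd: "finite (link c (del j F))"
        using link_nsets[OF del_nsets[OF F]] fV by (auto intro: finite_subset[OF _ finite_nsets])
      have fd': "finite (link j (del c F))"
        using link_nsets[OF del_nsets[OF F]] fV by (auto intro: finite_subset[OF _ finite_nsets])
      have "link j (del c F) \<subseteq> link c (del j F)"
      proof -
        consider "link c (del j F) \<subseteq> link j (del c F)" | "link j (del c F) \<subseteq> link c (del j F)"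
          using comp c(1) jV ne by blast
        then show ?thesis
        proof cases
          case 1
          then have "link c (del j F) = link j (del c F)" using card_seteq[OF fd' 1] le by simp
          then show ?thesis by simp
        qed
      qed
      moreover have "P - {j} \<in> link j (del c F)"
        using P ne by (auto simp: link_def del_def insert_absorb)
      ultimately show ?thesis by (auto simp: link_def del_def)
    qed
    have cr2: "crossing 2 (del c F) (del c F)"
      unfolding crossing_def
    proof (intro ballI)
      fix P Q assume P: "P \<in> del c F" and Q: "Q \<in> del c F"
      have PQ: "P \<in> F" "c \<notin> P" "Q \<in> F" "c \<notin> Q" using P Q by (auto simp: del_def)
      show "2 \<le> card (P \<inter> Q)"
      proof (rule ccontr)
        assume "\<not> 2 \<le> card (P \<inter> Q)"
        moreover have "card (P \<inter> Q) \<noteq> 0" using meet[OF PQ(1,3)] ff[OF PQ(1)] by simp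
        ultimately have "card (P \<inter> Q) = 1" by linarith
        \<comment> \<open>If \<open>j\<close> were the only common point of \<open>P\<close> and
          \<open>Q\<close>, exchanging it for \<open>c\<close> in \<open>P\<close> would yield a
          member disjoint from \<open>Q\<close>.\<close>
        then obtain j where j: "P \<inter> Q = {j}" by (rule card_1_singletonE)
        then have "insert c (P - {j}) \<in> F" using move PQ by blast
        then have "insert c (P - {j}) \<inter> Q \<noteq> {}" using meet PQ by blast
        then show False using j PQ by auto
      qed
    qed
    define U where "U = V - {c}"
    have U: "finite U" "card U = card V - 1" using c fV by (auto simp: U_def)
    have cp: "cross_pair U k (k - 1) 2 (del c F) (link c F)"
      using del_nsets[OF F] link_nsets[OF F] cr2 crossing_del_link[OF F cr] U k n
      unfolding cross_pair_def U_def[symmetric] by (auto simp: U_def)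
    have cA: "2 \<le> card (del c F)" using dv c by blast
    have b3: "3 \<le> k - 1" using k by simp
    have cF: "card F = card (del c F) + card (link c F)" by (rule card_del_link[OF fF])
    note core = cross_pair_bound_two[OF cp cA b3]
    have "k - 1 - 1 = k - 2" by simp
    then have "bnd F" using core(1) cF U unfolding bnd_def by simp
    moreover have "nontrivial_extremal V k F" if "tight F"
    proof -
      have "k + (k - 1) < card U" using n U k by simp
      then have "card (del c F) = 2 \<or> (k - 1 = 3 \<and> (\<exists>E\<subseteq>U. (card E = 2 \<or> card E = 2 + 1) \<and>
         del c F = {F \<in> nsets U k. E \<subseteq> F} \<and> link c F = {G \<in> nsets U (k - 1). G \<inter> E \<noteq> {}}))"
        using core(2) that cF U \<open>k - 1 - 1 = k - 2\<close> unfolding tight_def by simp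
      then show ?thesis
      proof
        assume "card (del c F) = 2" then show ?thesis using c unfolding nontrivial_extremal_def by blast
      next
        assume "k - 1 = 3 \<and> (\<exists>E\<subseteq>U. (card E = 2 \<or> card E = 2 + 1) \<and>
         del c F = {F \<in> nsets U k. E \<subseteq> F} \<and> link c F = {G \<in> nsets U (k - 1). G \<inter> E \<noteq> {}})"
        then obtain E where E: "k = 4" "E \<subseteq> U" "card E = 2 \<or> card E = 3"
          "del c F = {F \<in> nsets U 4. E \<subseteq> F}" "link c F = {G \<in> nsets U 3. G \<inter> E \<noteq> {}}" by auto
        from E(3) show ?thesis
        proof
          assume "card E = 2"
          then have "two_of_three V F" using two_of_threeI[OF fV c(1), of E F] E U_def by auto
          then show ?thesis using E unfolding nontrivial_extremal_def by blast
        next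
          assume "card E = 3"
          then have "\<exists>E\<subseteq>V - {c}. card E = 3 \<and> del c F = {F \<in> nsets (V - {c}) 4. E \<subseteq> F} \<and>
              link c F = {G \<in> nsets (V - {c}) 3. G \<inter> E \<noteq> {}}"
            using E unfolding U_def by (intro exI[of _ E] conjI)
          then have "\<exists>c\<in>V. \<exists>E\<subseteq>V - {c}. card E = 3 \<and> del c F = {F \<in> nsets (V - {c}) 4. E \<subseteq> F} \<and>
              link c F = {G \<in> nsets (V - {c}) 3. G \<inter> E \<noteq> {}}"
            by (rule bexI[OF _ c(1)])
          then show ?thesis using E(1) unfolding nontrivial_extremal_def by (intro disjI2 disjI1 conjI)
        qed
      qed
    qed
    ultimately show ?thesis by blast
  next
    case False
    then obtain i0 j0 where ij0: "i0 \<in> V" "j0 \<in> V" "i0 \<noteq> j0"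
      "\<not> link i0 (del j0 F) \<subseteq> link j0 (del i0 F)" "\<not> link j0 (del i0 F) \<subseteq> link i0 (del j0 F)" by blast
    \<comment> \<open>The condition is symmetric in the two points, so they may be ordered; the
      shift towards the smaller one lowers the weight.\<close>
    obtain i j where ij: "i \<in> V" "j \<in> V" "i < j"
      "\<not> link i (del j F) \<subseteq> link j (del i F)" "\<not> link j (del i F) \<subseteq> link i (del j F)"
    proof (cases "i0 < j0")
      case True then show ?thesis using that ij0 by blast
    next
      case False then show ?thesis using that[of j0 i0] ij0 by auto
    qed
    define W where "W = del i (del j F)"
    show ?thesis
    proof (cases "crossing 3 W W")
      case True
      then show ?thesis
        using incomparable_bound[OF fV F cr k n ij(1,2) _ dv dv _ ij(4,5)] ij unfolding bnd_def tight_def W_def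
        by auto
    next
      case W3: False
      define F' where "F' = shift i j F"
      have F': "F' \<subseteq> nsets V k" unfolding F'_def by (rule shift_subset_nsets[OF F ij(1,2)])
      have fF': "finite F'" using F' fV by (auto intro: finite_subset[OF _ finite_nsets])
      have cr': "crossing 1 F' F'" unfolding F'_def by (rule crossing_shift[OF cr]) (use ff in auto)
      have cF': "card F' = card F" unfolding F'_def by (rule card_shift[OF fF])
      obtain P where P: "insert j P \<in> F" "i \<notin> P" "j \<notin> P" "insert i P \<notin> F"
        using ij by (auto simp: link_def del_def)
      have wt: "weight F' < weight F"
        unfolding F'_def by (rule weight_shift(2)[OF fF ff ij(3), of "insert j P"]) (use P ij in auto)
      have WF': "W \<subseteq> del i F'" "W \<subseteq> del j F'"
        unfolding W_def F'_def
        by (auto simp: del_def shift_def transpose_image_eq)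
      \<comment> \<open>A lone member meets itself in \<open>k\<close> points, so a failure of
        3-intersection requires two members.\<close>
      have W2: "2 \<le> card W"
      proof (rule ccontr)
        assume "\<not> 2 \<le> card W"
        moreover have fW: "finite W" using fF unfolding W_def by (auto simp: del_def)
        ultimately have one: "G = H" if "G \<in> W" "H \<in> W" for G H
          using that card_le_Suc0_iff_eq[OF fW] by simp
        have "crossing 3 W W" unfolding crossing_def
        proof (intro ballI)
          fix G H assume "G \<in> W" "H \<in> W"
          then have "G = H" "G \<in> F" using one by (auto simp: W_def del_def)
          then have "card (G \<inter> H) = k" using F by (auto simp: nsets_def)
          then show "3 \<le> card (G \<inter> H)" using k by simp
        qed
        then show False using W3 by blast
      qed
      have dv': "2 \<le> card (del x F')" if x: "x \<in> V" for x
      proof -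
        have fd: "finite (del x F')" using fF' by (rule finite_del)
        consider "x = i \<or> x = j" | "x \<noteq> i" "x \<noteq> j" by blast
        then show ?thesis
        proof cases
          case 1
          then have "card W \<le> card (del x F')" using WF' fd card_mono by blast
          then show ?thesis using W2 by simp
        next
          case 2
          then have "del x F' = shift i j (del x F)" unfolding F'_def by (rule del_shift)
          then have "card (del x F') = card (del x F)"
            using card_shift[of "del x F"] finite_del[OF fF] by simp
          then show ?thesis using dv x by simp
        qed
      qed
      have IH: "bnd F' \<and> (tight F' \<longrightarrow> nontrivial_extremal V k F')"
        using less.hyps[OF wt F' cr' dv'] unfolding bnd_def tight_def .
      have "nontrivial_extremal V k F" if tF: "tight F"
      proof -
        have tF': "tight F'" using tF cF' unfolding tight_def by simp
        \<comment> \<open>For a centre outside \<open>{i, j}\<close> the shift commutes with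
          deletion and link, so a star pair can be pulled back within
          \<open>V - {c}\<close>.\<close>
        have shiftback: "\<exists>E'\<subseteq>V - {c}. card E' = card E \<and> del c F = {F \<in> nsets (V - {c}) 4. E' \<subseteq> F} \<and>
            link c F = {G \<in> nsets (V - {c}) 3. G \<inter> E' \<noteq> {}}"
          if k4: "k = 4" and c: "c \<in> V" "c \<noteq> i" "c \<noteq> j" and E: "E \<subseteq> V - {c}" "card E < 4"
            "del c F' = {F \<in> nsets (V - {c}) 4. E \<subseteq> F}" "link c F' = {G \<in> nsets (V - {c}) 3. G \<inter> E \<noteq> {}}"
          for c E
        proof (rule unshift_supersets)
          show "del c F \<subseteq> nsets (V - {c}) 4" using del_nsets[OF F] k4 by simp
          show "link c F \<subseteq> nsets (V - {c}) 3" using link_nsets[OF F, of c] k4 by simp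
          show "crossing 1 (del c F) (link c F)" by (rule crossing_del_link[OF F cr])
          show "shift i j (del c F) = {F \<in> nsets (V - {c}) 4. E \<subseteq> F}"
            using E(3) del_shift[OF c(2,3)] unfolding F'_def by simp
          show "shift i j (link c F) = {G \<in> nsets (V - {c}) 3. G \<inter> E \<noteq> {}}"
            using E(4) link_shift[OF c(2,3)] unfolding F'_def by simp
        qed (use fV n k4 c ij E in auto)
        have inV: "W \<subseteq> del c F'" if "c = i \<or> c = j" for c using WF' that by blast
        consider (two) c where "c \<in> V" "card (del c F') = 2"
          | (star) c E where "k = 4" "c \<in> V" "E \<subseteq> V - {c}" "card E = 3"
              "del c F' = {F \<in> nsets (V - {c}) 4. E \<subseteq> F}" "link c F' = {G \<in> nsets (V - {c}) 3. G \<inter> E \<noteq> {}}"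
          | (three) T where "k = 4" "T \<subseteq> V" "card T = 3" "F' = {G \<in> nsets V 4. 2 \<le> card (G \<inter> T)}"
          using IH tF' unfolding nontrivial_extremal_def two_of_three_def by blast
        then show ?thesis
        proof cases
          case two
          show ?thesis
          proof (cases "c = i \<or> c = j")
            case False
            then have "del c F' = shift i j (del c F)" unfolding F'_def by (intro del_shift) auto
            then have "card (del c F) = 2"
              using two card_shift[of "del c F" i j] finite_del[OF fF, of c] by simp
            then show ?thesis using two unfolding nontrivial_extremal_def by blast
          next
            case True
            \<comment> \<open>A centre in \<open>{i, j}\<close> is impossible: by tightness the two
              members of \<open>del c F'\<close> share \<open>k - 1\<close> points, at least three,
              which would make the subfamily \<open>W\<close> 3-intersecting.\<close>
            have U: "finite (V - {c})" "card (V - {c}) = card V - 1" using fV two by auto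
            have "card F' = card (del c F') + card (link c F')" by (rule card_del_link[OF fF'])
            then have e: "card (del c F') + card (link c F') + ((card (V - {c}) - k) choose (k - 1))
              + ((card (V - {c}) - k - 1) choose (k - 1 - 1)) = (card (V - {c}) choose (k - 1)) + 2"
              using tF' U(2) unfolding tight_def by (simp add: numeral_2_eq_2)
            have kk: "k + (k - 1) < card (V - {c})" "1 \<le> k - 1" unfolding U(2) using n k by linarith+
            from card_two_full[OF U(1) del_nsets[OF F'] link_nsets[OF F'] crossing_del_link[OF F' cr'] kk two(2) e]
            obtain P Q where "P \<noteq> Q \<and> del c F' = {P, Q} \<and> card (P \<inter> Q) = k - 1 \<and>
              link c F' = {G \<in> nsets (V - {c}) (k - 1). G \<inter> P \<noteq> {} \<and> G \<inter> Q \<noteq> {}}"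
              by (elim exE)
            then have PQ: "del c F' = {P, Q}" "card (P \<inter> Q) = k - 1" by simp_all
            have "card P = k" "card Q = k" using PQ(1) F' by (auto simp: del_def nsets_def)
            then have "crossing 3 {P, Q} {P, Q}"
              using PQ(2) k unfolding crossing_def by (auto simp: Int_commute)
            then have "crossing 3 W W" using inV[OF True] PQ(1) crossing_mono by metis
            then show ?thesis using W3 by blast
          qed
        next
          case star
          show ?thesis
          proof (cases "c = i \<or> c = j")
            case False
            then obtain E' where "E' \<subseteq> V - {c}" "card E' = card E" "del c F = {F \<in> nsets (V - {c}) 4. E' \<subseteq> F}"
              "link c F = {G \<in> nsets (V - {c}) 3. G \<inter> E' \<noteq> {}}"
              using shiftback[OF star(1,2) _ _ star(3) _ star(5,6)] star(4) by auto
            then have "\<exists>E\<subseteq>V - {c}. card E = 3 \<and> del c F = {F \<in> nsets (V - {c}) 4. E \<subseteq> F} \<and>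
              link c F = {G \<in> nsets (V - {c}) 3. G \<inter> E \<noteq> {}}"
              using star(4) by (intro exI[of _ E'] conjI) simp_all
            then have "\<exists>c\<in>V. \<exists>E\<subseteq>V - {c}. card E = 3 \<and> del c F = {F \<in> nsets (V - {c}) 4. E \<subseteq> F} \<and>
              link c F = {G \<in> nsets (V - {c}) 3. G \<inter> E \<noteq> {}}"
              by (rule bexI[OF _ star(2)])
            then show ?thesis using star(1) unfolding nontrivial_extremal_def by (intro disjI2 disjI1 conjI)
          next
            case True
            have "crossing 3 W W" unfolding crossing_def
            proof (intro ballI)
              fix G H assume "G \<in> W" "H \<in> W"
              then have "E \<subseteq> G \<inter> H" "finite (G \<inter> H)"
                using inV[OF True] unfolding star(5) by (auto simp: nsets_def)
              then have "card E \<le> card (G \<inter> H)" using card_mono by blast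
              then show "3 \<le> card (G \<inter> H)" using star by simp
            qed
            then show ?thesis using W3 by blast
          qed
        next
          case three
          have "\<not> T \<subseteq> {i, j}"
          proof
            assume "T \<subseteq> {i, j}"
            then have "card T \<le> card {i, j}" by (intro card_mono) auto
            also have "\<dots> \<le> 2" using card_insert_le_m1[of 2 "{j}" i] by simp
            finally show False using three by simp
          qed
          then obtain c where c: "c \<in> T" "c \<noteq> i" "c \<noteq> j" by auto
          define E where "E = T - {c}"
          have fT: "finite T" using three fV finite_subset by auto
          have E: "E \<subseteq> V - {c}" "card E = 2" "insert c E = T" "c \<in> V"
            using three c fT by (auto simp: E_def)
          have "del c F' = {F \<in> nsets (V - {c}) 4. E \<subseteq> F}" "link c F' = {G \<in> nsets (V - {c}) 3. G \<inter> E \<noteq> {}}"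
            using two_of_three_parts[OF fV E(4,1,2)] three(4) E(3) by auto
          then obtain E' where "E' \<subseteq> V - {c}" "card E' = card E" "del c F = {F \<in> nsets (V - {c}) 4. E' \<subseteq> F}"
              "link c F = {G \<in> nsets (V - {c}) 3. G \<inter> E' \<noteq> {}}"
            using shiftback[OF three(1) E(4) c(2,3) E(1)] E(2) by auto
          then have "two_of_three V F" using two_of_threeI[OF fV E(4), of E' F] E(2) by simp
          then show ?thesis using three unfolding nontrivial_extremal_def by blast
        qed
      qed
      then show ?thesis using IH cF' unfolding bnd_def by simp
    qed
  qed
  then show ?case unfolding bnd_def tight_def .
qed

subsection \<open>Three-element sets\<close>

lemma pair_subset_of_meeting:
  assumes "f \<in> nsets U 2" "f \<inter> e \<noteq> {}" "f \<inter> e' \<noteq> {}" "e \<inter> e' = {}"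
  shows "f \<subseteq> e \<union> e'"
proof -
  obtain u v where uv: "u \<in> f \<inter> e" "v \<in> f \<inter> e'" using assms by blast
  then have "u \<noteq> v" using assms(4) by auto
  have "{u, v} = f"
    by (rule card_subset_eq) (use uv \<open>u \<noteq> v\<close> assms(1) in \<open>auto simp: nsets_def\<close>)
  then show ?thesis using uv by auto
qed

text \<open>Pairwise meeting edges without a common vertex form a triangle, and an edge meeting all
  three sides of a triangle is one of these sides.\<close>

lemma cross_graphs_nonstar_triangle:
  assumes X: "X \<subseteq> nsets U 2" and Y: "Y \<subseteq> nsets U 2" and cr: "\<And>e f. e \<in> X \<Longrightarrow> f \<in> Y \<Longrightarrow> e \<inter> f \<noteq> {}"
    and ns: "\<And>z. \<exists>e\<in>X. z \<notin> e" and int: "\<And>e f. e \<in> X \<Longrightarrow> f \<in> X \<Longrightarrow> e \<inter> f \<noteq> {}"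
  shows "card X + card Y \<le> 6"
proof -
  obtain e1 where e1: "e1 \<in> X" using ns by auto
  then obtain a b where ab: "e1 = {a, b}" "a \<noteq> b" using X by (auto simp: nsets_def card_2_iff)
  obtain e2 where e2: "e2 \<in> X" "a \<notin> e2" using ns by auto
  obtain c where c: "e2 = {b, c}" "b \<noteq> c"
  proof -
    have "b \<in> e2" using int[OF e1 e2(1)] ab e2 by auto
    moreover have "card e2 = 2" using e2 X by (auto simp: nsets_def)
    then obtain u v where "e2 = {u, v}" "u \<noteq> v" unfolding card_2_iff by blast
    ultimately show ?thesis using that by fastforce
  qed
  obtain e3 where e3: "e3 \<in> X" "b \<notin> e3" using ns by auto
  have e3': "a \<in> e3" "c \<in> e3" using int[OF e1 e3(1)] int[OF e2(1) e3(1)] ab c e3 by auto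
  have ne: "a \<noteq> c" using e2 c by auto
  have sub: "f \<in> nsets {a, b, c} 2" if "f \<in> nsets U 2" "f \<inter> e1 \<noteq> {}" "f \<inter> e2 \<noteq> {}" "f \<inter> e3 \<noteq> {}" for f
  proof -
    have cf: "card f = 2" "finite f" using that by (auto simp: nsets_def)
    have "card e3 = 2" "finite e3" using e3 X by (auto simp: nsets_def)
    then have "{a, c} = e3" using e3' ne by (intro card_subset_eq) auto
    then have e3c: "e3 = {a, c}" by simp
    obtain u v where uv: "f = {u, v}" using cf(1) unfolding card_2_iff by blast
    have "f \<subseteq> {a, b, c}" using that(2-4) ab(1) c(1) e3c ab(2) c(2) ne unfolding uv by auto
    then show ?thesis using cf by (auto simp: nsets_def)
  qed
  have "X \<subseteq> nsets {a, b, c} 2"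
  proof
    fix f assume f: "f \<in> X"
    show "f \<in> nsets {a, b, c} 2"
      by (rule sub) (use X f in blast, rule int[OF f e1], rule int[OF f e2(1)], rule int[OF f e3(1)])
  qed
  moreover have "Y \<subseteq> nsets {a, b, c} 2"
  proof
    fix f assume f: "f \<in> Y"
    have "e \<inter> f = f \<inter> e" for e by (rule Int_commute)
    then show "f \<in> nsets {a, b, c} 2"
      using cr[OF e1 f] cr[OF e2(1) f] cr[OF e3(1) f] f Y by (intro sub) auto
  qed
  moreover have "card (nsets {a, b, c} 2) \<le> 3"
  proof -
    have "card {a, b, c} = 3" using ab c ne by simp
    then show ?thesis using card_nsets[of "{a, b, c}" 2] by (simp add: numeral_eq_Suc)
  qed
  ultimately show ?thesis
    using card_mono[of "nsets {a, b, c} 2" X] card_mono[of "nsets {a, b, c} 2" Y] by simp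
qed

text \<open>If neither graph is intersecting, two disjoint edges of \<open>X\<close> span four
  points that must contain every edge of \<open>Y\<close>, and two disjoint edges of
  \<open>Y\<close> then confine \<open>X\<close> to the same points. On four points
  \<open>card_complementary\<close> gives 6; the intersecting case gives 6 through the
  triangle.\<close>

lemma cross_graphs_nonstar:
  assumes X: "X \<subseteq> nsets U 2" and Y: "Y \<subseteq> nsets U 2" and cr: "\<And>e f. e \<in> X \<Longrightarrow> f \<in> Y \<Longrightarrow> e \<inter> f \<noteq> {}"
    and ns: "\<And>z. \<exists>e\<in>X. z \<notin> e" "\<And>z. \<exists>e\<in>Y. z \<notin> e"
  shows "card X + card Y \<le> 6"
proof (cases "(\<forall>e\<in>X. \<forall>f\<in>X. e \<inter> f \<noteq> {}) \<or> (\<forall>e\<in>Y. \<forall>f\<in>Y. e \<inter> f \<noteq> {})")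
  case True
  then show ?thesis
  proof
    assume "\<forall>e\<in>X. \<forall>f\<in>X. e \<inter> f \<noteq> {}"
    then show ?thesis using cross_graphs_nonstar_triangle[OF X Y cr ns(1)] by blast
  next
    assume "\<forall>e\<in>Y. \<forall>f\<in>Y. e \<inter> f \<noteq> {}"
    then have "card Y + card X \<le> 6"
      using cross_graphs_nonstar_triangle[OF Y X _ ns(2)] cr by (metis Int_commute)
    then show ?thesis by simp
  qed
next
  case False
  then obtain e e' f f' where ef: "e \<in> X" "e' \<in> X" "e \<inter> e' = {}" "f \<in> Y" "f' \<in> Y" "f \<inter> f' = {}"
    by blast
  have c2: "card g = 2 \<and> finite g" if "g \<in> X \<union> Y" for g using that X Y by (auto simp: nsets_def)
  define S where "S = e \<union> e'"
  have S: "card S = 4" "finite S" using ef c2[of e] c2[of e'] unfolding S_def by (auto simp: card_Un_disjoint)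
  have YS: "g \<subseteq> S" if "g \<in> Y" for g
    unfolding S_def using pair_subset_of_meeting[of g U e e'] that Y cr[OF ef(1) that] cr[OF ef(2) that] ef by blast
  have "f \<union> f' = S"
    by (rule card_subset_eq) (use S YS ef c2[of f] c2[of f'] in \<open>auto simp: card_Un_disjoint\<close>)
  then have XS: "g \<subseteq> S" if "g \<in> X" for g
    using pair_subset_of_meeting[of g U f f'] that X cr[OF that ef(4)] cr[OF that ef(5)] ef by blast
  have sub: "X \<subseteq> nsets S 2" "Y \<subseteq> nsets S 2" using XS YS c2 by (auto simp: nsets_def)
  have "crossing 1 X Y" using crossing_one_iff[OF X] cr by blast
  then have "card X + card Y \<le> card S choose 2"
    using card_complementary[OF S(2) sub] S by simp
  also have "card S choose 2 = 6" using S by (simp add: numeral_eq_Suc)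
  finally show ?thesis .
qed

text \<open>If all edges of \<open>X\<close> contain \<open>z\<close> and some edge \<open>f\<close> of \<open>Y\<close> does not, then \<open>f\<close> contains the
  other ends of all edges of \<open>X\<close>.\<close>
lemma cross_graphs_star:
  assumes fU: "finite U" and X: "X \<subseteq> nsets U 2" and Y: "Y \<subseteq> nsets U 2"
    and cr: "\<And>e f. e \<in> X \<Longrightarrow> f \<in> Y \<Longrightarrow> e \<inter> f \<noteq> {}"
    and z: "\<And>e. e \<in> X \<Longrightarrow> z \<in> e" and f: "f \<in> Y" "z \<notin> f" and cX: "2 \<le> card X"
  shows "card X = 2" "card {e \<in> Y. z \<notin> e} \<le> 1"
proof -
  have c2: "card g = 2 \<and> finite g" if "g \<in> X \<union> Y" for g using that X Y by (auto simp: nsets_def)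
  have main: "X \<subseteq> (\<lambda>u. {z, u}) ` g" if g: "g \<in> Y" "z \<notin> g" for g
  proof
    fix e assume e: "e \<in> X"
    obtain u where u: "u \<in> e" "u \<in> g" using cr[OF e g(1)] by auto
    have "z \<noteq> u" using u g by auto
    then have "{z, u} = e" by (intro card_subset_eq) (use u z[OF e] e c2[of e] in auto)
    then show "e \<in> (\<lambda>u. {z, u}) ` g" using u by auto
  qed
  have cf: "card f = 2" "finite f" using f c2 by auto
  have "card X \<le> card ((\<lambda>u. {z, u}) ` f)" using main[OF f] cf by (intro card_mono) auto
  also have "\<dots> \<le> 2" using card_image_le[OF cf(2)] cf by metis
  finally show cX2: "card X = 2" using cX by simp
  have uni: "g = \<Union>X - {z}" if g: "g \<in> Y" "z \<notin> g" for g
  proof -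
    have cg: "card g = 2" "finite g" using g c2 by auto
    have "card ((\<lambda>u. {z, u}) ` g) \<le> card X" using card_image_le[OF cg(2), of "\<lambda>u. {z, u}"] cg cX2 by simp
    then have "X = (\<lambda>u. {z, u}) ` g" using main[OF g] cg by (intro card_seteq) auto
    then show ?thesis using g by auto
  qed
  have "{e \<in> Y. z \<notin> e} \<subseteq> {\<Union>X - {z}}" using uni by blast
  then show "card {e \<in> Y. z \<notin> e} \<le> 1" using card_mono[of "{\<Union>X - {z}}"] by simp
qed

text \<open>Since \<open>card U \<ge> 5\<close>, the value 6 for two non-stars stays below
  \<open>card U + 2\<close>. Equality can therefore come only from a star, and then
  \<open>cross_graphs_star\<close> leaves it just two edges and allows the other graph one edge off
  the centre.\<close>

lemma cross_graphs_bound: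
  assumes fU: "finite U" "5 \<le> card U" and X: "X \<subseteq> nsets U 2" and Y: "Y \<subseteq> nsets U 2"
    and cr: "\<And>e f. e \<in> X \<Longrightarrow> f \<in> Y \<Longrightarrow> e \<inter> f \<noteq> {}"
    and cXY: "2 \<le> card X" "2 \<le> card Y" and ns: "\<not> (\<exists>z. \<forall>e\<in>X \<union> Y. z \<in> e)"
  shows "card X + card Y \<le> card U + 2"
    and "card X + card Y = card U + 2 \<Longrightarrow> card X = 2 \<or> card Y = 2"
proof -
  have star: "card X' = 2 \<and> card Y' \<le> card U"
    if X': "X' \<subseteq> nsets U 2" "Y' \<subseteq> nsets U 2" "\<And>e f. e \<in> X' \<Longrightarrow> f \<in> Y' \<Longrightarrow> e \<inter> f \<noteq> {}"
      "2 \<le> card X'" "\<not> (\<exists>z. \<forall>e\<in>X' \<union> Y'. z \<in> e)" and z: "\<And>e. e \<in> X' \<Longrightarrow> z \<in> e" for X' Y' z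
  proof -
    obtain f where f: "f \<in> Y'" "z \<notin> f" using X'(5) z by blast
    note s = cross_graphs_star[OF fU(1) X'(1-3) z f X'(4)]
    have fY: "finite Y'" using X' fU by (auto intro: finite_subset[OF _ finite_nsets])
    have "X' \<noteq> {}" using X'(4) by auto
    then have zU: "z \<in> U" using z X'(1) by (fastforce simp: nsets_def)
    have "card {e \<in> Y'. z \<in> e} \<le> card {e \<in> nsets U 2. {z} \<subseteq> e}"
      by (rule card_mono) (use fU X' in auto)
    also have "\<dots> = card U - 1" using card_supersets[of U "{z}" 2] fU zU by simp
    finally have "card {e \<in> Y'. z \<in> e} \<le> card U - 1" .
    moreover have "card Y' = card {e \<in> Y'. z \<in> e} + card {e \<in> Y'. z \<notin> e}"
    proof -
      have "card ({e \<in> Y'. z \<in> e} \<union> {e \<in> Y'. z \<notin> e}) = card {e \<in> Y'. z \<in> e} + card {e \<in> Y'. z \<notin> e}"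
        by (rule card_Un_disjoint) (use fY in auto)
      moreover have "{e \<in> Y'. z \<in> e} \<union> {e \<in> Y'. z \<notin> e} = Y'" by auto
      ultimately show ?thesis by simp
    qed
    ultimately show ?thesis using s fU(2) by simp
  qed
  have "(card X = 2 \<and> card Y \<le> card U) \<or> (card Y = 2 \<and> card X \<le> card U) \<or> card X + card Y \<le> 6"
  proof (cases "\<exists>z. \<forall>e\<in>X. z \<in> e")
    case True
    then show ?thesis using star[OF X Y cr cXY(1) ns] by blast
  next
    case nX: False
    show ?thesis
    proof (cases "\<exists>z. \<forall>e\<in>Y. z \<in> e")
      case True
      then show ?thesis using star[OF Y X _ cXY(2)] cr ns by (metis Int_commute Un_commute)
    next
      case False
      then show ?thesis using cross_graphs_nonstar[OF X Y cr] nX by blast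
    qed
  qed
  then show "card X + card Y \<le> card U + 2"
    and "card X + card Y = card U + 2 \<Longrightarrow> card X = 2 \<or> card Y = 2"
    using fU by auto
qed

section \<open>Intersecting triples without a cover by two points\<close>

lemma card_le_by_union:
  assumes "finite D" "\<And>d. d \<in> D \<Longrightarrow> card {G \<in> A. d \<in> G} \<le> p" "\<And>G. G \<in> A \<Longrightarrow> G \<inter> D \<noteq> {}"
  shows "card A \<le> card D * p"
proof -
  have "A = (\<Union>d\<in>D. {G \<in> A. d \<in> G})" using assms(3) by auto
  then have "card A \<le> (\<Sum>d\<in>D. card {G \<in> A. d \<in> G})"
    using card_UN_le[OF assms(1), of "\<lambda>d. {G \<in> A. d \<in> G}"] by simp
  also have "\<dots> \<le> card D * p" using sum_bounded_above[of D "\<lambda>d. card {G \<in> A. d \<in> G}" p] assms(2) by simp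
  finally show ?thesis .
qed

text \<open>The worst case is a single edge opposite three edges at each of its ends. Larger stars,
  and pairs of non-stars, give at most 6.\<close>

lemma cross_graphs_degree_bound:
  assumes fU: "finite U" and X: "X \<subseteq> nsets U 2" and Y: "Y \<subseteq> nsets U 2"
    and cr: "\<And>e f. e \<in> X \<Longrightarrow> f \<in> Y \<Longrightarrow> e \<inter> f \<noteq> {}"
    and dX: "\<And>z. card {e \<in> X. z \<in> e} \<le> 3" and dY: "\<And>z. card {e \<in> Y. z \<in> e} \<le> 3"
    and ne: "X \<noteq> {}" "Y \<noteq> {}"
  shows "card X + card Y \<le> 7"
proof -
  have star: "card X' + card Y' \<le> 7"
    if X': "X' \<subseteq> nsets U 2" "Y' \<subseteq> nsets U 2" "\<And>e f. e \<in> X' \<Longrightarrow> f \<in> Y' \<Longrightarrow> e \<inter> f \<noteq> {}"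
      "\<And>z. card {e \<in> X'. z \<in> e} \<le> 3" "\<And>z. card {e \<in> Y'. z \<in> e} \<le> 3" "X' \<noteq> {}"
      and z: "\<And>e. e \<in> X' \<Longrightarrow> z \<in> e" for X' Y' z
  proof -
    have fX: "finite X'" and fY: "finite Y'"
      using X' fU by (auto intro: finite_subset[OF _ finite_nsets])
    have "{e \<in> X'. z \<in> e} = X'" using z by auto
    then have c3: "card X' \<le> 3" using X'(4)[of z] by simp
    show ?thesis
    proof (cases "card X' = 1")
      case True
      obtain e where e: "e \<in> X'" using X' by auto
      have "card e = 2" "finite e" using e X' by (auto simp: nsets_def)
      then have "card Y' \<le> 2 * 3"
        using card_le_by_union[of e Y' 3] X'(5) X'(3)[OF e] by (metis Int_commute)
      then show ?thesis using True by simp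
    next
      case False
      then have c2: "2 \<le> card X'" using X'(6) fX card_0_eq[OF fX] by linarith
      show ?thesis
      proof (cases "\<exists>f\<in>Y'. z \<notin> f")
        case True
        then obtain f where f: "f \<in> Y'" "z \<notin> f" by auto
        note s = cross_graphs_star[OF fU X'(1-3) z f c2]
        have "card ({e \<in> Y'. z \<in> e} \<union> {e \<in> Y'. z \<notin> e}) = card {e \<in> Y'. z \<in> e} + card {e \<in> Y'. z \<notin> e}"
          by (rule card_Un_disjoint) (use fY in auto)
        moreover have "{e \<in> Y'. z \<in> e} \<union> {e \<in> Y'. z \<notin> e} = Y'" by auto
        ultimately show ?thesis using s X'(5)[of z] by simp
      next
        case False
        then have "{e \<in> Y'. z \<in> e} = Y'" by auto
        then show ?thesis using X'(5)[of z] c3 by simp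
      qed
    qed
  qed
  show ?thesis
  proof (cases "\<exists>z. \<forall>e\<in>X. z \<in> e")
    case True
    then show ?thesis using star[OF X Y cr dX dY ne(1)] by blast
  next
    case nX: False
    show ?thesis
    proof (cases "\<exists>z. \<forall>e\<in>Y. z \<in> e")
      case True
      then have "card Y + card X \<le> 7" using star[OF Y X _ dY dX ne(2)] cr by (metis Int_commute)
      then show ?thesis by simp
    next
      case False
      then have "card X + card Y \<le> 6" using cross_graphs_nonstar[OF X Y cr] nX by blast
      then show ?thesis by simp
    qed
  qed
qed

text \<open>A pair lies in at most three triples, because their third points belong to a triple
  avoiding the pair. For a pair of maximum codegree \<open>p\<close>, at most \<open>4 - p\<close>
  triples avoid it, at most 7 contain exactly one of its points, and \<open>p\<close> contain both.
  The total 11 is not sharpened further, being below \<open>2 * card V - 2\<close> as soon as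
  \<open>card V \<ge> 7\<close>.\<close>

lemma triples_no_two_cover:
  assumes fV: "finite V" and F: "F \<subseteq> nsets V 3" and meet: "\<And>G H. G \<in> F \<Longrightarrow> H \<in> F \<Longrightarrow> G \<inter> H \<noteq> {}"
    and nc: "\<And>x y. \<exists>G\<in>F. x \<notin> G \<and> y \<notin> G"
  shows "card F \<le> 11"
proof -
  define cd where "cd x y = {G \<in> F. x \<in> G \<and> y \<in> G}" for x y
  have fF: "finite F" using F fV by (auto intro: finite_subset[OF _ finite_nsets])
  have f3: "card G = 3 \<and> finite G \<and> G \<subseteq> V" if "G \<in> F" for G using that F by (auto simp: nsets_def)
  have third: "\<exists>c. G = {a, b, c} \<and> c \<noteq> a \<and> c \<noteq> b" if "G \<in> F" "a \<in> G" "b \<in> G" "a \<noteq> b" for G a b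
  proof -
    have "card (G - {a, b}) = 1" using that f3[OF that(1)] by (simp add: card_Diff_subset)
    then obtain c where "G - {a, b} = {c}" by (rule card_1_singletonE)
    then show ?thesis using that by (intro exI[of _ c]) auto
  qed
  have cdE: "\<exists>c. G = {x, y, c} \<and> c \<noteq> x \<and> c \<noteq> y" if "G \<in> cd x y" "x \<noteq> y" for G x y
    using third[of G x y] that by (simp add: cd_def)
  define W where "W x y = {G \<in> F. x \<notin> G \<and> y \<notin> G}" for x y
  have inW: "c \<in> w" if "w \<in> W x y" "{x, y, c} \<in> F" for w x y c
    using meet[of w "{x, y, c}"] that by (auto simp: W_def)
  have cd3: "card (cd x y) \<le> 3" if "x \<noteq> y" for x y
  proof -
    obtain w where w: "w \<in> W x y" using nc[of x y] unfolding W_def by auto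
    have "cd x y \<subseteq> (\<lambda>c. {x, y, c}) ` w"
    proof
      fix G assume G: "G \<in> cd x y"
      from cdE[OF G that] obtain c where c: "G = {x, y, c} \<and> c \<noteq> x \<and> c \<noteq> y" by (rule exE)
      then have "c \<in> w" using inW[OF w] G unfolding cd_def by auto
      then show "G \<in> (\<lambda>c. {x, y, c}) ` w" using c by auto
    qed
    moreover have fw: "finite w" "card w = 3" using w f3 by (auto simp: W_def)
    ultimately have "card (cd x y) \<le> card ((\<lambda>c. {x, y, c}) ` w)" by (intro card_mono) auto
    also have "\<dots> \<le> card w" by (rule card_image_le[OF fw(1)])
    finally show ?thesis using fw by simp
  qed
  have fcd: "finite (cd x y)" for x y using fF unfolding cd_def by simp
  show ?thesis
  proof (cases "F = {}")
    case True then show ?thesis by simp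
  next
    case False
    define S where "S = {card (cd x y) |x y. x \<noteq> y}"
    have "S \<subseteq> {..3}" using cd3 unfolding S_def by auto
    then have fS: "finite S" using finite_subset by blast
    have neS: "S \<noteq> {}"
    proof -
      obtain G where "G \<in> F" using False by auto
      then obtain x y where "x \<in> G" "y \<in> G" "x \<noteq> y"
        using f3 by (metis card_3_iff insertI1 insert_commute)
      then show ?thesis unfolding S_def by auto
    qed
    obtain x y where xy: "x \<noteq> y" "card (cd x y) = Max S"
      using Max_in[OF fS neS] unfolding S_def by auto
    define p where "p = card (cd x y)"
    have pmax: "card (cd u v) \<le> p" if "u \<noteq> v" for u v
      unfolding p_def xy(2) using fS that by (intro Max_ge) (auto simp: S_def)
    have p3: "p \<le> 3" using cd3[OF xy(1)] p_def by simp
    have p1: "1 \<le> p"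
    proof -
      obtain G where G: "G \<in> F" using False by auto
      then obtain u v where uv: "u \<in> G" "v \<in> G" "u \<noteq> v"
        using f3 by (metis card_3_iff insertI1 insert_commute)
      then have "card (cd u v) \<noteq> 0" using G fcd by (auto simp: cd_def)
      then show ?thesis using pmax[OF uv(3)] by simp
    qed
    define U where "U = V - {x} - {y}"
    define X where "X = link x (del y F)"
    define Y where "Y = link y (del x F)"
    define Z where "Z = link x (link y F)"
    have fU: "finite U" using fV U_def by simp
    have U': "V - {y} - {x} = U" unfolding U_def by auto
    have XU: "X \<subseteq> nsets U 2" and YU: "Y \<subseteq> nsets U 2"
      using link_nsets[OF del_nsets[OF F], of x y] link_nsets[OF del_nsets[OF F], of y x] U'
      unfolding X_def Y_def U_def[symmetric] by auto
    have cr1: "crossing 1 F F" using crossing_one_iff[OF F] meet by blast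
    have cr: "e \<inter> f \<noteq> {}" if "e \<in> X" "f \<in> Y" for e f
      using link_pair_meet[OF F cr1] that unfolding X_def Y_def by blast
    have cF: "card F = card (W x y) + card X + card Y + card (cd x y)"
    proof -
      have "del x (del y F) = W x y" unfolding W_def del_def by auto
      moreover have "card Z = card (cd x y)"
      proof -
        have re: "insert y (insert x (G - {x, y})) = G" if "x \<in> G" "y \<in> G" for G using that by auto
        have "bij_betw (\<lambda>e. insert y (insert x e)) Z (cd x y)"
          by (rule bij_betw_byWitness[where f' = "\<lambda>G. G - {x, y}"])
            (use xy re in \<open>auto simp: Z_def cd_def link_def\<close>)
        then show ?thesis by (rule bij_betw_same_card)
      qed
      ultimately show ?thesis using card_pair_split(3)[OF fF xy(1)] unfolding X_def Y_def Z_def by simp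
    qed
    have deg: "card {e \<in> link u (del v F). z \<in> e} \<le> 3" for u v z
    proof (cases "u = z")
      case True
      then have "{e \<in> link u (del v F). z \<in> e} = {}" by (auto simp: link_def)
      then show ?thesis by (simp only: card.empty le0)
    next
      case False
      have "card {e \<in> link u (del v F). z \<in> e} \<le> card (cd u z)"
        by (rule card_inj_on_le[where f = "insert u"])
          (use fcd in \<open>auto simp: inj_on_def link_def del_def cd_def insert_ident\<close>)
      then show ?thesis using cd3[OF False] by simp
    qed
    obtain G0 where G0: "G0 \<in> cd x y" using p1 p_def by fastforce
    from cdE[OF G0 xy(1)] obtain a where a: "G0 = {x, y, a} \<and> a \<noteq> x \<and> a \<noteq> y" by (rule exE)
    have aF: "{x, y, a} \<in> F" using G0 a by (auto simp: cd_def)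
    have neX: "X \<noteq> {}"
    proof -
      obtain G where G: "G \<in> F" "y \<notin> G" "a \<notin> G" using nc by blast
      then have "x \<in> G" using meet[OF G(1) aF] by auto
      then have "G - {x} \<in> X" using G unfolding X_def by (auto simp: link_def del_def insert_absorb)
      then show ?thesis by auto
    qed
    have neY: "Y \<noteq> {}"
    proof -
      obtain G where G: "G \<in> F" "x \<notin> G" "a \<notin> G" using nc by blast
      then have "y \<in> G" using meet[OF G(1) aF] by auto
      then have "G - {y} \<in> Y" using G unfolding Y_def by (auto simp: link_def del_def insert_absorb)
      then show ?thesis by auto
    qed
    have XY: "card X + card Y \<le> 7"
      by (rule cross_graphs_degree_bound[OF fU XU YU cr _ _ neX neY])
        (use deg in \<open>auto simp: X_def Y_def\<close>)
    \<comment> \<open>The third point of each triple through \<open>x\<close> and \<open>y\<close>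
      lies in every triple avoiding both. More such points leave less freedom for
      \<open>W x y\<close>.\<close>
    have "card (W x y) + p \<le> 4"
    proof -
      consider "p = 1" | "p \<ge> 2" using p1 by linarith
      then show ?thesis
      proof cases
        case 1
        \<comment> \<open>All triples in \<open>W x y\<close> pass through \<open>a\<close> and meet
          \<open>G\<close>. With maximum codegree 1, each of the three points of \<open>G\<close>
          accounts for at most one of them.\<close>
        obtain G where G: "G \<in> F" "a \<notin> G" using nc by blast
        have "card (W x y) \<le> card G * 1"
        proof (rule card_le_by_union)
          show "finite G" using f3 G by auto
          fix d assume "d \<in> G"
          then have "a \<noteq> d" using G by auto
          have "{w \<in> W x y. d \<in> w} \<subseteq> cd a d" using inW[OF _ aF] unfolding cd_def by (auto simp: W_def)
          then have "card {w \<in> W x y. d \<in> w} \<le> card (cd a d)" by (rule card_mono[OF fcd])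
          then show "card {w \<in> W x y. d \<in> w} \<le> 1" using pmax[OF \<open>a \<noteq> d\<close>] 1 by simp
        next
          fix w assume "w \<in> W x y"
          then show "w \<inter> G \<noteq> {}" using meet G by (auto simp: W_def)
        qed
        then show ?thesis using f3[OF G(1)] 1 by simp
      next
        case 2
        then have "cd x y \<noteq> {G0}" using p_def by auto
        then obtain G1 where G1: "G1 \<in> cd x y" "G1 \<noteq> G0" using G0 by auto
        from cdE[OF G1(1) xy(1)] obtain b where b: "G1 = {x, y, b} \<and> b \<noteq> x \<and> b \<noteq> y" by (rule exE)
        have bF: "{x, y, b} \<in> F" using G1 b by (auto simp: cd_def)
        have ab: "a \<noteq> b" using G1 a b by auto
        have "W x y \<subseteq> cd a b" using inW[OF _ aF] inW[OF _ bF] unfolding cd_def by (auto simp: W_def)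
        then have "card (W x y) \<le> card (cd a b)" by (rule card_mono[OF fcd])
        then have Wp: "card (W x y) \<le> p" using pmax[OF ab] by simp
        show ?thesis
        proof (cases "p = 2")
          case True then show ?thesis using Wp by simp
        next
          case False
          then have "p = 3" using p3 2 by simp
          then have "\<not> cd x y \<subseteq> {G0, G1}"
            using card_mono[of "{G0, G1}" "cd x y"] card_insert_le_m1[of 2 "{G1}" G0] p_def by auto
          then obtain G2 where G2: "G2 \<in> cd x y" "G2 \<noteq> G0" "G2 \<noteq> G1" by auto
          from cdE[OF G2(1) xy(1)] obtain c where c: "G2 = {x, y, c} \<and> c \<noteq> x \<and> c \<noteq> y" by (rule exE)
          have cF': "{x, y, c} \<in> F" using G2 c by (auto simp: cd_def)
          have abc: "c \<noteq> a" "c \<noteq> b" using G2 a b c by auto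
          have "w = {a, b, c}" if w: "w \<in> W x y" for w
          proof -
            have "card w = 3" "finite w" using w f3 by (auto simp: W_def)
            moreover have "{a, b, c} \<subseteq> w" using inW[OF w aF] inW[OF w bF] inW[OF w cF'] by auto
            moreover have "card {a, b, c} = 3" using ab abc by simp
            ultimately show ?thesis by (metis card_subset_eq)
          qed
          then have "W x y \<subseteq> {{a, b, c}}" by auto
          then have "card (W x y) \<le> 1" using card_mono[of "{{a, b, c}}"] by simp
          then show ?thesis using \<open>p = 3\<close> by simp
        qed
      qed
    qed
    then show ?thesis using XY cF p_def by simp
  qed
qed

text \<open>With a cover \<open>{x, y}\<close> the members containing exactly one of the two points
  give cross-intersecting graphs on \<open>card V - 2\<close> points, and the others are determined
  by their third point. The hypothesis on \<open>T\<close> keeps the edges of the two graphs from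
  having a common vertex \<open>z\<close>, since otherwise every member would contain two points of
  \<open>{x, y, z}\<close>.\<close>

theorem nontrivial_triples_bound:
  assumes fV: "finite V" and n: "7 \<le> card V" and F: "F \<subseteq> nsets V 3" and cr: "crossing 1 F F"
    and two: "\<And>x. x \<in> V \<Longrightarrow> 2 \<le> card (del x F)"
    and nT: "\<And>T. T \<subseteq> V \<Longrightarrow> card T = 3 \<Longrightarrow> \<exists>G\<in>F. card (G \<inter> T) < 2"
  shows "card F \<le> 2 * card V - 2"
    and "card F = 2 * card V - 2 \<Longrightarrow> \<exists>c\<in>V. card (del c F) = 2"
proof -
  have fF: "finite F" using F fV by (auto intro: finite_subset[OF _ finite_nsets])
  have meet: "G \<inter> H \<noteq> {}" if "G \<in> F" "H \<in> F" for G H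
    using that cr crossing_one_iff[OF F] by blast
  have "card F \<le> 2 * card V - 2 \<and> (card F = 2 * card V - 2 \<longrightarrow> (\<exists>c\<in>V. card (del c F) = 2))"
  proof (cases "\<exists>x\<in>V. \<exists>y\<in>V. x \<noteq> y \<and> (\<forall>G\<in>F. x \<in> G \<or> y \<in> G)")
    case True
    then obtain x y where xy: "x \<in> V" "y \<in> V" "x \<noteq> y" "\<And>G. G \<in> F \<Longrightarrow> x \<in> G \<or> y \<in> G" by blast
    define U where "U = V - {x} - {y}"
    define X where "X = link x (del y F)"
    define Y where "Y = link y (del x F)"
    define Z where "Z = link x (link y F)"
    have fU: "finite U" using fV U_def by simp
    have cU: "card U = card V - 2" using fV xy by (simp add: U_def)
    have U': "V - {y} - {x} = U" unfolding U_def by auto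
    have XU: "X \<subseteq> nsets U 2" and YU: "Y \<subseteq> nsets U 2"
      using link_nsets[OF del_nsets[OF F], of x y] link_nsets[OF del_nsets[OF F], of y x] U'
      unfolding X_def Y_def U_def[symmetric] by auto
    have ZU: "Z \<subseteq> nsets U 1"
      using link_nsets[OF link_nsets[OF F], of x y] U' unfolding Z_def by simp
    have cross: "e \<inter> f \<noteq> {}" if "e \<in> X" "f \<in> Y" for e f
      using link_pair_meet[OF F cr] that unfolding X_def Y_def by blast
    have W0: "del x (del y F) = {}" using xy(4) by (auto simp: del_def)
    have cy: "card (del y F) = card X" and cx: "card (del x F) = card Y"
      and cF: "card F = card X + card Y + card Z"
      using card_pair_split[OF fF xy(3)] W0 unfolding X_def Y_def Z_def by auto
    have cXY: "2 \<le> card X" "2 \<le> card Y"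
      using two[OF xy(1)] two[OF xy(2)] cx cy by auto
    have cZ: "card Z \<le> card U"
      using card_mono[OF _ ZU] card_nsets[OF fU, of 1] fU by simp
    have ns: "\<not> (\<exists>z. \<forall>e\<in>X \<union> Y. z \<in> e)"
    proof
      assume "\<exists>z. \<forall>e\<in>X \<union> Y. z \<in> e"
      then obtain z where z: "\<And>e. e \<in> X \<union> Y \<Longrightarrow> z \<in> e" by blast
      obtain e where e: "e \<in> X" using cXY by fastforce
      then have zU: "z \<in> U" using z[of e] XU by (auto simp: nsets_def)
      then have T: "{x, y, z} \<subseteq> V" "card {x, y, z} = 3" using xy by (auto simp: U_def)
      obtain G where G: "G \<in> F" "card (G \<inter> {x, y, z}) < 2" using nT[OF T] by blast
      have "\<exists>u v. u \<noteq> v \<and> {u, v} \<subseteq> G \<inter> {x, y, z}"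
      proof -
        have zn: "z \<noteq> x" "z \<noteq> y" using zU by (auto simp: U_def)
        consider "x \<in> G" "y \<in> G" | "x \<in> G" "y \<notin> G" | "x \<notin> G" "y \<in> G" using xy(4) G by blast
        then show ?thesis
        proof cases
          case 1 then show ?thesis using xy by (intro exI[of _ x] exI[of _ y]) auto
        next
          case 2
          then have "G - {x} \<in> X" using G xy unfolding X_def by (auto simp: link_def del_def insert_absorb)
          then have "z \<in> G" using z[of "G - {x}"] by auto
          then show ?thesis using 2 zn by (intro exI[of _ x] exI[of _ z]) auto
        next
          case 3
          then have "G - {y} \<in> Y" using G xy unfolding Y_def by (auto simp: link_def del_def insert_absorb)
          then have "z \<in> G" using z[of "G - {y}"] by auto
          then show ?thesis using 3 zn by (intro exI[of _ y] exI[of _ z]) auto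
        qed
      qed
      then obtain u v where "u \<noteq> v" "{u, v} \<subseteq> G \<inter> {x, y, z}" by blast
      then have "2 \<le> card (G \<inter> {x, y, z})"
        using card_mono[of "G \<inter> {x, y, z}" "{u, v}"] by simp
      then show False using G by simp
    qed
    have "5 \<le> card U" using cU n by simp
    note U5 = this
    have b1: "card X + card Y \<le> card U + 2"
      by (rule cross_graphs_bound(1)[OF fU U5 XU YU _ cXY ns]) (rule cross)
    have b2: "card X = 2 \<or> card Y = 2" if "card X + card Y = card U + 2"
      by (rule cross_graphs_bound(2)[OF fU U5 XU YU _ cXY ns that]) (rule cross)
    show ?thesis
    proof (intro conjI impI)
      show "card F \<le> 2 * card V - 2" using b1 cF cZ cU n by simp
      assume "card F = 2 * card V - 2"
      then have "card X + card Y = card U + 2" using b1 cF cZ cU n by simp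
      from b2[OF this] have "card X = 2 \<or> card Y = 2" .
      then show "\<exists>c\<in>V. card (del c F) = 2" using cx cy xy by auto
    qed
  next
    case False
    have "\<exists>G\<in>F. x \<notin> G \<and> y \<notin> G" for x y
    proof -
      have GV: "G \<subseteq> V" if "G \<in> F" for G using that F by (auto simp: nsets_def)
      have ex1: "\<exists>G\<in>F. u \<notin> G" for u
      proof (cases "u \<in> V")
        case True
        then have "del u F \<noteq> {}" using two[OF True] by auto
        then show ?thesis by (auto simp: del_def)
      next
        case False
        have "V \<noteq> {}" using n by auto
        then obtain v where "v \<in> V" by auto
        then have "del v F \<noteq> {}" using two[of v] by auto
        then show ?thesis using GV False by (auto simp: del_def)
      qed
      show ?thesis
      proof (cases "x \<in> V \<and> y \<in> V \<and> x \<noteq> y")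
        case True then show ?thesis using False by blast
      next
        case F: False
        then consider "x = y" | "x \<notin> V" | "y \<notin> V" by blast
        then show ?thesis using ex1 GV by cases (metis subsetD)+
      qed
    qed
    then have "card F \<le> 11" using triples_no_two_cover[OF fV F meet] by blast
    then have "card F < 2 * card V - 2" using n by linarith
    then show ?thesis by simp
  qed
  then show "card F \<le> 2 * card V - 2"
    and "card F = 2 * card V - 2 \<Longrightarrow> \<exists>c\<in>V. card (del c F) = 2" by auto
qed

subsection \<open>Permutations of the ground set\<close>

lemma permutes_colour:
  fixes f g :: "nat \<Rightarrow> nat"
  assumes "\<And>c. card {x \<in> {1..n}. f x = c} = card {x \<in> {1..n}. g x = c}"
  shows "\<exists>\<sigma>. \<sigma> permutes {1..n} \<and> (\<forall>x\<in>{1..n}. f x = g (\<sigma> x))"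
proof -
  have "image_mset f (mset_set {1..n}) = image_mset g (mset_set {1..n})"
  proof (rule multiset_eqI)
    fix c
    have "count (image_mset h (mset_set {1..n})) c = card {x \<in> {1..n}. h x = c}" for h :: "nat \<Rightarrow> nat" and c
    proof -
      have "count (image_mset h (mset_set {1..n})) c
        = (\<Sum>x | x \<in># mset_set {1..n} \<and> c = h x. count (mset_set {1..n}) x)"
        by (rule count_image_mset')
      also have "\<dots> = (\<Sum>x\<in>{x \<in> {1..n}. h x = c}. 1)" by (rule sum.cong) auto
      finally show ?thesis by simp
    qed
    then show "count (image_mset f (mset_set {1..n})) c = count (image_mset g (mset_set {1..n})) c"
      using assms by simp
  qed
  then show ?thesis by (rule image_mset_eq_implies_permutes[rotated, of f "{1..n}" g]) auto
qed

text \<open>Three prescribed images cover every normalisation needed later: distinguished points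
  enter as singletons, and surplus slots are filled with the empty set.\<close>

lemma permutes_three_sets:
  fixes n :: nat
  assumes A: "A1 \<subseteq> {1..n}" "A2 \<subseteq> {1..n}" "A3 \<subseteq> {1..n}" "A1 \<inter> A2 = {}" "A1 \<inter> A3 = {}" "A2 \<inter> A3 = {}"
    and B: "B1 \<subseteq> {1..n}" "B2 \<subseteq> {1..n}" "B3 \<subseteq> {1..n}" "B1 \<inter> B2 = {}" "B1 \<inter> B3 = {}" "B2 \<inter> B3 = {}"
    and c: "card A1 = card B1" "card A2 = card B2" "card A3 = card B3"
  shows "\<exists>\<sigma>. \<sigma> permutes {1..n} \<and> \<sigma> ` A1 = B1 \<and> \<sigma> ` A2 = B2 \<and> \<sigma> ` A3 = B3"
proof -
  define col where "col X Y Z x = (if x \<in> X then 1 else if x \<in> Y then 2 else if x \<in> Z then 3 else 0 :: nat)"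
    for X Y Z :: "nat set" and x
  have parts: "{x \<in> {1..n}. col X Y Z x = 1} = X" "{x \<in> {1..n}. col X Y Z x = 2} = Y"
    "{x \<in> {1..n}. col X Y Z x = 3} = Z" "{x \<in> {1..n}. col X Y Z x = 0} = {1..n} - (X \<union> Y \<union> Z)"
    if "X \<subseteq> {1..n}" "Y \<subseteq> {1..n}" "Z \<subseteq> {1..n}" "X \<inter> Y = {}" "X \<inter> Z = {}" "Y \<inter> Z = {}" for X Y Z :: "nat set"
    using that by (auto simp: col_def)
  have rest: "card ({1..n} - (X \<union> Y \<union> Z)) = n - (card X + card Y + card Z)"
    if "X \<subseteq> {1..n}" "Y \<subseteq> {1..n}" "Z \<subseteq> {1..n}" "X \<inter> Y = {}" "X \<inter> Z = {}" "Y \<inter> Z = {}" for X Y Z :: "nat set"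
  proof -
    have f: "finite X" "finite Y" "finite Z" using that finite_subset by blast+
    then have "card (X \<union> Y \<union> Z) = card X + card Y + card Z"
      using that by (simp add: card_Un_disjoint Int_Un_distrib2)
    then show ?thesis using f that by (subst card_Diff_subset) auto
  qed
  have "card {x \<in> {1..n}. col A1 A2 A3 x = k} = card {x \<in> {1..n}. col B1 B2 B3 x = k}" for k
  proof -
    consider "k = 0" | "k = 1" | "k = 2" | "k = 3" | "k > 3" by linarith
    then show ?thesis
    proof cases
      case 5
      then have "{x \<in> {1..n}. col X Y Z x = k} = {}" for X Y Z by (auto simp: col_def)
      then show ?thesis by (simp only:)
    qed (use parts[OF A] parts[OF B] rest[OF A] rest[OF B] c in simp_all)
  qed
  then obtain \<sigma> where \<sigma>: "\<sigma> permutes {1..n}" "\<And>x. x \<in> {1..n} \<Longrightarrow> col A1 A2 A3 x = col B1 B2 B3 (\<sigma> x)"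
    using permutes_colour[of n "col A1 A2 A3" "col B1 B2 B3"] by blast
  have img: "\<sigma> ` {x \<in> {1..n}. col A1 A2 A3 x = k} = {x \<in> {1..n}. col B1 B2 B3 x = k}" for k
  proof
    show "\<sigma> ` {x \<in> {1..n}. col A1 A2 A3 x = k} \<subseteq> {x \<in> {1..n}. col B1 B2 B3 x = k}"
    proof
      fix y assume "y \<in> \<sigma> ` {x \<in> {1..n}. col A1 A2 A3 x = k}"
      then obtain x where x: "x \<in> {1..n}" "col A1 A2 A3 x = k" "y = \<sigma> x" by blast
      have "\<sigma> x \<in> {1..n}" using permutes_in_image[OF \<sigma>(1)] x(1) by blast
      then show "y \<in> {x \<in> {1..n}. col B1 B2 B3 x = k}" using \<sigma>(2)[OF x(1)] x by simp
    qed
    show "{x \<in> {1..n}. col B1 B2 B3 x = k} \<subseteq> \<sigma> ` {x \<in> {1..n}. col A1 A2 A3 x = k}"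
    proof
      fix y assume y: "y \<in> {x \<in> {1..n}. col B1 B2 B3 x = k}"
      then obtain x where "x \<in> {1..n}" "y = \<sigma> x" using permutes_image[OF \<sigma>(1)] by (metis (no_types, lifting) imageE mem_Collect_eq)
      then show "y \<in> \<sigma> ` {x \<in> {1..n}. col A1 A2 A3 x = k}" using y \<sigma>(2) by auto
    qed
  qed
  show ?thesis
    using \<sigma>(1) img[of 1] img[of 2] img[of 3] parts[OF A] parts[OF B] by auto
qed

lemma permutes_image_subset: "\<sigma> permutes V \<Longrightarrow> \<sigma> ` X \<subseteq> V \<longleftrightarrow> X \<subseteq> V"
  using permutes_in_image by fastforce

lemma permutes_card_image: "\<sigma> permutes V \<Longrightarrow> card (\<sigma> ` X) = card X"
  by (meson card_image inj_on_subset permutes_inj subset_UNIV)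

lemma permutes_image_nsets: "\<sigma> permutes V \<Longrightarrow> \<sigma> ` X \<in> nsets V k \<longleftrightarrow> X \<in> nsets V k"
  unfolding nsets_def mem_Collect_eq
  by (metis finite_image_iff inj_on_subset permutes_card_image permutes_image_subset permutes_inj subset_UNIV)

lemma permutes_image_subsets_le: "\<sigma> permutes {1..n} \<Longrightarrow> \<sigma> ` X \<in> subsets_le n k \<longleftrightarrow> X \<in> subsets_le n k"
  unfolding subsets_le_def mem_Collect_eq by (simp only: permutes_image_subset permutes_card_image)

lemma permutes_image_Int: "\<sigma> permutes V \<Longrightarrow> \<sigma> ` X \<inter> \<sigma> ` Y = \<sigma> ` (X \<inter> Y)"
  by (metis image_Int permutes_inj)

lemma permutes_image_mono: "\<sigma> permutes V \<Longrightarrow> \<sigma> ` X \<subseteq> \<sigma> ` Y \<longleftrightarrow> X \<subseteq> Y"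
  by (metis inj_image_subset_iff permutes_inj)

lemma permutes_image_eq_iff: "\<sigma> permutes V \<Longrightarrow> \<sigma> ` X = \<sigma> ` Y \<longleftrightarrow> X = Y"
  by (metis inj_image_eq_iff permutes_inj)

lemma permutes_mem_image: "\<sigma> permutes V \<Longrightarrow> \<sigma> x \<in> \<sigma> ` Y \<longleftrightarrow> x \<in> Y"
  by (metis inj_image_mem_iff permutes_inj)

lemmas permutes_simps = permutes_card_image permutes_image_nsets permutes_image_subsets_le
  permutes_image_Int permutes_image_mono permutes_image_eq_iff permutes_mem_image

lemma isomorphic_famI:
  assumes \<sigma>: "\<sigma> permutes {1..n}" and "G \<subseteq> Pow {1..n}" "H \<subseteq> Pow {1..n}"
    and mem: "\<And>X. X \<subseteq> {1..n} \<Longrightarrow> X \<in> G \<longleftrightarrow> \<sigma> ` X \<in> H"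
  shows "isomorphic_fam n G H"
proof -
  have "{\<sigma> ` X |X. X \<in> G} = H"
  proof
    show "{\<sigma> ` X |X. X \<in> G} \<subseteq> H" using assms by auto
    show "H \<subseteq> {\<sigma> ` X |X. X \<in> G}"
    proof
      fix Y assume Y: "Y \<in> H"
      have e: "\<sigma> ` (inv \<sigma> ` Y) = Y" using permutes_surj[OF \<sigma>] by (simp add: image_f_inv_f)
      moreover have "inv \<sigma> ` Y \<subseteq> {1..n}" using e Y assms(3) permutes_image_subset[OF \<sigma>] by (metis PowD subsetD)
      ultimately have "inv \<sigma> ` Y \<in> G" using mem Y by simp
      then show "Y \<in> {\<sigma> ` X |X. X \<in> G}" using e by (metis (mono_tags, lifting) mem_Collect_eq)
    qed
  qed
  then show ?thesis using \<sigma> unfolding isomorphic_fam_def by blast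
qed

lemma isomorphic_fam_card:
  assumes "isomorphic_fam n G H"
  shows "card G = card H"
proof -
  obtain \<sigma> where \<sigma>: "\<sigma> permutes {1..n}" "{\<sigma> ` X |X. X \<in> G} = H"
    using assms unfolding isomorphic_fam_def by blast
  have "H = (`) \<sigma> ` G" using \<sigma>(2) by auto
  moreover have "inj_on ((`) \<sigma>) G" by (meson inj_onI permutes_image_eq_iff[OF \<sigma>(1)])
  ultimately show ?thesis by (simp add: card_image)
qed

lemma subfamilyI:
  assumes "\<sigma> permutes {1..n}" "F \<subseteq> Pow {1..n}" "F \<subseteq> G"
    and "\<And>X. X \<subseteq> {1..n} \<Longrightarrow> X \<in> G \<Longrightarrow> \<sigma> ` X \<in> H"
  shows "subfamily n F H"
  unfolding subfamily_def using assms by blast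

subsection \<open>Layers of union-bounded families\<close>

definition lay :: "'a set set \<Rightarrow> nat \<Rightarrow> 'a set set" where
  "lay F i = {X \<in> F. card X = i}"

lemma lay_nsets: "finite V \<Longrightarrow> F \<subseteq> Pow V \<Longrightarrow> lay F i \<subseteq> nsets V i"
  by (auto simp: lay_def nsets_def intro: finite_subset)

lemma card_eq_sum_lay:
  assumes "finite F" "\<And>X. X \<in> F \<Longrightarrow> card X \<le> s"
  shows "card F = (\<Sum>i\<le>s. card (lay F i))"
proof -
  have "F = (\<Union>i\<in>{..s}. lay F i)" using assms(2) by (auto simp: lay_def)
  then have "card F = card (\<Union>i\<in>{..s}. lay F i)" by simp
  also have "\<dots> = (\<Sum>i\<in>{..s}. card (lay F i))"
    by (rule card_UN_disjoint) (use assms(1) in \<open>auto simp: lay_def\<close>)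
  finally show ?thesis .
qed

text \<open>The range exceeds \<open>s = 2 * d\<close> by one so that layer 0 has a partner too,
  namely the empty layer \<open>2 * d + 1\<close>.\<close>

lemma sum_fold_even:
  fixes f :: "nat \<Rightarrow> nat"
  shows "(\<Sum>i\<le>2 * d + 1. f i) = (\<Sum>i\<le>d. f i + f (2 * d + 1 - i))"
proof -
  have "(\<Sum>i\<le>2 * d + 1. f i) = (\<Sum>i\<le>d. f i) + (\<Sum>i\<in>{d + 1..2 * d + 1}. f i)"
  proof -
    have "{..2 * d + 1} = {..d} \<union> {d + 1..2 * d + 1}" by auto
    then show ?thesis by (simp only:) (rule sum.union_disjoint, auto)
  qed
  also have "(\<Sum>i\<in>{d + 1..2 * d + 1}. f i) = (\<Sum>i\<le>d. f (2 * d + 1 - i))"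
    by (rule sum.reindex_bij_witness[where i = "\<lambda>i. 2 * d + 1 - i" and j = "\<lambda>i. 2 * d + 1 - i"]) auto
  finally show ?thesis by (simp add: sum.distrib)
qed

text \<open>For \<open>s = 2 * d + 1\<close> layer \<open>d + 1\<close> would be its own partner and
  therefore stands alone.\<close>

lemma sum_fold_odd:
  fixes f :: "nat \<Rightarrow> nat"
  shows "(\<Sum>i\<le>2 * d + 2. f i) = (\<Sum>i\<le>d. f i + f (2 * d + 2 - i)) + f (d + 1)"
proof -
  have "(\<Sum>i\<le>2 * d + 2. f i) = (\<Sum>i\<le>d. f i) + (\<Sum>i\<in>{d + 1..2 * d + 2}. f i)"
  proof -
    have "{..2 * d + 2} = {..d} \<union> {d + 1..2 * d + 2}" by auto
    then show ?thesis by (simp only:) (rule sum.union_disjoint, auto)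
  qed
  also have "(\<Sum>i\<in>{d + 1..2 * d + 2}. f i) = f (d + 1) + (\<Sum>i\<in>{d + 2..2 * d + 2}. f i)"
    by (simp add: sum.atLeast_Suc_atMost)
  also have "(\<Sum>i\<in>{d + 2..2 * d + 2}. f i) = (\<Sum>i\<le>d. f (2 * d + 2 - i))"
    by (rule sum.reindex_bij_witness[where i = "\<lambda>i. 2 * d + 2 - i" and j = "\<lambda>i. 2 * d + 2 - i"]) auto
  finally show ?thesis by (simp add: sum.distrib)
qed

lemma s_union_cross_pair:
  assumes fV: "finite V" and F: "F \<subseteq> Pow V" and su: "s_union s F" and ab: "a + b = s + 1" "b \<le> a"
    and n: "s + 1 \<le> card V"
  shows "cross_pair V a b (a + 1 - b) (lay F a) (lay F b)"
proof -
  have int: "i + j \<le> card (X \<inter> Y) + s" if "X \<in> lay F i" "Y \<in> lay F j" for X Y i j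
  proof -
    have "X \<in> F" "Y \<in> F" "card X = i" "card Y = j" using that by (auto simp: lay_def)
    moreover have "finite X" "finite Y" using calculation F fV by (auto intro: finite_subset)
    moreover have "card (X \<union> Y) \<le> s" using su calculation by (auto simp: s_union_def)
    ultimately show ?thesis using card_Un_Int[of X Y] by simp
  qed
  have "1 \<le> card (X \<inter> Y)" if "X \<in> lay F a" "Y \<in> lay F b" for X Y
    using int[OF that] ab by simp
  moreover have "a + 1 - b \<le> card (X \<inter> Y)" if "X \<in> lay F a" "Y \<in> lay F a" for X Y
    using int[OF that] ab by simp
  ultimately show ?thesis
    using fV lay_nsets[OF fV F] ab n unfolding cross_pair_def crossing_def by auto
qed

text \<open>Putting sets into the upper layer never pays: by \<open>cross_pair_bound\<close> it
  costs \<open>(card V - a) choose b\<close> and gains 1, and for \<open>b > 0\<close> this binomial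
  is at least 2 because \<open>s + 2 \<le> card V\<close>. For \<open>b = 0\<close> the upper layer
  would consist of sets of size \<open>s + 1\<close>.\<close>

lemma s_union_layers:
  fixes V :: "nat set"
  assumes fV: "finite V" and F: "F \<subseteq> Pow V" and su: "s_union s F" and ab: "a + b = s + 1" "b \<le> a"
    and n: "s + 2 \<le> card V"
  shows "card (lay F b) + card (lay F a) \<le> card V choose b"
    and "card (lay F b) + card (lay F a) = card V choose b \<Longrightarrow> lay F a = {} \<and> lay F b = nsets V b"
proof -
  have cp: "cross_pair V a b (a + 1 - b) (lay F a) (lay F b)"
    by (rule s_union_cross_pair[OF fV F su ab]) (use n in simp)
  note D = cross_pairD[OF cp]
  have le: "card (lay F b) \<le> card V choose b"
    using card_mono[OF _ D(3)] card_nsets[OF fV] fV by simp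
  have lt: "card (lay F b) + card (lay F a) < card V choose b" if ne: "lay F a \<noteq> {}"
  proof (cases "b = 0")
    case True
    obtain X where X: "X \<in> F" "card X = a" using ne by (auto simp: lay_def)
    have "card (X \<union> X) \<le> s" using su X(1) unfolding s_union_def by blast
    then show ?thesis using X True ab by simp
  next
    case False
    have "card (lay F a) + card (lay F b) + ((card V - a) choose b) \<le> (card V choose b) + 1"
      by (rule cross_pair_bound[OF cp ne]) (use False in simp)
    moreover have "2 \<le> (card V - a) choose b" by (rule binomial_ge_two) (use False ab n in auto)
    ultimately show ?thesis by simp
  qed
  show "card (lay F b) + card (lay F a) \<le> card V choose b"
    using le lt by (cases "lay F a = {}") auto
  assume eq: "card (lay F b) + card (lay F a) = card V choose b"
  then have e: "lay F a = {}" using lt by fastforce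
  moreover have "lay F b = nsets V b"
    by (rule card_subset_eq) (use fV D(3) eq e card_nsets[OF fV] in auto)
  ultimately show "lay F a = {} \<and> lay F b = nsets V b" by blast
qed

section \<open>Down-closures and the size of the exceptional star pairs\<close>

definition down_closure :: "'a set set \<Rightarrow> 'a set set" where
  "down_closure F = {X. \<exists>Y\<in>F. X \<subseteq> Y}"

lemma subset_down_closure: "F \<subseteq> down_closure F"
  by (auto simp: down_closure_def)

lemma down_closure_subset: "F \<subseteq> Pow V \<Longrightarrow> down_closure F \<subseteq> Pow V"
  by (auto simp: down_closure_def)

lemma down_closure_down: "X \<in> down_closure F \<Longrightarrow> Y \<subseteq> X \<Longrightarrow> Y \<in> down_closure F"
  by (auto simp: down_closure_def)

lemma s_union_down_closure:
  assumes "finite V" "F \<subseteq> Pow V" "s_union s F"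
  shows "s_union s (down_closure F)"
  unfolding s_union_def
proof (intro ballI)
  fix X Y assume "X \<in> down_closure F" "Y \<in> down_closure F"
  then obtain X' Y' where *: "X' \<in> F" "Y' \<in> F" "X \<subseteq> X'" "Y \<subseteq> Y'" by (auto simp: down_closure_def)
  then have "finite (X' \<union> Y')" using assms(1,2) finite_subset by (metis PowD Un_least subsetD)
  then have "card (X \<union> Y) \<le> card (X' \<union> Y')" using * by (intro card_mono) auto
  also have "\<dots> \<le> s" using assms(3) * by (auto simp: s_union_def)
  finally show "card (X \<union> Y) \<le> s" .
qed

lemma card_subsets_le: "card (subsets_le n m) = (\<Sum>i\<le>m. n choose i)"
proof -
  have "finite (subsets_le n m)"
    by (rule finite_subset[of _ "Pow {1..n}"]) (auto simp: subsets_le_def)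
  then have "card (subsets_le n m) = (\<Sum>i\<le>m. card (lay (subsets_le n m) i))"
    by (rule card_eq_sum_lay) (auto simp: subsets_le_def)
  also have "\<dots> = (\<Sum>i\<le>m. n choose i)"
  proof (rule sum.cong)
    fix i assume "i \<in> {..m}"
    then have "lay (subsets_le n m) i = nsets {1..n} i"
      by (auto simp: lay_def subsets_le_def nsets_def intro: finite_subset)
    then show "card (lay (subsets_le n m) i) = n choose i" using card_nsets[of "{1..n}" i] by simp
  qed simp
  finally show ?thesis .
qed

text \<open>Passing from a kernel of size 3 to one of size 2 gains exactly as many four-sets as it
  loses three-sets. This coincidence is why two additional extremal families appear for each of s =
  6 and s = 7.\<close>

lemma supersets_star_count:
  assumes "finite V" "5 \<le> card V" "E \<subseteq> V" "card E = 2 \<or> card E = 3"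
  shows "card {F \<in> nsets V 4. E \<subseteq> F} + card {G \<in> nsets V 3. G \<inter> E \<noteq> {}} +
    ((card V - 4) choose 3) + ((card V - 5) choose 2) = (card V choose 3) + 2"
proof -
  define r where "r = card V - 5"
  have r: "card V - 5 = r" "card V - 4 = Suc r" "card V - 3 = Suc (Suc r)" "card V - 2 = Suc (Suc (Suc r))"
    using assms(2) r_def by auto
  have a: "card {F \<in> nsets V 4. E \<subseteq> F} = (card V - card E) choose (4 - card E)"
    by (rule card_supersets) (use assms in auto)
  have b: "card {G \<in> nsets V 3. G \<inter> E \<noteq> {}} + ((card V - card E) choose 3) = card V choose 3"
    by (rule card_meeting) (use assms in auto)
  from assms(4) show ?thesis
  proof
    assume "card E = 2"
    then show ?thesis using a b r by (simp add: choose_two_Suc choose_three_Suc)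
  next
    assume "card E = 3"
    then show ?thesis using a b r by (simp add: choose_two_Suc choose_three_Suc)
  qed
qed

subsection \<open>The even case\<close>

text \<open>Three members of \<open>A\<close> without a common pair span a four-set \<open>S\<close>. Every member of \<open>A\<close>
  lies in \<open>S\<close>, and a member of \<open>B\<close> outside \<open>S\<close> meets \<open>S\<close> in the only point common to
  the three.\<close>
lemma triples_pairs_bound:
  assumes cp: "cross_pair V 3 2 2 A B" and n: "6 \<le> card V" and cA: "3 \<le> card A"
    and ns: "\<And>E. E \<subseteq> V \<Longrightarrow> card E = 2 \<Longrightarrow> \<exists>F\<in>A. \<not> E \<subseteq> F"
  shows "card A + card B < 2 * card V"
proof -
  note D = cross_pairD[OF cp]
  have f: "finite F \<and> card F = 3 \<and> F \<subseteq> V" if "F \<in> A" for F using that D(2) by (auto simp: nsets_def)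
  have int: "2 \<le> card (F \<inter> G)" if "F \<in> A" "G \<in> A" for F G using D(7) that by (simp add: crossing_def)
  have meet: "F \<inter> G \<noteq> {}" if "F \<in> A" "G \<in> B" for F G using D(6) that crossing_one_iff[OF D(2)] by blast
  obtain P where P: "P \<in> A" using cA by fastforce
  have "A \<noteq> {P}" using cA by auto
  then obtain Q where Q: "Q \<in> A" "Q \<noteq> P" using P by blast
  have "\<not> P \<subseteq> Q" using f[OF P] f[OF Q(1)] Q(2) card_subset_eq by metis
  then have "P \<inter> Q \<subset> P" by auto
  then have "card (P \<inter> Q) < 3" using f[OF P] psubset_card_mono by metis
  then have cPQ: "card (P \<inter> Q) = 2" using int[OF P Q(1)] by simp
  have "P \<inter> Q \<subseteq> V" using f[OF P] by auto
  then obtain R where R: "R \<in> A" "\<not> P \<inter> Q \<subseteq> R" using ns cPQ by blast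
  define S where "S = P \<union> Q"
  have S: "card S = 4" "finite S" "S \<subseteq> V"
    using card_Un_Int[of P Q] cPQ f[OF P] f[OF Q(1)] unfolding S_def by auto
  have PQR: "card (P \<inter> Q \<inter> R) \<le> 1"
  proof -
    have "P \<inter> Q \<inter> R \<subset> P \<inter> Q" using R by auto
    then have "card (P \<inter> Q \<inter> R) < card (P \<inter> Q)" using f[OF P] by (intro psubset_card_mono) auto
    then show ?thesis using cPQ by simp
  qed
  \<comment> \<open>A triple \<open>T\<close> leaving \<open>S\<close> must contain
    \<open>P \<inter> Q\<close> to meet both \<open>P\<close> and \<open>Q\<close> in two points.
    Then \<open>R\<close>, having at most one point of \<open>P \<inter> Q\<close>, needs a further
    point in each of \<open>P\<close>, \<open>Q\<close> and \<open>T\<close>; these three points are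
    distinct and exhaust \<open>R\<close>, so \<open>R\<close> meets \<open>P\<close> only
    once.\<close>
  have AS: "T \<subseteq> S" if T: "T \<in> A" for T
  proof (rule ccontr)
    assume nT: "\<not> T \<subseteq> S"
    have fT: "finite T" using f[OF T] by simp
    have "T \<inter> S \<subset> T" using nT by auto
    then have "card (T \<inter> S) < card T" by (rule psubset_card_mono[OF fT])
    then have c2: "card (T \<inter> S) \<le> 2" using f[OF T] by simp
    have "T \<inter> P = T \<inter> S" "T \<inter> Q = T \<inter> S"
      by (rule card_seteq; use c2 int[OF T P] int[OF T Q(1)] fT in \<open>auto simp: S_def\<close>)+
    then have sub: "T \<inter> S \<subseteq> P \<inter> Q" by auto
    have "P \<inter> Q = T \<inter> S"
      by (rule card_seteq[symmetric]) (use sub f[OF P] cPQ int[OF T P] \<open>T \<inter> P = T \<inter> S\<close> in auto)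
    obtain t where t: "t \<in> T" "t \<notin> S" using nT by auto
    have "insert t (P \<inter> Q) = T"
      by (rule card_subset_eq) (use f[OF T] f[OF P] cPQ t \<open>P \<inter> Q = T \<inter> S\<close> in \<open>auto simp: S_def\<close>)
    have pt: "\<exists>x. x \<in> R \<and> x \<in> M \<and> x \<notin> P \<inter> Q" if M: "M \<in> A" "P \<inter> Q \<subseteq> M" for M
    proof (rule ccontr)
      assume "\<not> ?thesis"
      then have "R \<inter> M \<subseteq> P \<inter> Q \<inter> R" by auto
      then have "card (R \<inter> M) \<le> card (P \<inter> Q \<inter> R)" using f[OF P] by (intro card_mono) auto
      then show False using PQR int[OF R(1) M(1)] by simp
    qed
    obtain x y z where xyz: "x \<in> R" "x \<in> P" "x \<notin> P \<inter> Q" "y \<in> R" "y \<in> Q" "y \<notin> P \<inter> Q"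
      "z \<in> R" "z \<in> T" "z \<notin> P \<inter> Q"
      using pt[OF P] pt[OF Q(1)] pt[OF T] \<open>P \<inter> Q = T \<inter> S\<close> by blast
    then have zt: "z = t" using \<open>insert t (P \<inter> Q) = T\<close> by auto
    have d: "x \<noteq> y" "x \<noteq> z" "y \<noteq> z" using xyz zt t unfolding S_def by auto
    have "{x, y, z} = R" by (rule card_subset_eq) (use f[OF R(1)] xyz d in auto)
    then have "R \<inter> P \<subseteq> {x}" using xyz zt t unfolding S_def by auto
    then have "card (R \<inter> P) \<le> 1" using card_mono[of "{x}"] by fastforce
    then show False using int[OF R(1) P] by simp
  qed
  have cA4: "card A \<le> 4"
  proof -
    have "A \<subseteq> nsets S 3" using AS f by (auto simp: nsets_def)
    then have "card A \<le> card (nsets S 3)" using S by (intro card_mono) auto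
    then show ?thesis using card_nsets[OF S(2), of 3] S by (simp add: numeral_eq_Suc)
  qed
  have S6: "card (nsets S 2) = 6" using card_nsets[OF S(2), of 2] S by (simp add: numeral_eq_Suc)
  have out: "\<exists>w. G \<inter> S = {w} \<and> (\<forall>F\<in>A. w \<in> F)" if G: "G \<in> B" "\<not> G \<subseteq> S" for G
  proof -
    have g: "finite G" "card G = 2" using G D(3) by (auto simp: nsets_def)
    have "G \<inter> S \<subset> G" using G by auto
    then have "card (G \<inter> S) < 2" using psubset_card_mono[OF g(1)] g by auto
    moreover have "G \<inter> S \<noteq> {}" using meet[OF P G(1)] unfolding S_def by auto
    ultimately have "card (G \<inter> S) = 1" using g by (simp add: card_gt_0_iff Suc_leI le_antisym less_2_cases_iff)
    then obtain w where w: "G \<inter> S = {w}" by (rule card_1_singletonE)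
    have "w \<in> F" if F: "F \<in> A" for F
    proof -
      have "F \<inter> G \<subseteq> {w}" using AS[OF F] w by auto
      then show ?thesis using meet[OF F G(1)] by auto
    qed
    then show ?thesis using w by auto
  qed
  show ?thesis
  proof (cases "\<exists>w. \<forall>F\<in>A. w \<in> F")
    case False
    have "B \<subseteq> nsets S 2"
    proof
      fix G assume G: "G \<in> B"
      have "G \<subseteq> S" using out[OF G] False by blast
      then show "G \<in> nsets S 2" using G D(3) by (auto simp: nsets_def)
    qed
    then have "card B \<le> 6" using card_mono[of "nsets S 2" B] S S6 by simp
    then show ?thesis using cA4 n by simp
  next
    case True
    then obtain w where w: "\<And>F. F \<in> A \<Longrightarrow> w \<in> F" by auto
    have wS: "w \<in> S" using w[OF P] unfolding S_def by auto
    have "A \<subseteq> {F \<in> nsets S 3. {w} \<subseteq> F}" using AS f w by (auto simp: nsets_def)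
    then have "card A \<le> card {F \<in> nsets S 3. {w} \<subseteq> F}" using S by (intro card_mono) auto
    also have "\<dots> = 3" using card_supersets[of S "{w}" 3] S wS by (simp add: numeral_eq_Suc)
    finally have cA3: "card A \<le> 3" .
    have uniq: "u = w" if u: "\<forall>F\<in>A. u \<in> F" for u
    proof (rule ccontr)
      assume "u \<noteq> w"
      moreover have "{u, w} \<subseteq> P \<inter> Q \<inter> R" using u w P Q R by auto
      ultimately have "2 \<le> card (P \<inter> Q \<inter> R)" using f[OF P] card_mono[of "P \<inter> Q \<inter> R" "{u, w}"] by simp
      then show False using PQR by simp
    qed
    have "B \<subseteq> nsets S 2 \<union> (\<lambda>v. {w, v}) ` (V - S)"
    proof
      fix G assume G: "G \<in> B"
      have g: "finite G" "card G = 2" "G \<subseteq> V" using G D(3) by (auto simp: nsets_def)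
      show "G \<in> nsets S 2 \<union> (\<lambda>v. {w, v}) ` (V - S)"
      proof (cases "G \<subseteq> S")
        case True then show ?thesis using g by (auto simp: nsets_def)
      next
        case False
        then have GS: "G \<inter> S = {w}" using out[OF G False] uniq by blast
        obtain v where v: "v \<in> G" "v \<notin> S" using False by auto
        have "w \<in> G" using GS by blast
        moreover have "w \<noteq> v" using v wS by auto
        ultimately have "{w, v} = G" by (intro card_subset_eq) (use g v in auto)
        then show ?thesis using v g by auto
      qed
    qed
    then have "card B \<le> card (nsets S 2 \<union> (\<lambda>v. {w, v}) ` (V - S))"
      using S D(1) by (intro card_mono) auto
    also have "\<dots> \<le> card (nsets S 2) + card ((\<lambda>v. {w, v}) ` (V - S))" by (rule card_Un_le)
    also have "card ((\<lambda>v. {w, v}) ` (V - S)) \<le> card (V - S)" by (rule card_image_le) (use D(1) in simp)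
    also have "card (V - S) = card V - 4" using S D(1) by (simp add: card_Diff_subset)
    \<comment> \<open>Altogether at most \<open>3 + 6 + (card V - 4)\<close>, which is below
      \<open>2 * card V\<close>.\<close>
    finally show ?thesis using cA3 S6 n by simp
  qed
qed

definition even_W :: "nat \<Rightarrow> nat \<Rightarrow> nat set \<Rightarrow> nat set \<Rightarrow> nat set set" where
  "even_W n d D1 D2 = subsets_le n (d - 1) \<union> {D1, D2} \<union>
       {H \<in> nsets {1..n} d. H \<inter> D1 \<noteq> {} \<and> H \<inter> D2 \<noteq> {}}"

text \<open>The common form of \<open>W_star_6\<close> and \<open>W_star_star_6\<close>, with a
  kernel of size 3 and 2 respectively.\<close>

definition star_6 :: "nat \<Rightarrow> nat set \<Rightarrow> nat set set" where
  "star_6 n E = subsets_le n 2 \<union> {F \<in> nsets {1..n} 3. F \<inter> E \<noteq> {}} \<union> {H \<in> nsets {1..n} 4. E \<subseteq> H}"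

text \<open>\<open>H_star_4\<close> with an arbitrary pair \<open>E\<close> in place of
  \<open>{1, 2}\<close>.\<close>

definition star_4 :: "nat \<Rightarrow> nat set \<Rightarrow> nat set set" where
  "star_4 n E = subsets_le n 1 \<union> {F \<in> nsets {1..n} 2. F \<inter> E \<noteq> {}} \<union> {H \<in> nsets {1..n} 3. E \<subseteq> H}"

text \<open>A pair disjoint from \<open>E\<close> would have to contain the third point of every
  triple, allowing only two triples. A set of size at least four would contain a triple omitting a
  point of \<open>E\<close>, which lies in \<open>C\<close> by downward closure.\<close>

lemma subset_star_4:
  assumes C: "C \<subseteq> Pow {1..n}" and down: "\<And>X Y. X \<in> C \<Longrightarrow> Y \<subseteq> X \<Longrightarrow> Y \<in> C"
    and cp: "cross_pair {1..n} 3 2 2 (lay C 3) (lay C 2)" and c3: "3 \<le> card (lay C 3)"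
    and E: "card E = 2" "\<And>F. F \<in> lay C 3 \<Longrightarrow> E \<subseteq> F"
  shows "C \<subseteq> star_4 n E"
proof
  fix X assume X: "X \<in> C"
  note D = cross_pairD[OF cp]
  have fE: "finite E" using E(1) by (simp add: card_ge_0_finite)
  have x: "X \<subseteq> {1..n}" using X C by auto
  then have fX: "finite X" by (rule finite_subset) simp
  note x = x fX
  consider "card X \<le> 1" | "card X = 2" | "card X = 3" | "4 \<le> card X" by linarith
  then show "X \<in> star_4 n E"
  proof cases
    case 1 then show ?thesis using x by (simp add: star_4_def subsets_le_def)
  next
    case 2
    have "X \<inter> E \<noteq> {}"
    proof
      assume XE: "X \<inter> E = {}"
      have "lay C 3 \<subseteq> (\<lambda>v. insert v E) ` X"
      proof
        fix F assume F: "F \<in> lay C 3"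
        have fF: "finite F" "card F = 3" using F D(2) by (auto simp: nsets_def)
        have "X \<in> lay C 2" using X 2 by (simp add: lay_def)
        then have "F \<inter> X \<noteq> {}" using D(6) F crossing_one_iff[OF D(2)] by blast
        then obtain v where v: "v \<in> F" "v \<in> X" by auto
        have "v \<notin> E" using v XE by auto
        then have "insert v E = F" using v E(1) E(2)[OF F] fF fE by (intro card_subset_eq) auto
        then show "F \<in> (\<lambda>v. insert v E) ` X" using v by auto
      qed
      then have "card (lay C 3) \<le> card ((\<lambda>v. insert v E) ` X)" using x by (intro card_mono) auto
      also have "\<dots> \<le> card X" by (rule card_image_le[OF x(2)])
      finally show False using 2 c3 by simp
    qed
    then show ?thesis using x 2 by (simp add: star_4_def nsets_def)
  next
    case 3
    then have "E \<subseteq> X" using X E(2) by (simp add: lay_def)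
    then show ?thesis using x 3 by (simp add: star_4_def nsets_def)
  next
    case 4
    obtain e where e: "e \<in> E" using E(1) by fastforce
    have "3 \<le> card (X - {e})" using 4 x by (cases "e \<in> X") auto
    then obtain Y where Y: "Y \<in> nsets (X - {e}) 3" using ex_nset[of "X - {e}" 3] x by auto
    then have "Y \<in> lay C 3" using down[OF X, of Y] by (auto simp: lay_def nsets_def)
    then have "e \<in> Y" using E(2) e by blast
    then show ?thesis using Y by (auto simp: nsets_def)
  qed
qed

text \<open>\<open>cross_pair_bound_two\<close> covers \<open>b \<ge> 3\<close>, so
  \<open>d = 2\<close> is treated separately: two triples by direct counting, three or more by
  \<open>triples_pairs_bound\<close>. In the latter case a common pair of all triples is excluded
  because it would place \<open>C\<close> inside \<open>star_4\<close>.\<close>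

lemma even_middle_bound:
  assumes d: "2 \<le> d" and n: "2 * d + 2 \<le> n" and C: "C \<subseteq> Pow {1..n}"
    and down: "\<And>X Y. X \<in> C \<Longrightarrow> Y \<subseteq> X \<Longrightarrow> Y \<in> C"
    and cp: "cross_pair {1..n} (d + 1) d 2 (lay C (d + 1)) (lay C d)"
    and two: "2 \<le> card (lay C (d + 1))"
    and H4: "\<And>E. d = 2 \<Longrightarrow> E \<subseteq> {1..n} \<Longrightarrow> card E = 2 \<Longrightarrow> \<not> C \<subseteq> star_4 n E"
  shows "card (lay C (d + 1)) + card (lay C d) + ((n - d - 1) choose d) + ((n - d - 2) choose (d - 1))
      \<le> (n choose d) + 2"
    and "card (lay C (d + 1)) + card (lay C d) + ((n - d - 1) choose d) + ((n - d - 2) choose (d - 1))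
      = (n choose d) + 2 \<Longrightarrow> card (lay C (d + 1)) = 2 \<or> (d = 3 \<and> (\<exists>E\<subseteq>{1..n}. (card E = 2 \<or> card E = 3) \<and>
         lay C (d + 1) = {F \<in> nsets {1..n} 4. E \<subseteq> F} \<and> lay C d = {G \<in> nsets {1..n} 3. G \<inter> E \<noteq> {}}))"
proof -
  note D = cross_pairD[OF cp]
  have "card (lay C (d + 1)) + card (lay C d) + ((n - d - 1) choose d) + ((n - d - 2) choose (d - 1))
      \<le> (n choose d) + 2 \<and>
    (card (lay C (d + 1)) + card (lay C d) + ((n - d - 1) choose d) + ((n - d - 2) choose (d - 1))
      = (n choose d) + 2 \<longrightarrow> card (lay C (d + 1)) = 2 \<or> (d = 3 \<and> (\<exists>E\<subseteq>{1..n}. (card E = 2 \<or> card E = 3) \<and>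
         lay C (d + 1) = {F \<in> nsets {1..n} 4. E \<subseteq> F} \<and> lay C d = {G \<in> nsets {1..n} 3. G \<inter> E \<noteq> {}})))"
  proof (cases "d = 2")
    case False
    then have d3: "3 \<le> d" using d by simp
    have ar: "card {1..n} - (d + 1) = n - d - 1" "card {1..n} - (d + 1) - 1 = n - d - 2" "d + 1 + d < card {1..n}"
      using n by auto
    note b = cross_pair_bound_two[OF cp two d3, unfolded ar]
    show ?thesis
    proof (intro conjI impI)
      show "card (lay C (d + 1)) + card (lay C d) + ((n - d - 1) choose d) + ((n - d - 2) choose (d - 1))
        \<le> (n choose d) + 2" using b(1) by simp
      assume eq: "card (lay C (d + 1)) + card (lay C d) + ((n - d - 1) choose d) + ((n - d - 2) choose (d - 1))
        = (n choose d) + 2"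
      have "card (lay C (d + 1)) = 2 \<or> d = 3 \<and> (\<exists>E\<subseteq>{1..n}. (card E = 2 \<or> card E = 2 + 1) \<and>
         lay C (d + 1) = {F \<in> nsets {1..n} (d + 1). E \<subseteq> F} \<and> lay C d = {G \<in> nsets {1..n} d. G \<inter> E \<noteq> {}})"
        by (rule b(2)) (use eq n in simp_all)
      then show "card (lay C (d + 1)) = 2 \<or> d = 3 \<and> (\<exists>E\<subseteq>{1..n}. (card E = 2 \<or> card E = 3) \<and>
         lay C (d + 1) = {F \<in> nsets {1..n} 4. E \<subseteq> F} \<and> lay C d = {G \<in> nsets {1..n} 3. G \<inter> E \<noteq> {}})"
        by (cases "d = 3") simp_all
    qed
  next
    case d2: True
    show ?thesis
    proof (cases "card (lay C 3) = 2")
      case True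
      then obtain P Q where PQ: "lay C 3 = {P, Q}" "P \<noteq> Q" by (auto simp: card_2_iff)
      have "card (lay C 2) + ((card {1..n} - 3) choose 2) + ((card {1..n} - 3 - 1) choose (2 - 1)) \<le> card {1..n} choose 2"
        by (rule card_crossing_le_two[where A = "lay C 3" and P = P and Q = Q]) (use D d2 PQ in \<open>auto simp: numeral_3_eq_3\<close>)
      then show ?thesis using True d2 by (simp add: numeral_3_eq_3)
    next
      case False
      have cp': "cross_pair {1..n} 3 2 2 (lay C 3) (lay C 2)" using cp d2 by (simp add: numeral_3_eq_3)
      have c3: "3 \<le> card (lay C 3)" using False two d2 by (simp add: numeral_3_eq_3)
      have ns: "\<exists>F\<in>lay C 3. \<not> E \<subseteq> F" if "E \<subseteq> {1..n}" "card E = 2" for E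
      proof (rule ccontr)
        assume "\<not> ?thesis"
        then have "C \<subseteq> star_4 n E"
          by (intro subset_star_4[OF C _ cp' c3 that(2)]) (use down in blast)+
        then show False using H4[OF d2 that] by blast
      qed
      have "card (lay C 3) + card (lay C 2) < 2 * card {1..n}"
        by (rule triples_pairs_bound[OF cp' _ c3 ns]) (use n d2 in auto)
      then have lt: "card (lay C 3) + card (lay C 2) < 2 * n" by simp
      \<comment> \<open>For \<open>d = 2\<close> the two sides of the claim differ exactly as
        \<open>card (lay C 3) + card (lay C 2)\<close> and \<open>2 * n\<close>, so three or more
        triples never give equality.\<close>
      define r where "r = n - 4"
      have r: "n = Suc (Suc (Suc (Suc r)))" using n d2 r_def by simp
      have "n choose 2 = 3 * r + 6 + (Suc r choose 2)" unfolding r by (simp add: choose_two_Suc)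
      moreover have "n - 2 - 1 = Suc r" "n - 2 - 2 = r" using r by auto
      moreover have "(2::nat) + 1 = 3" "(2::nat) - 1 = 1" by auto
      ultimately have "card (lay C (2 + 1)) + card (lay C 2) + ((n - 2 - 1) choose 2) + ((n - 2 - 2) choose (2 - 1))
        < (n choose 2) + 2" using lt r by simp
      then show ?thesis unfolding d2 by simp
    qed
  qed
  then show "card (lay C (d + 1)) + card (lay C d) + ((n - d - 1) choose d) + ((n - d - 2) choose (d - 1))
      \<le> (n choose d) + 2"
    and "card (lay C (d + 1)) + card (lay C d) + ((n - d - 1) choose d) + ((n - d - 2) choose (d - 1))
      = (n choose d) + 2 \<Longrightarrow> card (lay C (d + 1)) = 2 \<or> (d = 3 \<and> (\<exists>E\<subseteq>{1..n}. (card E = 2 \<or> card E = 3) \<and>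
         lay C (d + 1) = {F \<in> nsets {1..n} 4. E \<subseteq> F} \<and> lay C d = {G \<in> nsets {1..n} 3. G \<inter> E \<noteq> {}}))"
    by blast+
qed

lemma union_of_layers:
  assumes "C \<subseteq> Pow {1..n}" "\<And>i. i < m \<Longrightarrow> lay C i = nsets {1..n} i"
    and "\<And>X. X \<in> C \<Longrightarrow> card X \<le> m + 1" "1 \<le> m"
  shows "C = subsets_le n (m - 1) \<union> lay C m \<union> lay C (m + 1)"
proof (rule set_eqI)
  fix X
  show "X \<in> C \<longleftrightarrow> X \<in> subsets_le n (m - 1) \<union> lay C m \<union> lay C (m + 1)"
  proof (cases "card X < m")
    case True
    have "X \<in> C \<longleftrightarrow> X \<in> lay C (card X)" by (simp add: lay_def)
    also have "\<dots> \<longleftrightarrow> X \<in> subsets_le n (m - 1)"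
      using assms(2)[OF True] True by (auto simp: nsets_def subsets_le_def finite_subset)
    finally show ?thesis using True by (auto simp: lay_def)
  next
    case False
    then have "X \<notin> subsets_le n (m - 1)" using assms(4) by (auto simp: subsets_le_def)
    moreover have "card X = m \<or> card X = m + 1" if "X \<in> C" using assms(3)[OF that] False by linarith
    ultimately show ?thesis by (auto simp: lay_def)
  qed
qed

text \<open>Each pair of layers below the middle is bounded by \<open>n choose i\<close> separately.
  A tight total makes every one of these bounds tight, so the lower layers are full and the layers
  above \<open>d + 1\<close> empty, and the structure is decided by the middle pair alone.\<close>

theorem even_bound:
  assumes d: "2 \<le> d" and n: "2 * d + 2 \<le> n" and C: "C \<subseteq> Pow {1..n}" and su: "s_union (2 * d) C"
    and down: "\<And>X Y. X \<in> C \<Longrightarrow> Y \<subseteq> X \<Longrightarrow> Y \<in> C"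
    and two: "2 \<le> card (lay C (d + 1))"
    and H4: "\<And>E. d = 2 \<Longrightarrow> E \<subseteq> {1..n} \<Longrightarrow> card E = 2 \<Longrightarrow> \<not> C \<subseteq> star_4 n E"
  shows "card C + ((n - d - 1) choose d) + ((n - d - 2) choose (d - 1)) \<le> (\<Sum>i\<le>d. n choose i) + 2"
    and "card C + ((n - d - 1) choose d) + ((n - d - 2) choose (d - 1)) = (\<Sum>i\<le>d. n choose i) + 2 \<Longrightarrow>
      (\<exists>D1 D2. D1 \<in> nsets {1..n} (d + 1) \<and> D2 \<in> nsets {1..n} (d + 1) \<and> card (D1 \<inter> D2) = d \<and> C = even_W n d D1 D2) \<or>
      (d = 3 \<and> (\<exists>E\<subseteq>{1..n}. (card E = 2 \<or> card E = 3) \<and> C = star_6 n E))"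
proof -
  have fC: "finite C" using C finite_subset by blast
  have cX: "card X \<le> 2 * d" if "X \<in> C" for X
  proof -
    have "card (X \<union> X) \<le> 2 * d" using su that unfolding s_union_def by blast
    then show ?thesis by simp
  qed
  have cp: "cross_pair {1..n} (d + 1) d 2 (lay C (d + 1)) (lay C d)"
    using s_union_cross_pair[OF _ C su, of "d + 1" d] n by simp
  have M1: "card (lay C (d + 1)) + card (lay C d) + ((n - d - 1) choose d) + ((n - d - 2) choose (d - 1))
      \<le> (n choose d) + 2"
    by (rule even_middle_bound(1)[OF d n C _ cp two]) (use down H4 in blast)+
  define T where "T i = card (lay C i) + card (lay C (2 * d + 1 - i))" for i
  have "card C = (\<Sum>i\<le>2 * d + 1. card (lay C i))"
    by (rule card_eq_sum_lay[OF fC]) (use cX in fastforce)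
  also have "\<dots> = (\<Sum>i\<le>d. T i)" unfolding T_def by (rule sum_fold_even)
  also have "\<dots> = (\<Sum>i<d. T i) + T d" by (simp add: lessThan_Suc_atMost[symmetric])
  finally have cC: "card C = (\<Sum>i<d. T i) + T d" .
  have Td: "T d = card (lay C (d + 1)) + card (lay C d)" unfolding T_def by simp
  have Ti: "T i \<le> n choose i" if "i < d" for i
    using s_union_layers(1)[OF _ C su, of "2 * d + 1 - i" i] that n unfolding T_def by simp
  have sumle: "(\<Sum>i<d. T i) \<le> (\<Sum>i<d. n choose i)" by (rule sum_mono) (use Ti in simp)
  have sd: "(\<Sum>i\<le>d. n choose i) = (\<Sum>i<d. n choose i) + (n choose d)"
    by (simp add: lessThan_Suc_atMost[symmetric])
  show "card C + ((n - d - 1) choose d) + ((n - d - 2) choose (d - 1)) \<le> (\<Sum>i\<le>d. n choose i) + 2"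
    using M1 cC Td sumle sd by linarith
  assume eq: "card C + ((n - d - 1) choose d) + ((n - d - 2) choose (d - 1)) = (\<Sum>i\<le>d. n choose i) + 2"
  have eqM: "card (lay C (d + 1)) + card (lay C d) + ((n - d - 1) choose d) + ((n - d - 2) choose (d - 1))
      = (n choose d) + 2" and eqS: "(\<Sum>i<d. T i) = (\<Sum>i<d. n choose i)"
    using M1 cC Td sumle sd eq by linarith+
  have Te: "T i = n choose i" if "i < d" for i
    by (rule sum_mono_inv[OF eqS]) (use Ti that in auto)
  have lays: "lay C (2 * d + 1 - i) = {} \<and> lay C i = nsets {1..n} i" if "i < d" for i
    using s_union_layers(2)[OF _ C su, of "2 * d + 1 - i" i] Te[OF that] that n unfolding T_def by simp
  have top: "card X \<le> d + 1" if X: "X \<in> C" for X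
  proof (rule ccontr)
    assume "\<not> card X \<le> d + 1"
    then have "2 * d + 1 - card X < d" "2 * d + 1 - (2 * d + 1 - card X) = card X" using cX[OF X] by auto
    then have "lay C (card X) = {}" using lays by metis
    then show False using X by (auto simp: lay_def)
  qed
  have Ceq: "C = subsets_le n (d - 1) \<union> lay C d \<union> lay C (d + 1)"
    by (rule union_of_layers[OF C]) (use lays top d in auto)
  note D = cross_pairD[OF cp]
  have "card (lay C (d + 1)) = 2 \<or> (d = 3 \<and> (\<exists>E\<subseteq>{1..n}. (card E = 2 \<or> card E = 3) \<and>
         lay C (d + 1) = {F \<in> nsets {1..n} 4. E \<subseteq> F} \<and> lay C d = {G \<in> nsets {1..n} 3. G \<inter> E \<noteq> {}}))"
    by (rule even_middle_bound(2)[OF d n C _ cp two _ eqM]) (use down H4 in blast)+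
  then show "(\<exists>D1 D2. D1 \<in> nsets {1..n} (d + 1) \<and> D2 \<in> nsets {1..n} (d + 1) \<and> card (D1 \<inter> D2) = d \<and> C = even_W n d D1 D2) \<or>
      (d = 3 \<and> (\<exists>E\<subseteq>{1..n}. (card E = 2 \<or> card E = 3) \<and> C = star_6 n E))"
  proof
    assume c2: "card (lay C (d + 1)) = 2"
    have e: "card (lay C (d + 1)) + card (lay C d) + ((card {1..n} - (d + 1)) choose d)
      + ((card {1..n} - (d + 1) - 1) choose (d - 1)) = (card {1..n} choose d) + 2" using eqM by simp
    have "\<exists>P Q. P \<noteq> Q \<and> lay C (d + 1) = {P, Q} \<and> card (P \<inter> Q) = d + 1 - 1 \<and>
      lay C d = {G \<in> nsets {1..n} d. G \<inter> P \<noteq> {} \<and> G \<inter> Q \<noteq> {}}"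
      by (rule card_two_full[OF D(1-3,6) _ _ c2 e]) (use n d in auto)
    then obtain P Q where PQ: "P \<noteq> Q \<and> lay C (d + 1) = {P, Q} \<and> card (P \<inter> Q) = d + 1 - 1 \<and>
      lay C d = {G \<in> nsets {1..n} d. G \<inter> P \<noteq> {} \<and> G \<inter> Q \<noteq> {}}" by (elim exE)
    have "P \<in> nsets {1..n} (d + 1)" "Q \<in> nsets {1..n} (d + 1)" using PQ D(2) by auto
    moreover have "C = even_W n d P Q" using Ceq PQ unfolding even_W_def by (metis Un_assoc Un_commute)
    ultimately have "\<exists>D1 D2. D1 \<in> nsets {1..n} (d + 1) \<and> D2 \<in> nsets {1..n} (d + 1) \<and> card (D1 \<inter> D2) = d \<and> C = even_W n d D1 D2"
      using PQ by (intro exI[of _ P] exI[of _ Q]) simp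
    then show ?thesis by (rule disjI1)
  next
    assume "d = 3 \<and> (\<exists>E\<subseteq>{1..n}. (card E = 2 \<or> card E = 3) \<and>
         lay C (d + 1) = {F \<in> nsets {1..n} 4. E \<subseteq> F} \<and> lay C d = {G \<in> nsets {1..n} 3. G \<inter> E \<noteq> {}})"
    then obtain E where E: "d = 3" "E \<subseteq> {1..n}" "card E = 2 \<or> card E = 3"
      "lay C (d + 1) = {F \<in> nsets {1..n} 4. E \<subseteq> F}" "lay C d = {G \<in> nsets {1..n} 3. G \<inter> E \<noteq> {}}"
      by (elim conjE exE) (rule that)
    then have "C = star_6 n E" using Ceq unfolding star_6_def by simp
    then have "\<exists>E\<subseteq>{1..n}. (card E = 2 \<or> card E = 3) \<and> C = star_6 n E" using E(2,3) by (intro exI[of _ E] conjI)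
    then show ?thesis using E(1) by (intro disjI2 conjI)
  qed
qed

subsection \<open>The odd case\<close>

lemma insert_in_nsets_iff:
  assumes "c \<in> V" "c \<notin> G"
  shows "insert c G \<in> nsets V (Suc k) \<longleftrightarrow> G \<in> nsets (V - {c}) k"
  using assms by (auto simp: nsets_def)

text \<open>Joins the cases \<open>k = 3\<close> and \<open>k \<ge> 4\<close>. The two-of-three
  family is rewritten as a star pair centred at one of its three points, so that the exceptional
  families for both kernel sizes have the same form.\<close>

lemma odd_middle_bound:
  fixes V :: "nat set"
  assumes fV: "finite V" and k: "3 \<le> k" and n: "2 * k < card V"
    and F: "F \<subseteq> nsets V k" and cr: "crossing 1 F F" and two: "\<And>x. x \<in> V \<Longrightarrow> 2 \<le> card (del x F)"
    and nT: "\<And>T. k = 3 \<Longrightarrow> T \<subseteq> V \<Longrightarrow> card T = 3 \<Longrightarrow> \<exists>G\<in>F. card (G \<inter> T) < 2"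
  shows "card F + ((card V - 1 - k) choose (k - 1)) + ((card V - 1 - k - 1) choose (k - 2))
      \<le> ((card V - 1) choose (k - 1)) + 2"
    and "card F + ((card V - 1 - k) choose (k - 1)) + ((card V - 1 - k - 1) choose (k - 2))
      = ((card V - 1) choose (k - 1)) + 2 \<Longrightarrow> (\<exists>c\<in>V. card (del c F) = 2) \<or>
      (k = 4 \<and> (\<exists>c E. c \<in> V \<and> E \<subseteq> V - {c} \<and> (card E = 2 \<or> card E = 3) \<and>
        del c F = {F \<in> nsets (V - {c}) 4. E \<subseteq> F} \<and> link c F = {G \<in> nsets (V - {c}) 3. G \<inter> E \<noteq> {}}))"
proof -
  define tight where "tight \<longleftrightarrow> card F + ((card V - 1 - k) choose (k - 1)) + ((card V - 1 - k - 1) choose (k - 2))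
      = ((card V - 1) choose (k - 1)) + 2"
  define star where "star \<longleftrightarrow> (\<exists>c E. c \<in> V \<and> E \<subseteq> V - {c} \<and> (card E = 2 \<or> card E = 3) \<and>
        del c F = {F \<in> nsets (V - {c}) 4. E \<subseteq> F} \<and> link c F = {G \<in> nsets (V - {c}) 3. G \<inter> E \<noteq> {}})"
  have "card F + ((card V - 1 - k) choose (k - 1)) + ((card V - 1 - k - 1) choose (k - 2))
      \<le> ((card V - 1) choose (k - 1)) + 2 \<and> (tight \<longrightarrow> (\<exists>c\<in>V. card (del c F) = 2) \<or> (k = 4 \<and> star))"
  proof (cases "k = 3")
    case True
    \<comment> \<open>For \<open>k = 3\<close> the general bound is the number
      \<open>2 * card V - 2\<close> from the theorem on triples.\<close>
    define r where "r = card V - 5"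
    have r: "card V = Suc (Suc (Suc (Suc (Suc r))))" using n True r_def by simp
    have ar: "card V - 1 - 3 = Suc r" "card V - 1 - 3 - 1 = r" "(3::nat) - 1 = 2" "(3::nat) - 2 = 1"
      "card V - 1 = Suc (Suc (Suc (Suc r)))" "2 * card V - 2 = 2 * r + 8" using r by auto
    have F3: "F \<subseteq> nsets V 3" using F True by simp
    have V7: "7 \<le> card V" using n True by simp
    have b1: "card F \<le> 2 * card V - 2"
      by (rule nontrivial_triples_bound(1)[OF fV V7 F3 cr two]) (use nT True in blast)+
    have b2: "\<exists>c\<in>V. card (del c F) = 2" if "card F = 2 * card V - 2"
      by (rule nontrivial_triples_bound(2)[OF fV V7 F3 cr two _ that]) (use nT True in blast)+
    show ?thesis
      using b1 b2 unfolding tight_def True ar by (simp add: choose_two_Suc)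
  next
    case False
    then have k4: "4 \<le> k" using k by simp
    note H = nontrivial_intersecting_bound[OF fV k4 n F cr two]
    have "(\<exists>c\<in>V. card (del c F) = 2) \<or> (k = 4 \<and> star)" if t: tight
    proof -
      have "nontrivial_extremal V k F" using H t unfolding tight_def by blast
      then consider "\<exists>c\<in>V. card (del c F) = 2"
        | (star) c E where "k = 4" "c \<in> V" "E \<subseteq> V - {c}" "card E = 3"
              "del c F = {F \<in> nsets (V - {c}) 4. E \<subseteq> F}" "link c F = {G \<in> nsets (V - {c}) 3. G \<inter> E \<noteq> {}}"
        | (three) T where "k = 4" "T \<subseteq> V" "card T = 3" "F = {G \<in> nsets V 4. 2 \<le> card (G \<inter> T)}"
        unfolding nontrivial_extremal_def two_of_three_def by blast
      then show ?thesis
      proof cases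
        case 1 then show ?thesis by blast
      next
        case star
        have star unfolding star_def
          by (rule exI[of _ c], rule exI[of _ E]) (use star in simp)
        then show ?thesis using star by blast
      next
        case three
        have "T \<noteq> {}" using three by auto
        then obtain c where c: "c \<in> T" by auto
        have fT: "finite T" using three fV finite_subset by auto
        have E: "c \<in> V" "T - {c} \<subseteq> V - {c}" "card (T - {c}) = 2" "insert c (T - {c}) = T"
          using three c fT by auto
        have star unfolding star_def
          by (rule exI[of _ c], rule exI[of _ "T - {c}"])
            (use E two_of_three_parts[OF fV E(1,2,3)] three(4) in simp)
        then show ?thesis using three by blast
      qed
    qed
    then show ?thesis using H by blast
  qed
  then show "card F + ((card V - 1 - k) choose (k - 1)) + ((card V - 1 - k - 1) choose (k - 2))
      \<le> ((card V - 1) choose (k - 1)) + 2"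
    and "card F + ((card V - 1 - k) choose (k - 1)) + ((card V - 1 - k - 1) choose (k - 2))
      = ((card V - 1) choose (k - 1)) + 2 \<Longrightarrow> (\<exists>c\<in>V. card (del c F) = 2) \<or>
      (k = 4 \<and> (\<exists>c E. c \<in> V \<and> E \<subseteq> V - {c} \<and> (card E = 2 \<or> card E = 3) \<and>
        del c F = {F \<in> nsets (V - {c}) 4. E \<subseteq> F} \<and> link c F = {G \<in> nsets (V - {c}) 3. G \<inter> E \<noteq> {}}))"
    unfolding tight_def star_def by blast+
qed

definition odd_katona :: "nat \<Rightarrow> nat \<Rightarrow> nat \<Rightarrow> nat set set" where
  "odd_katona n d y = subsets_le n d \<union> {F \<in> nsets {1..n} (d + 1). y \<in> F}"

definition odd_frankl :: "nat \<Rightarrow> nat \<Rightarrow> nat \<Rightarrow> nat set \<Rightarrow> nat set set" where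
  "odd_frankl n d y D = subsets_le n d \<union> {D} \<union> {H \<in> nsets {1..n} (d + 1). y \<in> H \<and> H \<inter> D \<noteq> {}}"

definition two_of_three_5 :: "nat \<Rightarrow> nat set \<Rightarrow> nat set set" where
  "two_of_three_5 n T = subsets_le n 2 \<union> {F \<in> nsets {1..n} 3. 2 \<le> card (F \<inter> T)}"

text \<open>Up to isomorphism this is \<open>W_star_7\<close> for a kernel \<open>E\<close> of size
  2 and \<open>W_star_star_7\<close> for one of size 3.\<close>

definition star_7 :: "nat \<Rightarrow> nat \<Rightarrow> nat set \<Rightarrow> nat set set" where
  "star_7 n c E = subsets_le n 3 \<union> {H \<in> nsets {1..n} 4. E \<subseteq> H} \<union>
     {H \<in> nsets {1..n} 4. c \<in> H \<and> H \<inter> E \<noteq> {}}"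

text \<open>Brings \<open>\<J>\<^sub>2\<close> into the shape produced by
  \<open>card_two_full\<close>: seen from its centre it is a pair of sets with common part
  \<open>E\<close>, together with everything that meets both.\<close>

lemma J2_parts:
  assumes c: "c \<in> {1..n}" "c \<notin> E" and J: "J - {c} = {p, q}"
  shows "del c (\<J>\<^sub>2 n (d + 1) E J c) = {E \<union> {p}, E \<union> {q}}"
    and "link c (\<J>\<^sub>2 n (d + 1) E J c) =
      {G \<in> nsets ({1..n} - {c}) d. G \<inter> (E \<union> {p}) \<noteq> {} \<and> G \<inter> (E \<union> {q}) \<noteq> {}}"
proof -
  have ne: "p \<noteq> c" "q \<noteq> c" using J by auto
  show "del c (\<J>\<^sub>2 n (d + 1) E J c) = {E \<union> {p}, E \<union> {q}}"
    unfolding \<J>\<^sub>2_def J using ne c by (auto simp: del_def)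
  show "link c (\<J>\<^sub>2 n (d + 1) E J c) =
      {G \<in> nsets ({1..n} - {c}) d. G \<inter> (E \<union> {p}) \<noteq> {} \<and> G \<inter> (E \<union> {q}) \<noteq> {}}" (is "_ = ?L")
  proof (rule set_eqI)
    fix G
    show "G \<in> link c (\<J>\<^sub>2 n (d + 1) E J c) \<longleftrightarrow> G \<in> ?L"
    proof (cases "c \<in> G")
      case True then show ?thesis by (auto simp: link_def nsets_def)
    next
      case False
      have m: "insert c G \<inter> (E \<union> {p}) = G \<inter> (E \<union> {p})" "insert c G \<inter> (E \<union> {q}) = G \<inter> (E \<union> {q})"
        using ne c by auto
      have "insert c G \<noteq> E \<union> {j}" if "j \<in> {p, q}" for j
      proof
        assume "insert c G = E \<union> {j}"
        then have "c \<in> E \<union> {j}" by (metis insertI1)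
        then show False using ne c that by auto
      qed
      then have notin: "insert c G \<notin> {E \<union> {j} |j. j \<in> {p, q}}" by blast
      have mt: "(\<forall>j\<in>{p, q}. insert c G \<inter> (E \<union> {j}) \<noteq> {}) \<longleftrightarrow>
          G \<inter> (E \<union> {p}) \<noteq> {} \<and> G \<inter> (E \<union> {q}) \<noteq> {}"
        unfolding ball_simps m by simp
      have "G \<in> link c (\<J>\<^sub>2 n (d + 1) E J c) \<longleftrightarrow> insert c G \<in> \<J>\<^sub>2 n (d + 1) E J c"
        using False by (simp add: link_def)
      also have "\<dots> \<longleftrightarrow> (insert c G \<in> nsets {1..n} (d + 1) \<and> c \<in> insert c G \<and>
        (\<forall>j\<in>{p, q}. insert c G \<inter> (E \<union> {j}) \<noteq> {})) \<or> insert c G \<in> {E \<union> {j} |j. j \<in> {p, q}}"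
        unfolding \<J>\<^sub>2_def J by (simp only: Un_iff mem_Collect_eq)
      also have "\<dots> \<longleftrightarrow> insert c G \<in> nsets {1..n} (d + 1) \<and>
          G \<inter> (E \<union> {p}) \<noteq> {} \<and> G \<inter> (E \<union> {q}) \<noteq> {}"
        using notin mt by blast
      finally show ?thesis using insert_in_nsets_iff[OF c(1) False, of d] by simp
    qed
  qed
qed

text \<open>The parameters are read off from the two sets: \<open>E\<close> is their common part,
  and \<open>J\<close> consists of the centre and the two points in which they differ.\<close>

lemma link_two_sets_J2:
  assumes F: "F \<subseteq> nsets {1..n} (d + 1)" and c: "c \<in> {1..n}"
    and PQ: "P \<noteq> Q" "del c F = {P, Q}" "card (P \<inter> Q) = d"
    and L: "link c F = {G \<in> nsets ({1..n} - {c}) d. G \<inter> P \<noteq> {} \<and> G \<inter> Q \<noteq> {}}"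
  shows "\<exists>E J. E \<in> nsets {1..n} d \<and> J \<in> nsets ({1..n} - E) 3 \<and> c \<in> J \<and> F = \<J>\<^sub>2 n (d + 1) E J c"
proof -
  have f: "P \<subseteq> {1..n}" "Q \<subseteq> {1..n}" "finite P" "finite Q" "card P = d + 1" "card Q = d + 1" "c \<notin> P" "c \<notin> Q"
  proof -
    have "P \<in> del c F" "Q \<in> del c F" using PQ by auto
    then show "P \<subseteq> {1..n}" "Q \<subseteq> {1..n}" "finite P" "finite Q" "card P = d + 1" "card Q = d + 1" "c \<notin> P" "c \<notin> Q"
      using F by (auto simp: del_def nsets_def)
  qed
  define E where "E = P \<inter> Q"
  have "card (P - Q) = 1" "card (Q - P) = 1"
    using card_Diff_subset_Int[of P Q] card_Diff_subset_Int[of Q P] f PQ(3) by (simp_all add: Int_commute)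
  then obtain p q where pq: "P - Q = {p}" "Q - P = {q}" by (metis card_1_singletonE)
  have P: "P = E \<union> {p}" and Q: "Q = E \<union> {q}" and ne: "p \<noteq> q" "p \<notin> E" "q \<notin> E" "p \<noteq> c" "q \<noteq> c" "c \<notin> E"
    using pq f unfolding E_def by blast+
  define J where "J = {c, p, q}"
  have pV: "p \<in> {1..n}" "q \<in> {1..n}" using P Q f by auto
  have E: "E \<in> nsets {1..n} d" using f PQ(3) unfolding E_def by (auto simp: nsets_def)
  have J: "J \<in> nsets ({1..n} - E) 3" using ne c pV unfolding J_def by (auto simp: nsets_def)
  have Jc: "J - {c} = {p, q}" using ne unfolding J_def by auto
  have "F = \<J>\<^sub>2 n (d + 1) E J c"
    by (rule family_eqI[of c]) (use J2_parts[OF c ne(6) Jc, of d] PQ(2) L P Q in simp_all)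
  then show ?thesis using E J J_def by blast
qed

lemma star_parts:
  assumes c: "c \<in> {1..n}" "c \<notin> E" and ne: "E \<noteq> {}"
  defines "K \<equiv> {H \<in> nsets {1..n} 4. E \<subseteq> H} \<union> {H \<in> nsets {1..n} 4. c \<in> H \<and> H \<inter> E \<noteq> {}}"
  shows "del c K = {F \<in> nsets ({1..n} - {c}) 4. E \<subseteq> F}"
    and "link c K = {G \<in> nsets ({1..n} - {c}) 3. G \<inter> E \<noteq> {}}"
proof -
  show "del c K = {F \<in> nsets ({1..n} - {c}) 4. E \<subseteq> F}"
  proof (rule set_eqI)
    fix H
    have "H \<in> nsets ({1..n} - {c}) 4 \<longleftrightarrow> H \<in> nsets {1..n} 4 \<and> c \<notin> H" by (auto simp: nsets_def)
    then show "H \<in> del c K \<longleftrightarrow> H \<in> {F \<in> nsets ({1..n} - {c}) 4. E \<subseteq> F}"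
      unfolding K_def del_def by blast
  qed
  show "link c K = {G \<in> nsets ({1..n} - {c}) 3. G \<inter> E \<noteq> {}}"
  proof (rule set_eqI)
    fix G
    show "G \<in> link c K \<longleftrightarrow> G \<in> {G \<in> nsets ({1..n} - {c}) 3. G \<inter> E \<noteq> {}}"
    proof (cases "c \<in> G")
      case True then show ?thesis by (auto simp: link_def nsets_def)
    next
      case False
      have "E \<subseteq> insert c G \<Longrightarrow> G \<inter> E \<noteq> {}" using c ne by auto
      moreover have "insert c G \<inter> E = G \<inter> E" using c by auto
      ultimately have "G \<in> link c K \<longleftrightarrow> insert c G \<in> nsets {1..n} (Suc 3) \<and> G \<inter> E \<noteq> {}"
        using False unfolding K_def link_def by auto
      then show ?thesis using insert_in_nsets_iff[OF c(1) False, of 3] by simp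
    qed
  qed
qed

text \<open>Meant for a middle layer that looks like an excluded family although \<open>C\<close>
  does not. If at most one member of \<open>F\<close> avoids \<open>y\<close>, a set of size
  \<open>d + 2\<close> in \<open>C\<close> has a \<open>(d + 1)\<close>-subset avoiding
  \<open>y\<close>, and this member of \<open>F\<close> limits all those through \<open>y\<close>.
  The two-of-three case is a direct count.\<close>

lemma card_middle_exceptional:
  assumes d: "2 \<le> d" and n: "2 * d + 3 \<le> n" and C: "C \<subseteq> Pow {1..n}"
    and down: "\<And>X Y. X \<in> C \<Longrightarrow> Y \<subseteq> X \<Longrightarrow> Y \<in> C" and F: "F = lay C (d + 1)" "F \<subseteq> nsets {1..n} (d + 1)"
    and cr: "crossing 1 F F" and top: "lay C (d + 2) \<noteq> {}"
    and ex: "(\<exists>y\<in>{1..n}. card (del y F) \<le> 1) \<or>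
      (d = 2 \<and> (\<exists>T\<subseteq>{1..n}. card T = 3 \<and> (\<forall>G\<in>F. 2 \<le> card (G \<inter> T))))"
  shows "card F + ((n - d - 2) choose d) \<le> ((n - 1) choose d) + 1"
proof -
  have fF: "finite F" using F(2) by (auto intro: finite_subset[OF _ finite_nsets])
  from ex show ?thesis
  proof
    assume "\<exists>y\<in>{1..n}. card (del y F) \<le> 1"
    then obtain y where y: "y \<in> {1..n}" "card (del y F) \<le> 1" by auto
    obtain X where X: "X \<in> C" "card X = d + 2" using top by (auto simp: lay_def)
    have fX: "finite X" using X C finite_subset by (metis PowD finite_atLeastAtMost subsetD)
    have "d + 1 \<le> card (X - {y})" using X fX by (cases "y \<in> X") auto
    then obtain Y where Y: "Y \<in> nsets (X - {y}) (d + 1)" using ex_nset[of "X - {y}" "d + 1"] fX by auto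
    have "Y \<in> del y F" using Y down[OF X(1), of Y] unfolding F(1) by (auto simp: del_def lay_def nsets_def)
    have c1: "card (link y F) + ((card ({1..n} - {y}) - (d + 1)) choose (d + 1 - 1))
      \<le> card ({1..n} - {y}) choose (d + 1 - 1)"
      by (rule card_crossing_le[OF _ del_nsets[OF F(2)] link_nsets[OF F(2)] crossing_del_link[OF F(2) cr] \<open>Y \<in> del y F\<close>]) simp
    have "card ({1..n} - {y}) = n - 1" using y by simp
    then have "card (link y F) + ((n - d - 2) choose d) \<le> (n - 1) choose d" using c1 by simp
    then show ?thesis using card_del_link[OF fF, of y] y by simp
  next
    assume "d = 2 \<and> (\<exists>T\<subseteq>{1..n}. card T = 3 \<and> (\<forall>G\<in>F. 2 \<le> card (G \<inter> T)))"
    then obtain T where T: "d = 2" "T \<subseteq> {1..n}" "card T = 3" "\<And>G. G \<in> F \<Longrightarrow> 2 \<le> card (G \<inter> T)" by blast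
    have fT: "finite T" using T by (simp add: card_ge_0_finite)
    \<comment> \<open>Split at one point of \<open>T\<close>: members avoiding \<open>c\<close>
      contain both other points, and members through \<open>c\<close> contain at least one of
      them.\<close>
    obtain c where c: "c \<in> T" using T by fastforce
    define E where "E = T - {c}"
    define V' where "V' = {1..n} - {c}"
    have E: "card E = 2" "E \<subseteq> V'" "T = insert c E" "c \<notin> E" "finite E"
      using c T fT unfolding E_def V'_def by auto
    have V': "finite V'" "card V' = n - 1" using c T unfolding V'_def by auto
    have "del c F \<subseteq> {G \<in> nsets V' 3. E \<subseteq> G}"
    proof
      fix G assume G: "G \<in> del c F"
      then have "G \<inter> T = G \<inter> E" using E(3) by (auto simp: del_def)
      moreover have "2 \<le> card (G \<inter> T)" using T(4) G by (simp add: del_def)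
      ultimately have "2 \<le> card (G \<inter> E)" by simp
      then have "G \<inter> E = E" using E by (intro card_seteq) auto
      then show "G \<in> {G \<in> nsets V' 3. E \<subseteq> G}"
        using G del_nsets[OF F(2), of c] T(1) unfolding V'_def by auto
    qed
    then have "card (del c F) \<le> card {G \<in> nsets V' 3. E \<subseteq> G}" by (rule card_mono[rotated]) (use V' in simp)
    also have "\<dots> = n - 3" using card_supersets[OF V'(1) E(2), of 3] E V' by simp
    finally have c1: "card (del c F) \<le> n - 3" .
    have "link c F \<subseteq> {G \<in> nsets V' 2. G \<inter> E \<noteq> {}}"
    proof
      fix G assume G: "G \<in> link c F"
      then have "2 \<le> card (insert c G \<inter> T)" using T(4) by (auto simp: link_def)
      moreover have "insert c G \<inter> T = insert c (G \<inter> E)" using E(3) by auto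
      moreover have "card (insert c (G \<inter> E)) \<le> Suc (card (G \<inter> E))" using E(5) by (simp add: card_insert_if)
      ultimately have "card (G \<inter> E) \<noteq> 0" by simp
      then show "G \<in> {G \<in> nsets V' 2. G \<inter> E \<noteq> {}}"
        using G link_nsets[OF F(2), of c] T(1) unfolding V'_def by auto
    qed
    then have "card (link c F) \<le> card {G \<in> nsets V' 2. G \<inter> E \<noteq> {}}" by (rule card_mono[rotated]) (use V' in simp)
    moreover have "card V' - card E = n - 3" using E V' by simp
    ultimately have c2: "card (link c F) + ((n - 3) choose 2) \<le> (n - 1) choose 2"
      using card_meeting[OF V'(1) E(2), of 2] unfolding V'(2) by simp
    define r where "r = n - 4"
    have r: "n - 3 = Suc r" "n - 2 - 2 = r" using n T r_def by auto
    have "Suc r choose 2 = r + (r choose 2)" by (rule choose_two_Suc)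
    then have "card F + (r choose 2) \<le> ((n - 1) choose 2) + 1"
      using c1 c2 card_del_link[OF fF, of c] unfolding r by simp
    then show ?thesis unfolding T(1) r .
  qed
qed

text \<open>The exclusions concern all of \<open>C\<close>, whereas the theorem on intersecting
  families needs the middle layer \<open>F\<close> itself to be nontrivial. If it is not,
  \<open>C\<close> has a set of size \<open>d + 2\<close>. Then \<open>F\<close> and the pair of
  layers \<open>d\<close> and \<open>d + 2\<close> each fall short by
  \<open>(n - d - 2) choose d\<close>, up to a constant 1, and this double loss exceeds the one in
  the bound.\<close>

theorem odd_bound:
  assumes d: "2 \<le> d" and n: "2 * d + 3 \<le> n" and C: "C \<subseteq> Pow {1..n}" and su: "s_union (2 * d + 1) C"
    and down: "\<And>X Y. X \<in> C \<Longrightarrow> Y \<subseteq> X \<Longrightarrow> Y \<in> C"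
    and H1: "\<And>y. y \<in> {1..n} \<Longrightarrow> \<not> C \<subseteq> odd_katona n d y"
    and H2: "\<And>y D. y \<in> {1..n} \<Longrightarrow> D \<in> nsets ({1..n} - {y}) (d + 1) \<Longrightarrow> \<not> C \<subseteq> odd_frankl n d y D"
    and H3: "\<And>T. d = 2 \<Longrightarrow> T \<subseteq> {1..n} \<Longrightarrow> card T = 3 \<Longrightarrow> \<not> C \<subseteq> two_of_three_5 n T"
  shows "card C + ((n - d - 2) choose d) + ((n - d - 3) choose (d - 1))
      \<le> (\<Sum>i\<le>d. n choose i) + ((n - 1) choose d) + 2"
    and "card C + ((n - d - 2) choose d) + ((n - d - 3) choose (d - 1))
      = (\<Sum>i\<le>d. n choose i) + ((n - 1) choose d) + 2 \<Longrightarrow>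
      (\<exists>E J x. E \<in> nsets {1..n} d \<and> J \<in> nsets ({1..n} - E) 3 \<and> x \<in> J \<and> C = subsets_le n d \<union> \<J>\<^sub>2 n (d + 1) E J x) \<or>
      (d = 3 \<and> (\<exists>c E. c \<in> {1..n} \<and> E \<subseteq> {1..n} - {c} \<and> (card E = 2 \<or> card E = 3) \<and> C = star_7 n c E))"
proof -
  have fC: "finite C" using C finite_subset by blast
  have fX: "finite X" if "X \<in> C" for X using that C finite_subset by (metis PowD finite_atLeastAtMost subsetD)
  have cX: "card X \<le> 2 * d + 1" if "X \<in> C" for X
  proof -
    have "card (X \<union> X) \<le> 2 * d + 1" using su that unfolding s_union_def by blast
    then show ?thesis by simp
  qed
  define F where "F = lay C (d + 1)"
  have Fn: "F \<subseteq> nsets {1..n} (d + 1)" unfolding F_def by (rule lay_nsets) (use C in auto)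
  have cr: "crossing 1 F F"
    using cross_pairD(6)[OF s_union_cross_pair[OF _ C su, of "d + 1" "d + 1"]] n unfolding F_def by simp
  define T where "T i = card (lay C i) + card (lay C (2 * d + 2 - i))" for i
  have "card C = (\<Sum>i\<le>2 * d + 2. card (lay C i))"
    by (rule card_eq_sum_lay[OF fC]) (use cX in fastforce)
  also have "\<dots> = (\<Sum>i\<le>d. T i) + card F" unfolding T_def F_def by (rule sum_fold_odd)
  finally have cC: "card C = (\<Sum>i\<le>d. T i) + card F" .
  have lay1: "card (lay C i) + card (lay C (2 * d + 2 - i)) \<le> card {1..n} choose i"
    and lay2: "card (lay C i) + card (lay C (2 * d + 2 - i)) = card {1..n} choose i \<Longrightarrow>
      lay C (2 * d + 2 - i) = {} \<and> lay C i = nsets {1..n} i" if "i \<le> d" for i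
    by (rule s_union_layers[OF _ C su, of "2 * d + 2 - i" i]; use that n in simp)+
  have Ti: "T i \<le> n choose i" if "i \<le> d" for i
    using lay1[OF that] unfolding T_def by simp
  define exc where "exc \<longleftrightarrow> (\<exists>y\<in>{1..n}. card (del y F) \<le> 1) \<or>
      (d = 2 \<and> (\<exists>T\<subseteq>{1..n}. card T = 3 \<and> (\<forall>G\<in>F. 2 \<le> card (G \<inter> T))))"
  have "card C + ((n - d - 2) choose d) + ((n - d - 3) choose (d - 1))
      \<le> (\<Sum>i\<le>d. n choose i) + ((n - 1) choose d) + 2 \<and>
    (card C + ((n - d - 2) choose d) + ((n - d - 3) choose (d - 1))
      = (\<Sum>i\<le>d. n choose i) + ((n - 1) choose d) + 2 \<longrightarrow>
      (\<exists>E J x. E \<in> nsets {1..n} d \<and> J \<in> nsets ({1..n} - E) 3 \<and> x \<in> J \<and> C = subsets_le n d \<union> \<J>\<^sub>2 n (d + 1) E J x) \<or>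
      (d = 3 \<and> (\<exists>c E. c \<in> {1..n} \<and> E \<subseteq> {1..n} - {c} \<and> (card E = 2 \<or> card E = 3) \<and> C = star_7 n c E)))"
    (is "?bound \<and> (?tight \<longrightarrow> ?ext)")
  proof (cases exc)
    case exc: True
    \<comment> \<open>Without sets of size \<open>d + 2\<close>, downward closure leaves nothing
      above size \<open>d + 1\<close>. An exceptional middle layer would then put the whole of
      \<open>C\<close> into one of the excluded families.\<close>
    have top: "lay C (d + 2) \<noteq> {}"
    proof
      assume e: "lay C (d + 2) = {}"
      have le: "card X \<le> d + 1" if X: "X \<in> C" for X
      proof (rule ccontr)
        assume "\<not> card X \<le> d + 1"
        then obtain Y where Y: "Y \<in> nsets X (d + 2)" using ex_nset[of X "d + 2"] fX[OF X] by auto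
        then have "Y \<in> lay C (d + 2)" using down[OF X, of Y] by (auto simp: lay_def nsets_def)
        then show False using e by simp
      qed
      have small: "X \<in> subsets_le n d \<or> X \<in> F" if "X \<in> C" for X
        using le[OF that] that C unfolding F_def subsets_le_def lay_def by fastforce
      from exc show False unfolding exc_def
      proof
        assume "\<exists>y\<in>{1..n}. card (del y F) \<le> 1"
        then obtain y where y: "y \<in> {1..n}" "card (del y F) \<le> 1" by auto
        show False
        proof (cases "del y F = {}")
          case True
          have "C \<subseteq> odd_katona n d y"
          proof
            fix X assume "X \<in> C"
            from small[OF this] show "X \<in> odd_katona n d y"
              using True Fn unfolding odd_katona_def del_def by auto
          qed
          then show False using H1 y by blast
        next
          case False
          have fd: "finite (del y F)" using Fn by (intro finite_del) (auto intro: finite_subset[OF _ finite_nsets])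
          then have "card (del y F) = 1" using y False card_0_eq[OF fd] by linarith
          then obtain D where D: "del y F = {D}" by (rule card_1_singletonE)
          then have DF: "D \<in> F" "y \<notin> D" by (auto simp: del_def)
          have "C \<subseteq> odd_frankl n d y D"
          proof
            fix X assume "X \<in> C"
            from small[OF this] show "X \<in> odd_frankl n d y D"
            proof
              assume X: "X \<in> F"
              have "X = D \<or> y \<in> X" using X D by (auto simp: del_def)
              moreover have "X \<inter> D \<noteq> {}" using cr X DF crossing_one_iff[OF Fn] by blast
              ultimately show ?thesis using X Fn unfolding odd_frankl_def by auto
            qed (simp add: odd_frankl_def)
          qed
          moreover have "D \<in> nsets ({1..n} - {y}) (d + 1)" using DF Fn by (auto simp: nsets_def)
          ultimately show False using H2 y by blast
        qed
      next
        assume "d = 2 \<and> (\<exists>T\<subseteq>{1..n}. card T = 3 \<and> (\<forall>G\<in>F. 2 \<le> card (G \<inter> T)))"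
        then obtain T where T: "d = 2" "T \<subseteq> {1..n}" "card T = 3" "\<forall>G\<in>F. 2 \<le> card (G \<inter> T)" by blast
        have "C \<subseteq> two_of_three_5 n T"
        proof
          fix X assume "X \<in> C"
          from small[OF this] show "X \<in> two_of_three_5 n T"
            using T Fn unfolding two_of_three_5_def by auto
        qed
        then show False using H3 T by blast
      qed
    qed
    have cF: "card F + ((n - d - 2) choose d) \<le> ((n - 1) choose d) + 1"
      by (rule card_middle_exceptional[OF d n C _ F_def Fn cr top exc[unfolded exc_def]]) (use down in blast)
    have cp: "cross_pair {1..n} (d + 2) d 3 (lay C (d + 2)) (lay C d)"
      using s_union_cross_pair[OF _ C su, of "d + 2" d] n by simp
    have "card (lay C (d + 2)) + card (lay C d) + ((card {1..n} - (d + 2)) choose d) \<le> (card {1..n} choose d) + 1"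
      by (rule cross_pair_bound[OF cp top]) (use d in simp)
    then have Td: "T d + ((n - d - 2) choose d) \<le> (n choose d) + 1" unfolding T_def by simp
    have "(\<Sum>i<d. T i) \<le> (\<Sum>i<d. n choose i)" by (rule sum_mono) (use Ti in simp)
    then have "card C + ((n - d - 2) choose d) + ((n - d - 2) choose d) \<le> (\<Sum>i\<le>d. n choose i) + ((n - 1) choose d) + 2"
      using cC cF Td by (simp add: lessThan_Suc_atMost[symmetric])
    \<comment> \<open>The second loss is strictly larger than the second binomial of the bound, so
      equality cannot occur in this case.\<close>
    moreover have "((n - d - 3) choose (d - 1)) < ((n - d - 2) choose d)"
    proof -
      have "n - d - 2 = Suc (n - d - 3)" using n by simp
      then have "(n - d - 2) choose d = ((n - d - 3) choose (d - 1)) + ((n - d - 3) choose d)"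
        using choose_Suc_pos[of "n - d - 2" d] d by simp
      moreover have "0 < (n - d - 3) choose d" using n by simp
      ultimately show ?thesis by simp
    qed
    ultimately have "card C + ((n - d - 2) choose d) + ((n - d - 3) choose (d - 1))
      < (\<Sum>i\<le>d. n choose i) + ((n - 1) choose d) + 2" by linarith
    then show ?thesis by simp
  next
    case nexc: False
    have two: "2 \<le> card (del x F)" if "x \<in> {1..n}" for x
    proof (rule ccontr)
      assume "\<not> 2 \<le> card (del x F)"
      then have "card (del x F) \<le> 1" by simp
      then show False using nexc that unfolding exc_def by blast
    qed
    have nT: "\<exists>G\<in>F. card (G \<inter> T) < 2" if "d + 1 = 3" "T \<subseteq> {1..n}" "card T = 3" for T
    proof (rule ccontr)
      assume "\<not> ?thesis"
      then have "\<forall>G\<in>F. 2 \<le> card (G \<inter> T)" by auto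
      then show False using nexc that unfolding exc_def by auto
    qed
    have k: "3 \<le> d + 1" "2 * (d + 1) < card {1..n}" using d n by auto
    have fin: "finite {1..n}" by simp
    have ar: "card {1..n} - 1 - (d + 1) = n - d - 2" "card {1..n} - 1 - (d + 1) - 1 = n - d - 3"
      "d + 1 - 1 = d" "d + 1 - 2 = d - 1" "card {1..n} - 1 = n - 1"
      "n - d - 2 - 1 = n - d - 3" "n - 1 - (d + 1) = n - d - 2" by auto
    have M1: "card F + ((n - d - 2) choose d) + ((n - d - 3) choose (d - 1)) \<le> ((n - 1) choose d) + 2"
    proof -
      have "card F + ((card {1..n} - 1 - (d + 1)) choose (d + 1 - 1)) + ((card {1..n} - 1 - (d + 1) - 1) choose (d + 1 - 2))
        \<le> ((card {1..n} - 1) choose (d + 1 - 1)) + 2"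
        by (rule odd_middle_bound(1)[OF fin k Fn cr two nT])
      then show ?thesis unfolding ar .
    qed
    have sumle: "(\<Sum>i\<le>d. T i) \<le> (\<Sum>i\<le>d. n choose i)" by (rule sum_mono) (use Ti in simp)
    have ?bound using cC M1 sumle by linarith
    moreover have ?ext if t: ?tight
    proof -
      have e1: "card F + ((n - d - 2) choose d) + ((n - d - 3) choose (d - 1)) = ((n - 1) choose d) + 2"
        and e2: "(\<Sum>i\<le>d. T i) = (\<Sum>i\<le>d. n choose i)" using cC M1 sumle t by linarith+
      have Te: "T i = n choose i" if "i \<le> d" for i
        by (rule sum_mono_inv[OF e2]) (use Ti that in auto)
      have lays: "lay C (2 * d + 2 - i) = {} \<and> lay C i = nsets {1..n} i" if "i \<le> d" for i
        by (rule lay2[OF that]) (use Te[OF that] in \<open>simp add: T_def\<close>)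
      have top: "card X \<le> d + 1" if X: "X \<in> C" for X
      proof (rule ccontr)
        assume "\<not> card X \<le> d + 1"
        then have "2 * d + 2 - card X \<le> d" "2 * d + 2 - (2 * d + 2 - card X) = card X" using cX[OF X] by auto
        then have "lay C (card X) = {}" using lays by metis
        then show False using X by (auto simp: lay_def)
      qed
      have "lay C (d + 2) = {}" using top by (fastforce simp: lay_def)
      moreover have "C = subsets_le n (d + 1 - 1) \<union> lay C (d + 1) \<union> lay C (d + 1 + 1)"
        by (rule union_of_layers[OF C]) (use lays top in \<open>auto simp: le_SucI\<close>)
      ultimately have Ceq: "C = subsets_le n d \<union> F" unfolding F_def by simp
      have "(\<exists>c\<in>{1..n}. card (del c F) = 2) \<or>
        (d + 1 = 4 \<and> (\<exists>c E. c \<in> {1..n} \<and> E \<subseteq> {1..n} - {c} \<and> (card E = 2 \<or> card E = 3) \<and>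
        del c F = {F \<in> nsets ({1..n} - {c}) 4. E \<subseteq> F} \<and> link c F = {G \<in> nsets ({1..n} - {c}) 3. G \<inter> E \<noteq> {}}))"
        by (rule odd_middle_bound(2)[OF fin k Fn cr two nT]) (use e1 ar in simp_all)
      then show ?ext
      proof
        assume "\<exists>c\<in>{1..n}. card (del c F) = 2"
        then obtain c where c: "c \<in> {1..n}" "card (del c F) = 2" by blast
        define V' where "V' = {1..n} - {c}"
        have V': "finite V'" "card V' = n - 1" using c unfolding V'_def by auto
        have dn: "del c F \<subseteq> nsets V' (d + 1)" and ln: "link c F \<subseteq> nsets V' d"
          using del_nsets[OF Fn, of c] link_nsets[OF Fn, of c] unfolding V'_def by auto
        have fF: "finite F" using Fn by (auto intro: finite_subset[OF _ finite_nsets])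
        have "card F = card (del c F) + card (link c F)" by (rule card_del_link[OF fF])
        then have e: "card (del c F) + card (link c F) + ((card V' - (d + 1)) choose d)
          + ((card V' - (d + 1) - 1) choose (d - 1)) = (card V' choose d) + 2"
          using e1 unfolding V'(2) ar by linarith
        have d1: "1 \<le> d" using d by simp
        have "d + 1 + d < card V'" using n V' by simp
        from card_two_full[OF V'(1) dn ln crossing_del_link[OF Fn cr] this d1 c(2) e]
        obtain P Q where "P \<noteq> Q \<and> del c F = {P, Q} \<and> card (P \<inter> Q) = d + 1 - 1 \<and>
          link c F = {G \<in> nsets V' d. G \<inter> P \<noteq> {} \<and> G \<inter> Q \<noteq> {}}" by (elim exE)
        then have PQ: "P \<noteq> Q" "del c F = {P, Q}" "card (P \<inter> Q) = d"
          "link c F = {G \<in> nsets ({1..n} - {c}) d. G \<inter> P \<noteq> {} \<and> G \<inter> Q \<noteq> {}}" unfolding V'_def by simp_all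
        from link_two_sets_J2[OF Fn c(1) PQ] obtain E J where
          EJ: "E \<in> nsets {1..n} d \<and> J \<in> nsets ({1..n} - E) 3 \<and> c \<in> J \<and> F = \<J>\<^sub>2 n (d + 1) E J c" by (elim exE)
        have "\<exists>E J x. E \<in> nsets {1..n} d \<and> J \<in> nsets ({1..n} - E) 3 \<and> x \<in> J \<and> C = subsets_le n d \<union> \<J>\<^sub>2 n (d + 1) E J x"
          by (rule exI[of _ E], rule exI[of _ J], rule exI[of _ c]) (use EJ Ceq in simp)
        then show ?thesis by (rule disjI1)
      next
        assume "d + 1 = 4 \<and> (\<exists>c E. c \<in> {1..n} \<and> E \<subseteq> {1..n} - {c} \<and> (card E = 2 \<or> card E = 3) \<and>
        del c F = {F \<in> nsets ({1..n} - {c}) 4. E \<subseteq> F} \<and> link c F = {G \<in> nsets ({1..n} - {c}) 3. G \<inter> E \<noteq> {}})"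
        then obtain c E where cE: "d = 3" "c \<in> {1..n}" "E \<subseteq> {1..n} - {c}" "card E = 2 \<or> card E = 3"
          "del c F = {F \<in> nsets ({1..n} - {c}) 4. E \<subseteq> F}" "link c F = {G \<in> nsets ({1..n} - {c}) 3. G \<inter> E \<noteq> {}}"
          by (elim conjE exE) simp
        have cE': "c \<notin> E" using cE by auto
        have ne: "E \<noteq> {}" using cE(4) by auto
        define K where "K = {H \<in> nsets {1..n} 4. E \<subseteq> H} \<union> {H \<in> nsets {1..n} 4. c \<in> H \<and> H \<inter> E \<noteq> {}}"
        have "F = K" unfolding K_def
          by (rule family_eqI[of c]) (simp_all only: star_parts[OF cE(2) cE' ne] cE(5,6))
        then have "C = star_7 n c E" using Ceq cE(1) unfolding star_7_def K_def by (simp add: Un_assoc)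
        then have "\<exists>c E. c \<in> {1..n} \<and> E \<subseteq> {1..n} - {c} \<and> (card E = 2 \<or> card E = 3) \<and> C = star_7 n c E"
          using cE(2-4) by (intro exI[of _ c] exI[of _ E] conjI)
        then show ?thesis using cE(1) by (intro disjI2 conjI)
      qed
    qed
    ultimately show ?thesis by blast
  qed
  then show ?bound and "?tight \<Longrightarrow> ?ext" by (rule conjunct1, elim conjE, blast)
qed

subsection \<open>The extremal families\<close>

lemma card_subsets_le_Un:
  assumes "G \<subseteq> Pow {1..n}" "\<And>X. X \<in> G \<Longrightarrow> m < card X"
  shows "card (subsets_le n m \<union> G) = (\<Sum>i\<le>m. n choose i) + card G"
proof -
  have "finite (subsets_le n m)"
    by (rule finite_subset[of _ "Pow {1..n}"]) (auto simp: subsets_le_def)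
  moreover have "finite G" by (rule finite_subset[OF assms(1)]) simp
  ultimately have "card (subsets_le n m \<union> G) = card (subsets_le n m) + card G"
    using assms(2) by (intro card_Un_disjoint) (fastforce simp: subsets_le_def)+
  then show ?thesis by (simp add: card_subsets_le)
qed

lemma card_even_W:
  assumes d: "2 \<le> d" and n: "2 * d + 2 \<le> n" and D: "D1 \<in> nsets {1..n} (d + 1)" "D2 \<in> nsets {1..n} (d + 1)"
    and c: "card (D1 \<inter> D2) = d"
  shows "card (even_W n d D1 D2) + ((n - d - 1) choose d) + ((n - d - 2) choose (d - 1)) = (\<Sum>i\<le>d. n choose i) + 2"
proof -
  define M where "M = {H \<in> nsets {1..n} d. H \<inter> D1 \<noteq> {} \<and> H \<inter> D2 \<noteq> {}}"
  have ne: "D1 \<noteq> D2" using c nsetsD(3)[OF D(1)] by fastforce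
  have "even_W n d D1 D2 = subsets_le n (d - 1) \<union> ({D1, D2} \<union> M)" by (simp add: even_W_def M_def Un_assoc)
  moreover have "card (subsets_le n (d - 1) \<union> ({D1, D2} \<union> M)) = (\<Sum>i\<le>d - 1. n choose i) + card ({D1, D2} \<union> M)"
    by (rule card_subsets_le_Un) (use D d in \<open>auto simp: M_def nsets_def\<close>)
  moreover have "card ({D1, D2} \<union> M) = card {D1, D2} + card M"
    by (rule card_Un_disjoint) (use D in \<open>auto simp: M_def nsets_def\<close>)
  moreover have "card M + ((card {1..n} - (d + 1)) choose d) + ((card {1..n} - (d + 1) - 1) choose (d - 1)) = card {1..n} choose d"
    unfolding M_def by (rule card_meeting_two(2)[OF _ D ne]) (use d c in auto)
  moreover have "(\<Sum>i\<le>d. n choose i) = (\<Sum>i\<le>d - 1. n choose i) + (n choose d)"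
    using d sum.atMost_Suc[of "\<lambda>i. n choose i" "d - 1"] by simp
  ultimately show ?thesis using ne by simp
qed

lemma card_star_6:
  assumes n: "8 \<le> n" and E: "E \<subseteq> {1..n}" "card E = 2 \<or> card E = 3"
  shows "card (star_6 n E) + ((n - 4) choose 3) + ((n - 5) choose 2) = (\<Sum>i\<le>3. n choose i) + 2"
proof -
  define A where "A = {F \<in> nsets {1..n} 4. E \<subseteq> F}"
  define B where "B = {G \<in> nsets {1..n} 3. G \<inter> E \<noteq> {}}"
  have "star_6 n E = subsets_le n 2 \<union> (A \<union> B)" by (auto simp: star_6_def A_def B_def)
  moreover have "card (subsets_le n 2 \<union> (A \<union> B)) = (\<Sum>i\<le>2. n choose i) + card (A \<union> B)"
    by (rule card_subsets_le_Un) (auto simp: A_def B_def nsets_def)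
  moreover have "card (A \<union> B) = card A + card B"
    by (rule card_Un_disjoint) (auto simp: A_def B_def nsets_def)
  moreover have "card A + card B + ((card {1..n} - 4) choose 3) + ((card {1..n} - 5) choose 2) = (card {1..n} choose 3) + 2"
    unfolding A_def B_def by (rule supersets_star_count) (use n E in auto)
  moreover have "(\<Sum>i\<le>3. n choose i) = (\<Sum>i\<le>2. n choose i) + (n choose 3)"
    using sum.atMost_Suc[of "\<lambda>i. n choose i" 2] by (simp add: numeral_3_eq_3)
  ultimately show ?thesis by simp
qed

lemma card_odd_W:
  assumes d: "2 \<le> d" and n: "2 * d + 3 \<le> n" and E: "E \<in> nsets {1..n} d" and J: "J \<in> nsets ({1..n} - E) 3" "c \<in> J"
  shows "card (subsets_le n d \<union> \<J>\<^sub>2 n (d + 1) E J c) + ((n - d - 2) choose d) + ((n - d - 3) choose (d - 1))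
    = (\<Sum>i\<le>d. n choose i) + ((n - 1) choose d) + 2"
proof -
  define F where "F = \<J>\<^sub>2 n (d + 1) E J c"
  have e: "E \<subseteq> {1..n}" "finite E" "card E = d" using E by (auto simp: nsets_def)
  have cE: "c \<in> {1..n}" "c \<notin> E" using J by (auto simp: nsets_def)
  have "card (J - {c}) = 2" using J by (auto simp: nsets_def)
  then obtain p q where pq: "J - {c} = {p, q}" "p \<noteq> q" by (auto simp: card_2_iff)
  then have "p \<in> J - {c}" "q \<in> J - {c}" by auto
  then have pqE: "p \<in> {1..n}" "p \<notin> E" "q \<in> {1..n}" "q \<notin> E" "p \<noteq> c" "q \<noteq> c" using J(1) by (auto simp: nsets_def)
  have Fn: "F \<subseteq> nsets {1..n} (d + 1)"
    unfolding F_def \<J>\<^sub>2_def pq(1) using e pqE by (auto simp: nsets_def)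
  have fF: "finite F" using Fn by (auto intro: finite_subset[OF _ finite_nsets])
  define V' where "V' = {1..n} - {c}"
  have V': "finite V'" "card V' = n - 1" using cE unfolding V'_def by auto
  define P where "P = E \<union> {p}"
  define Q where "Q = E \<union> {q}"
  have PQ: "P \<in> nsets V' (d + 1)" "Q \<in> nsets V' (d + 1)" "P \<noteq> Q" "card (P \<inter> Q) = d + 1 - 1"
  proof -
    show "P \<in> nsets V' (d + 1)" "Q \<in> nsets V' (d + 1)"
      using e pqE cE unfolding P_def Q_def V'_def by (auto simp: nsets_def)
    have "P \<inter> Q = E" using pq pqE unfolding P_def Q_def by auto
    then show "card (P \<inter> Q) = d + 1 - 1" using e by simp
    have "p \<in> P" "p \<notin> Q" using pq pqE unfolding P_def Q_def by auto
    then show "P \<noteq> Q" by blast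
  qed
  note parts = J2_parts[OF cE pq(1), of d, folded F_def V'_def P_def Q_def]
  have "card (link c F) + ((card V' - (d + 1)) choose d) + ((card V' - (d + 1) - 1) choose (d - 1)) = card V' choose d"
    unfolding parts(2) by (rule card_meeting_two(2)[OF V'(1) PQ(1-3) _ PQ(4)]) (use d in simp)
  moreover have "n - 1 - (d + 1) = n - d - 2" "n - d - 2 - 1 = n - d - 3" by simp_all
  ultimately have L: "card (link c F) + ((n - d - 2) choose d) + ((n - d - 3) choose (d - 1)) = (n - 1) choose d"
    unfolding V'(2) by simp
  have "card F = 2 + card (link c F)" using card_del_link[OF fF, of c] parts(1) PQ(3) by simp
  moreover have "card (subsets_le n d \<union> F) = (\<Sum>i\<le>d. n choose i) + card F"
    by (rule card_subsets_le_Un) (use Fn in \<open>auto simp: nsets_def\<close>)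
  ultimately show ?thesis using L unfolding F_def by simp
qed

lemma card_star_7:
  assumes n: "9 \<le> n" and c: "c \<in> {1..n}" and E: "E \<subseteq> {1..n} - {c}" "card E = 2 \<or> card E = 3"
  shows "card (star_7 n c E) + ((n - 5) choose 3) + ((n - 6) choose 2) = (\<Sum>i\<le>3. n choose i) + ((n - 1) choose 3) + 2"
proof -
  define K where "K = {H \<in> nsets {1..n} 4. E \<subseteq> H} \<union> {H \<in> nsets {1..n} 4. c \<in> H \<and> H \<inter> E \<noteq> {}}"
  have "star_7 n c E = subsets_le n 3 \<union> K" by (simp add: star_7_def K_def Un_assoc)
  moreover have "card (subsets_le n 3 \<union> K) = (\<Sum>i\<le>3. n choose i) + card K"
    by (rule card_subsets_le_Un) (auto simp: K_def nsets_def)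
  moreover have "card K = card (del c K) + card (link c K)"
    by (rule card_del_link) (auto simp: K_def)
  moreover have cE: "c \<notin> E" "E \<noteq> {}" using E by auto
  note parts = star_parts[OF c cE, folded K_def]
  define V' where "V' = {1..n} - {c}"
  have V': "finite V'" "card V' = n - 1" using c unfolding V'_def by auto
  have "card {F \<in> nsets V' 4. E \<subseteq> F} + card {G \<in> nsets V' 3. G \<inter> E \<noteq> {}} + ((card V' - 4) choose 3)
    + ((card V' - 5) choose 2) = (card V' choose 3) + 2"
    by (rule supersets_star_count) (use n E V' in \<open>auto simp: V'_def\<close>)
  then have "card (del c K) + card (link c K) + ((n - 5) choose 3) + ((n - 6) choose 2) = ((n - 1) choose 3) + 2"
    unfolding parts V'_def[symmetric] V'(2) by simp
  ultimately show ?thesis by simp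
qed

section \<open>Independence of the choice of fixed points and sets\<close>

text \<open>The cells \<open>D1 \<inter> D2\<close>, \<open>D1 - D2\<close> and
  \<open>D2 - D1\<close> always have sizes \<open>d\<close>, 1 and 1, so a permutation can match
  them with those of another choice.\<close>

lemma even_W_iso:
  assumes D: "D1 \<in> nsets {1..n} (d + 1)" "D2 \<in> nsets {1..n} (d + 1)" "card (D1 \<inter> D2) = d"
    and D': "D1' \<in> nsets {1..n} (d + 1)" "D2' \<in> nsets {1..n} (d + 1)" "card (D1' \<inter> D2') = d"
  shows "isomorphic_fam n (even_W n d D1 D2) (even_W n d D1' D2')"
proof -
  have diff: "card (A - B) = 1" if "A \<in> nsets {1..n} (d + 1)" "card (A \<inter> B) = d" for A B
    using that card_Diff_subset_Int[of A B] by (auto simp: nsets_def)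
  have "card (D1 \<inter> D2) = card (D1' \<inter> D2')" "card (D1 - D2) = card (D1' - D2')" "card (D2 - D1) = card (D2' - D1')"
    using diff[of D1 D2] diff[of D2 D1] diff[of D1' D2'] diff[of D2' D1'] D D' by (auto simp: Int_commute)
  moreover have "D1 \<subseteq> {1..n}" "D2 \<subseteq> {1..n}" "D1' \<subseteq> {1..n}" "D2' \<subseteq> {1..n}"
    using D D' by (auto simp: nsets_def)
  ultimately have "\<exists>\<sigma>. \<sigma> permutes {1..n} \<and> \<sigma> ` (D1 \<inter> D2) = D1' \<inter> D2' \<and> \<sigma> ` (D1 - D2) = D1' - D2' \<and>
      \<sigma> ` (D2 - D1) = D2' - D1'"
    by (intro permutes_three_sets) auto
  then obtain \<sigma> where \<sigma>: "\<sigma> permutes {1..n}" "\<sigma> ` (D1 \<inter> D2) = D1' \<inter> D2'" "\<sigma> ` (D1 - D2) = D1' - D2'"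
      "\<sigma> ` (D2 - D1) = D2' - D1'" by (elim exE conjE)
  have "\<sigma> ` ((D1 \<inter> D2) \<union> (D1 - D2)) = (D1' \<inter> D2') \<union> (D1' - D2')"
    "\<sigma> ` ((D1 \<inter> D2) \<union> (D2 - D1)) = (D1' \<inter> D2') \<union> (D2' - D1')"
    using \<sigma> by (simp_all only: image_Un)
  moreover have "(A \<inter> B) \<union> (A - B) = A" "(A \<inter> B) \<union> (B - A) = B" for A B :: "nat set" by auto
  ultimately have im: "\<sigma> ` D1 = D1'" "\<sigma> ` D2 = D2'" by (simp_all only:)
  show ?thesis
  proof (rule isomorphic_famI[OF \<sigma>(1)])
    show "even_W n d D1 D2 \<subseteq> Pow {1..n}" "even_W n d D1' D2' \<subseteq> Pow {1..n}"
      using D D' by (auto simp: even_W_def subsets_le_def nsets_def)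
    fix X assume "X \<subseteq> {1..n}"
    show "X \<in> even_W n d D1 D2 \<longleftrightarrow> \<sigma> ` X \<in> even_W n d D1' D2'"
      unfolding even_W_def im[symmetric] by (simp add: permutes_simps[OF \<sigma>(1)] del: One_nat_def)
  qed
qed

lemma star_6_iso:
  assumes E: "E \<subseteq> {1..n}" "E' \<subseteq> {1..n}" "card E = card E'"
  shows "isomorphic_fam n (star_6 n E) (star_6 n E')"
proof -
  obtain \<sigma> where \<sigma>: "\<sigma> permutes {1..n}" "\<sigma> ` E = E'"
    using permutes_three_sets[of E n "{}" "{}" E' "{}" "{}"] E by auto
  show ?thesis
  proof (rule isomorphic_famI[OF \<sigma>(1)])
    show "star_6 n E \<subseteq> Pow {1..n}" "star_6 n E' \<subseteq> Pow {1..n}"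
      by (auto simp: star_6_def subsets_le_def nsets_def)
    fix X assume "X \<subseteq> {1..n}"
    show "X \<in> star_6 n E \<longleftrightarrow> \<sigma> ` X \<in> star_6 n E'"
      unfolding star_6_def \<sigma>(2)[symmetric] by (simp add: permutes_simps[OF \<sigma>(1)] del: One_nat_def)
  qed
qed

lemma star_7_iso:
  assumes c: "c \<in> {1..n}" "c' \<in> {1..n}" and E: "E \<subseteq> {1..n} - {c}" "E' \<subseteq> {1..n} - {c'}" "card E = card E'"
  shows "isomorphic_fam n (star_7 n c E) (star_7 n c' E')"
proof -
  obtain \<sigma> where \<sigma>: "\<sigma> permutes {1..n}" "\<sigma> ` E = E'" "\<sigma> ` {c} = {c'}"
    using permutes_three_sets[of E n "{c}" "{}" E' "{c'}" "{}"] E c by auto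
  have im: "\<sigma> c = c'" using \<sigma>(3) by simp
  show ?thesis
  proof (rule isomorphic_famI[OF \<sigma>(1)])
    show "star_7 n c E \<subseteq> Pow {1..n}" "star_7 n c' E' \<subseteq> Pow {1..n}"
      by (auto simp: star_7_def subsets_le_def nsets_def)
    fix X assume "X \<subseteq> {1..n}"
    show "X \<in> star_7 n c E \<longleftrightarrow> \<sigma> ` X \<in> star_7 n c' E'"
      unfolding star_7_def \<sigma>(2)[symmetric] im[symmetric] by (simp add: permutes_simps[OF \<sigma>(1)] del: One_nat_def)
  qed
qed

lemma J2_image:
  assumes \<sigma>: "\<sigma> permutes {1..n}"
  shows "\<sigma> ` X \<in> \<J>\<^sub>2 n k (\<sigma> ` E) (\<sigma> ` J) (\<sigma> x) \<longleftrightarrow> X \<in> \<J>\<^sub>2 n k E J x"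
proof -
  have J: "\<sigma> ` J - {\<sigma> x} = \<sigma> ` (J - {x})"
    by (metis image_set_diff[OF permutes_inj[OF \<sigma>]] image_empty image_insert)
  have ins: "\<sigma> ` E \<union> {\<sigma> j} = \<sigma> ` (E \<union> {j})" for j by auto
  have all: "(\<forall>j\<in>\<sigma> ` (J - {x}). \<sigma> ` X \<inter> (\<sigma> ` E \<union> {j}) \<noteq> {}) \<longleftrightarrow> (\<forall>j\<in>J - {x}. X \<inter> (E \<union> {j}) \<noteq> {})"
    unfolding ball_simps ins permutes_image_Int[OF \<sigma>] by simp
  have ex: "\<sigma> ` X \<in> {\<sigma> ` E \<union> {j} |j. j \<in> \<sigma> ` (J - {x})} \<longleftrightarrow> X \<in> {E \<union> {j} |j. j \<in> J - {x}}"
  proof -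
    have "\<sigma> ` X \<in> {\<sigma> ` E \<union> {j} |j. j \<in> \<sigma> ` (J - {x})} \<longleftrightarrow> (\<exists>j\<in>J - {x}. \<sigma> ` X = \<sigma> ` (E \<union> {j}))"
      unfolding ins[symmetric] by blast
    also have "\<dots> \<longleftrightarrow> (\<exists>j\<in>J - {x}. X = E \<union> {j})" unfolding permutes_image_eq_iff[OF \<sigma>] ..
    also have "\<dots> \<longleftrightarrow> X \<in> {E \<union> {j} |j. j \<in> J - {x}}" by blast
    finally show ?thesis .
  qed
  show ?thesis
    unfolding \<J>\<^sub>2_def J Un_iff ex mem_Collect_eq[of _ "\<lambda>G. _ \<in> nsets _ _ \<and> _ G"]
    by (simp only: mem_Collect_eq all permutes_simps[OF \<sigma>])
qed

text \<open>The cells to be matched are \<open>E\<close>, \<open>J - {x}\<close> and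
  \<open>{x}\<close>; everything in the definition of \<open>\<J>\<^sub>2\<close> is expressed
  through them.\<close>

lemma odd_W_iso:
  assumes E: "E \<in> nsets {1..n} d" "J \<in> nsets ({1..n} - E) 3" "x \<in> J"
    and E': "E' \<in> nsets {1..n} d" "J' \<in> nsets ({1..n} - E') 3" "x' \<in> J'"
  shows "isomorphic_fam n (subsets_le n d \<union> \<J>\<^sub>2 n (d + 1) E J x) (subsets_le n d \<union> \<J>\<^sub>2 n (d + 1) E' J' x')"
proof -
  have s: "E \<subseteq> {1..n}" "J \<subseteq> {1..n}" "E \<inter> J = {}" "card J = 3" "finite J" "card E = d"
    "E' \<subseteq> {1..n}" "J' \<subseteq> {1..n}" "E' \<inter> J' = {}" "card J' = 3" "finite J'" "card E' = d"
    using E E' by (auto simp: nsets_def)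
  have cJ: "card (J - {x}) = card (J' - {x'})" using s E(3) E'(3) by simp
  have "\<exists>\<sigma>. \<sigma> permutes {1..n} \<and> \<sigma> ` E = E' \<and> \<sigma> ` (J - {x}) = J' - {x'} \<and> \<sigma> ` {x} = {x'}"
    by (rule permutes_three_sets) (use s cJ E(3) E'(3) in auto)
  then obtain \<sigma> where \<sigma>: "\<sigma> permutes {1..n}" "\<sigma> ` E = E'" "\<sigma> ` (J - {x}) = J' - {x'}" "\<sigma> ` {x} = {x'}"
    by (elim exE conjE)
  have x: "\<sigma> x = x'" using \<sigma>(4) by simp
  have "\<sigma> ` (insert x (J - {x})) = insert x' (J' - {x'})" using \<sigma>(3) x by (simp only: image_insert)
  then have J: "\<sigma> ` J = J'" using E(3) E'(3) by (simp add: insert_absorb)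
  show ?thesis
  proof (rule isomorphic_famI[OF \<sigma>(1)])
    have "subsets_le n d \<union> \<J>\<^sub>2 n (d + 1) A B y \<subseteq> Pow {1..n}" if "A \<subseteq> {1..n}" "B \<subseteq> {1..n}" for A B y
      using that by (auto simp: \<J>\<^sub>2_def subsets_le_def nsets_def)
    then show "subsets_le n d \<union> \<J>\<^sub>2 n (d + 1) E J x \<subseteq> Pow {1..n}" "subsets_le n d \<union> \<J>\<^sub>2 n (d + 1) E' J' x' \<subseteq> Pow {1..n}"
      using s by blast+
    fix X assume "X \<subseteq> {1..n}"
    show "X \<in> subsets_le n d \<union> \<J>\<^sub>2 n (d + 1) E J x \<longleftrightarrow> \<sigma> ` X \<in> subsets_le n d \<union> \<J>\<^sub>2 n (d + 1) E' J' x'"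
      unfolding \<sigma>(2)[symmetric] J[symmetric] x[symmetric] Un_iff J2_image[OF \<sigma>(1)]
        permutes_image_subsets_le[OF \<sigma>(1)] ..
  qed
qed

lemma W_star_6_eq: "W_star_6 n = star_6 n {1..3}" "W_star_star_6 n = star_6 n {1..2}"
  by (simp_all add: W_star_6_def W_star_star_6_def star_6_def)

lemma W_star_7_eq: "W_star_7 n = star_7 n 1 {2, 3}" "W_star_star_7 n = star_7 n 1 {2, 3, 4}"
  by (simp_all add: W_star_7_def W_star_star_7_def star_7_def)

text \<open>The hypothesis of the theorem excludes one fixed copy of the family, while the
  structural argument meets an arbitrary kernel. A permutation carrying the kernel to the fixed one
  bridges the difference; the analogous lemmas below do the same for the other excluded
  families.\<close>

lemma star_4_subset:
  assumes n: "2 \<le> n" and F: "F \<subseteq> Pow {1..n}" "F \<subseteq> star_4 n E" and E: "E \<subseteq> {1..n}" "card E = 2"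
  shows "subfamily n F (H_star_4 n)"
proof -
  have "star_4 n {1..2} \<subseteq> H_star_4 n"
  proof
    fix X assume "X \<in> star_4 n {1..2}"
    then consider "X \<in> subsets_le n 1" | "X \<in> nsets {1..n} 2" "X \<inter> {1..2} \<noteq> {}" | "X \<in> nsets {1..n} 3" "{1..2} \<subseteq> X"
      unfolding star_4_def by blast
    then show "X \<in> H_star_4 n"
    proof cases
      case 3
      have x: "finite X" "card X = 3" "X \<subseteq> {1..n}" using 3 by (auto simp: nsets_def)
      have "card (X - {1..2}) = 1" using 3 x by (simp add: card_Diff_subset)
      then obtain i where i: "X - {1..2} = {i}" by (rule card_1_singletonE)
      have e: "{1..2} = {1, 2::nat}" by auto
      have "i \<in> X - {1..2}" using i by simp
      then have "i \<in> {3..n}" using x by auto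
      moreover have "X = {1, 2, i}" using i 3(2) unfolding e by blast
      ultimately show ?thesis unfolding H_star_4_def by blast
    qed (auto simp: H_star_4_def)
  qed
  then have sub: "X \<in> H_star_4 n" if "X \<in> star_4 n {1..2}" for X using that by (rule subsetD)
  obtain \<sigma> where \<sigma>: "\<sigma> permutes {1..n}" "\<sigma> ` E = {1..2}"
    using permutes_three_sets[of E n "{}" "{}" "{1..2}" "{}" "{}"] E n by auto
  have "\<sigma> ` X \<in> star_4 n {1..2}" if "X \<in> star_4 n E" for X
    using that unfolding star_4_def \<sigma>(2)[symmetric] by (simp add: permutes_simps[OF \<sigma>(1)] del: One_nat_def)
  then show ?thesis by (intro subfamilyI[OF \<sigma>(1) F] sub)
qed

lemma two_of_three_5_subset:
  assumes n: "3 \<le> n" and F: "F \<subseteq> Pow {1..n}" "F \<subseteq> two_of_three_5 n T" and T: "T \<subseteq> {1..n}" "card T = 3"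
  shows "subfamily n F (T_5 n)"
proof -
  have T5: "two_of_three_5 n {1..3} = T_5 n" by (simp add: two_of_three_5_def T_5_def)
  obtain \<sigma> where \<sigma>: "\<sigma> permutes {1..n}" "\<sigma> ` T = {1..3}"
    using permutes_three_sets[of T n "{}" "{}" "{1..3}" "{}" "{}"] T n by auto
  have "\<sigma> ` X \<in> two_of_three_5 n {1..3}" if "X \<in> two_of_three_5 n T" for X
    using that unfolding two_of_three_5_def \<sigma>(2)[symmetric] by (simp add: permutes_simps[OF \<sigma>(1)] del: One_nat_def)
  then show ?thesis using subfamilyI[OF \<sigma>(1) F] T5 by simp
qed

lemma odd_katona_subset:
  assumes F: "F \<subseteq> Pow {1..n}" "F \<subseteq> odd_katona n d y" and y: "y \<in> {1..n}" "y' \<in> {1..n}"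
  shows "subfamily n F (odd_katona n d y')"
proof -
  obtain \<sigma> where \<sigma>: "\<sigma> permutes {1..n}" "\<sigma> ` {y} = {y'}"
    using permutes_three_sets[of "{y}" n "{}" "{}" "{y'}" "{}" "{}"] y by auto
  have im: "\<sigma> y = y'" using \<sigma>(2) by simp
  have "\<sigma> ` X \<in> odd_katona n d y'" if "X \<in> odd_katona n d y" for X
    using that unfolding odd_katona_def im[symmetric] by (simp add: permutes_simps[OF \<sigma>(1)] del: One_nat_def)
  then show ?thesis using subfamilyI[OF \<sigma>(1) F] by simp
qed

lemma odd_frankl_subset:
  assumes F: "F \<subseteq> Pow {1..n}" "F \<subseteq> odd_frankl n d y D" and y: "y \<in> {1..n}" "y' \<in> {1..n}"
    and D: "D \<in> nsets ({1..n} - {y}) (d + 1)" "D' \<in> nsets ({1..n} - {y'}) (d + 1)"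
  shows "subfamily n F (odd_frankl n d y' D')"
proof -
  have s: "D \<subseteq> {1..n}" "y \<notin> D" "D' \<subseteq> {1..n}" "y' \<notin> D'" "card D = card D'"
    using D by (auto simp: nsets_def)
  obtain \<sigma> where \<sigma>: "\<sigma> permutes {1..n}" "\<sigma> ` D = D'" "\<sigma> ` {y} = {y'}"
    using permutes_three_sets[of D n "{y}" "{}" D' "{y'}" "{}"] y s by auto
  have im: "\<sigma> y = y'" using \<sigma>(3) by simp
  have "\<sigma> ` X \<in> odd_frankl n d y' D'" if "X \<in> odd_frankl n d y D" for X
    using that unfolding odd_frankl_def im[symmetric] \<sigma>(2)[symmetric] by (simp add: permutes_simps[OF \<sigma>(1)] del: One_nat_def)
  then show ?thesis using subfamilyI[OF \<sigma>(1) F] by simp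
qed

definition even_frankl :: "nat \<Rightarrow> nat \<Rightarrow> nat set \<Rightarrow> nat set set" where
  "even_frankl n d D = subsets_le n (d - 1) \<union> {D} \<union> {H \<in> nsets {1..n} d. H \<inter> D \<noteq> {}}"

lemma even_frankl_subset:
  assumes F: "F \<subseteq> Pow {1..n}" "F \<subseteq> even_frankl n d D"
    and D: "D \<in> nsets {1..n} (d + 1)" "D' \<in> nsets {1..n} (d + 1)"
  shows "subfamily n F (even_frankl n d D')"
proof -
  have s: "D \<subseteq> {1..n}" "D' \<subseteq> {1..n}" "card D = card D'" using D by (auto simp: nsets_def)
  obtain \<sigma> where \<sigma>: "\<sigma> permutes {1..n}" "\<sigma> ` D = D'"
    using permutes_three_sets[of D n "{}" "{}" D' "{}" "{}"] s by auto
  have "\<sigma> ` X \<in> even_frankl n d D'" if "X \<in> even_frankl n d D" for X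
    using that unfolding even_frankl_def \<sigma>(2)[symmetric] by (simp add: permutes_simps[OF \<sigma>(1)] del: One_nat_def)
  then show ?thesis using subfamilyI[OF \<sigma>(1) F] by simp
qed

text \<open>A family with one set of size \<open>d + 1\<close> and none larger is contained in \<open>\<H>(n, 2d)\<close>, and two
  \<open>(d + 1)\<close>-sets already arise from a single member of larger size.\<close>
lemma two_large_sets:
  assumes d: "2 \<le> d" and n: "2 * d + 2 \<le> n" and F: "F \<subseteq> Pow {1..n}" "s_union (2 * d) F"
    and K: "\<not> subfamily n F (subsets_le n d)"
    and H: "D' \<in> nsets {1..n} (d + 1)" "\<not> subfamily n F (even_frankl n d D')"
  shows "2 \<le> card (lay (down_closure F) (d + 1))"
proof (rule ccontr)
  assume n2: "\<not> 2 \<le> card (lay (down_closure F) (d + 1))"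
  let ?C = "down_closure F"
  have C: "?C \<subseteq> Pow {1..n}" by (rule down_closure_subset[OF F(1)])
  have su: "s_union (2 * d) ?C" by (rule s_union_down_closure[OF _ F]) simp
  have ln: "lay ?C (d + 1) \<subseteq> nsets {1..n} (d + 1)" by (rule lay_nsets[OF _ C]) simp
  have fl: "finite (lay ?C (d + 1))" by (rule finite_subset[OF ln]) simp
  have fX: "finite X" if "X \<in> ?C" for X using that C finite_subset by (metis PowD finite_atLeastAtMost subsetD)
  have top: "card X \<le> d + 1" if X: "X \<in> ?C" for X
  proof (rule ccontr)
    assume "\<not> card X \<le> d + 1"
    then obtain Y where Y: "Y \<in> nsets X (d + 2)" using ex_nset[of X "d + 2"] fX[OF X] by auto
    have "nsets Y (d + 1) \<subseteq> lay ?C (d + 1)"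
    proof
      fix Z assume "Z \<in> nsets Y (d + 1)"
      then have "Z \<subseteq> X" "card Z = d + 1" using Y by (auto simp: nsets_def)
      then show "Z \<in> lay ?C (d + 1)" using down_closure_down[OF X] by (simp add: lay_def)
    qed
    then have "card (nsets Y (d + 1)) \<le> card (lay ?C (d + 1))" by (rule card_mono[OF fl])
    moreover have "card (nsets Y (d + 1)) = d + 2"
      using Y card_nsets[of Y "d + 1"] binomial_symmetric[of 1 "d + 2"] by (simp add: nsets_def)
    ultimately show False using n2 by simp
  qed
  have "lay ?C (d + 1) \<noteq> {}"
  proof
    assume e: "lay ?C (d + 1) = {}"
    have "F \<subseteq> subsets_le n d"
    proof
      fix X assume X: "X \<in> F"
      then have XC: "X \<in> ?C" using subset_down_closure by auto
      then have "card X \<noteq> d + 1" using e by (auto simp: lay_def)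
      then show "X \<in> subsets_le n d" using top[OF XC] X F by (auto simp: subsets_le_def)
    qed
    then have "subfamily n F (subsets_le n d)"
      using subfamilyI[OF permutes_id F(1), of "subsets_le n d"] by simp
    then show False using K by blast
  qed
  then have "card (lay ?C (d + 1)) = 1" using n2 card_0_eq[OF fl] by linarith
  then obtain D where D: "lay ?C (d + 1) = {D}" by (rule card_1_singletonE)
  have cp: "cross_pair {1..n} (d + 1) d 2 (lay ?C (d + 1)) (lay ?C d)"
    using s_union_cross_pair[OF _ C su, of "d + 1" d] n by simp
  note P = cross_pairD[OF cp]
  have "F \<subseteq> even_frankl n d D"
  proof
    fix X assume X: "X \<in> F"
    then have XC: "X \<in> ?C" using subset_down_closure by auto
    consider "card X \<le> d - 1" | "card X = d" | "card X = d + 1" using top[OF XC] by linarith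
    then show "X \<in> even_frankl n d D"
    proof cases
      case 1 then show ?thesis using X F by (auto simp: even_frankl_def subsets_le_def)
    next
      case 2
      then have Xl: "X \<in> lay ?C d" using XC by (simp add: lay_def)
      then have "D \<inter> X \<noteq> {}" using P(6) D crossing_one_iff[OF P(2)] by blast
      then show ?thesis using Xl P(3) by (auto simp: even_frankl_def)
    next
      case 3
      then have "X \<in> lay ?C (d + 1)" using XC by (simp add: lay_def)
      then show ?thesis using D by (simp add: even_frankl_def)
    qed
  qed
  then have "subfamily n F (even_frankl n d D')"
    by (rule even_frankl_subset[OF F(1)]) (use D ln H(1) in auto)
  then show False using H(2) by blast
qed

section \<open>From down-closures back to arbitrary families\<close>

text \<open>Since the down-closure contains \<open>F\<close>, its bound applies to \<open>F\<close>.
  In the equality case both have the same size and hence coincide, so the structure of the closure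
  is that of \<open>F\<close>.\<close>

lemma even_case:
  assumes d: "2 \<le> d" and n: "2 * d + 2 \<le> n" and F: "F \<subseteq> Pow {1..n}" "s_union (2 * d) F"
    and K: "\<not> subfamily n F (subsets_le n d)"
    and H: "D \<in> nsets {1..n} (d + 1)" "\<not> subfamily n F (even_frankl n d D)"
    and H4: "d = 2 \<Longrightarrow> \<not> subfamily n F (H_star_4 n)"
    and W: "D1 \<in> nsets {1..n} (d + 1)" "D2 \<in> nsets {1..n} (d + 1)" "card (D1 \<inter> D2) = d"
  shows "card F + ((n - d - 1) choose d) + ((n - d - 2) choose (d - 1)) \<le> (\<Sum>i\<le>d. n choose i) + 2"
    and "card F + ((n - d - 1) choose d) + ((n - d - 2) choose (d - 1)) = (\<Sum>i\<le>d. n choose i) + 2 \<longleftrightarrow>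
      isomorphic_fam n F (even_W n d D1 D2) \<or>
      (d = 3 \<and> (isomorphic_fam n F (W_star_6 n) \<or> isomorphic_fam n F (W_star_star_6 n)))"
proof -
  let ?C = "down_closure F"
  have C: "?C \<subseteq> Pow {1..n}" by (rule down_closure_subset[OF F(1)])
  have fC: "finite ?C" by (rule finite_subset[OF C]) simp
  have su: "s_union (2 * d) ?C" by (rule s_union_down_closure[OF _ F]) simp
  have two: "2 \<le> card (lay ?C (d + 1))" by (rule two_large_sets[OF d n F K H])
  have n4: "\<not> ?C \<subseteq> star_4 n E" if "d = 2" "E \<subseteq> {1..n}" "card E = 2" for E
  proof
    assume "?C \<subseteq> star_4 n E"
    then have "F \<subseteq> star_4 n E" using subset_down_closure[of F] by blast
    then have "subfamily n F (H_star_4 n)" using star_4_subset[OF _ F(1) _ that(2,3)] n by simp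
    then show False using H4 that(1) by blast
  qed
  have le: "card F \<le> card ?C" by (rule card_mono[OF fC subset_down_closure])
  have bC: "card ?C + ((n - d - 1) choose d) + ((n - d - 2) choose (d - 1)) \<le> (\<Sum>i\<le>d. n choose i) + 2"
    by (rule even_bound(1)[OF d n C su _ two n4]) (use down_closure_down in blast)+
  then show "card F + ((n - d - 1) choose d) + ((n - d - 2) choose (d - 1)) \<le> (\<Sum>i\<le>d. n choose i) + 2"
    using le by simp
  show "card F + ((n - d - 1) choose d) + ((n - d - 2) choose (d - 1)) = (\<Sum>i\<le>d. n choose i) + 2 \<longleftrightarrow>
      isomorphic_fam n F (even_W n d D1 D2) \<or>
      (d = 3 \<and> (isomorphic_fam n F (W_star_6 n) \<or> isomorphic_fam n F (W_star_star_6 n)))" (is "?eq \<longleftrightarrow> ?iso")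
  proof
    assume eq: ?eq
    then have "card F = card ?C" using le bC by linarith
    then have FC: "F = ?C" by (rule card_subset_eq[OF fC subset_down_closure])
    have eqC: "card ?C + ((n - d - 1) choose d) + ((n - d - 2) choose (d - 1)) = (\<Sum>i\<le>d. n choose i) + 2"
      using eq FC by simp
    have "(\<exists>D1 D2. D1 \<in> nsets {1..n} (d + 1) \<and> D2 \<in> nsets {1..n} (d + 1) \<and> card (D1 \<inter> D2) = d \<and> ?C = even_W n d D1 D2) \<or>
      (d = 3 \<and> (\<exists>E\<subseteq>{1..n}. (card E = 2 \<or> card E = 3) \<and> ?C = star_6 n E))"
      by (rule even_bound(2)[OF d n C su _ two n4 eqC]) (use down_closure_down in blast)+
    then show ?iso
    proof
      assume "\<exists>D1 D2. D1 \<in> nsets {1..n} (d + 1) \<and> D2 \<in> nsets {1..n} (d + 1) \<and> card (D1 \<inter> D2) = d \<and> ?C = even_W n d D1 D2"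
      then obtain A B where AB: "A \<in> nsets {1..n} (d + 1) \<and> B \<in> nsets {1..n} (d + 1) \<and> card (A \<inter> B) = d \<and> ?C = even_W n d A B"
        by (elim exE)
      then have "isomorphic_fam n (even_W n d A B) (even_W n d D1 D2)" by (intro even_W_iso W) simp_all
      then show ?thesis using AB FC by simp
    next
      assume "d = 3 \<and> (\<exists>E\<subseteq>{1..n}. (card E = 2 \<or> card E = 3) \<and> ?C = star_6 n E)"
      then obtain E where E: "d = 3" "E \<subseteq> {1..n}" "card E = 2 \<or> card E = 3" "?C = star_6 n E" by (elim conjE exE)
      from E(3) have "isomorphic_fam n F (W_star_6 n) \<or> isomorphic_fam n F (W_star_star_6 n)"
      proof
        assume "card E = 2"
        then have "isomorphic_fam n (star_6 n E) (star_6 n {1..2})" by (intro star_6_iso) (use E n in auto)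
        then show ?thesis using E FC W_star_6_eq by simp
      next
        assume "card E = 3"
        then have "isomorphic_fam n (star_6 n E) (star_6 n {1..3})" by (intro star_6_iso) (use E n in auto)
        then show ?thesis using E FC W_star_6_eq by simp
      qed
      then show ?thesis using E(1) by simp
    qed
  next
    assume ?iso
    then consider "isomorphic_fam n F (even_W n d D1 D2)"
      | "d = 3" "isomorphic_fam n F (star_6 n {1..3}) \<or> isomorphic_fam n F (star_6 n {1..2})"
      using W_star_6_eq by auto
    then show ?eq
    proof cases
      case 1 then show ?thesis using isomorphic_fam_card[OF 1] card_even_W[OF d n W] by simp
    next
      case 2
      have c: "card (star_6 n E) + ((n - 4) choose 3) + ((n - 5) choose 2) = (\<Sum>i\<le>3. n choose i) + 2"
        if "E = {1..3} \<or> E = {1..2}" for E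
        by (rule card_star_6) (use 2 n that in auto)
      have "card F + ((n - 4) choose 3) + ((n - 5) choose 2) = (\<Sum>i\<le>3. n choose i) + 2"
        using 2(2)
      proof
        assume "isomorphic_fam n F (star_6 n {1..3})"
        then show ?thesis using isomorphic_fam_card[of n F "star_6 n {1..3}"] c[of "{1..3}"] by simp
      next
        assume "isomorphic_fam n F (star_6 n {1..2})"
        then show ?thesis using isomorphic_fam_card[of n F "star_6 n {1..2}"] c[of "{1..2}"] by simp
      qed
      then show ?thesis using 2(1) by simp
    qed
  qed
qed

text \<open>If the closure were contained in any copy of an excluded family, so would be
  \<open>F\<close>, and a permutation would move that copy to the given one. The hypotheses on
  \<open>F\<close> thus become exclusions of the closure for every choice of fixed points and sets,
  as \<open>odd_bound\<close> demands.\<close>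

lemma odd_case:
  assumes d: "2 \<le> d" and n: "2 * d + 3 \<le> n" and F: "F \<subseteq> Pow {1..n}" "s_union (2 * d + 1) F"
    and K: "y \<in> {1..n}" "\<not> subfamily n F (odd_katona n d y)"
    and H: "z \<in> {1..n}" "D \<in> nsets ({1..n} - {z}) (d + 1)" "\<not> subfamily n F (odd_frankl n d z D)"
    and H5: "d = 2 \<Longrightarrow> \<not> subfamily n F (T_5 n)"
    and W: "E \<in> nsets {1..n} d" "J \<in> nsets ({1..n} - E) 3" "x \<in> J"
  shows "card F + ((n - d - 2) choose d) + ((n - d - 3) choose (d - 1)) \<le> (\<Sum>i\<le>d. n choose i) + ((n - 1) choose d) + 2"
    and "card F + ((n - d - 2) choose d) + ((n - d - 3) choose (d - 1)) = (\<Sum>i\<le>d. n choose i) + ((n - 1) choose d) + 2 \<longleftrightarrow>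
      isomorphic_fam n F (subsets_le n d \<union> \<J>\<^sub>2 n (d + 1) E J x) \<or>
      (d = 3 \<and> (isomorphic_fam n F (W_star_7 n) \<or> isomorphic_fam n F (W_star_star_7 n)))"
proof -
  let ?C = "down_closure F"
  have C: "?C \<subseteq> Pow {1..n}" by (rule down_closure_subset[OF F(1)])
  have fC: "finite ?C" by (rule finite_subset[OF C]) simp
  have su: "s_union (2 * d + 1) ?C" by (rule s_union_down_closure[OF _ F]) simp
  have FC: "F \<subseteq> G" if "?C \<subseteq> G" for G using that subset_down_closure[of F] by blast
  have h1: "\<not> ?C \<subseteq> odd_katona n d u" if "u \<in> {1..n}" for u
    using odd_katona_subset[OF F(1) FC that K(1)] K(2) by blast
  have h2: "\<not> ?C \<subseteq> odd_frankl n d u B" if "u \<in> {1..n}" "B \<in> nsets ({1..n} - {u}) (d + 1)" for u B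
    using odd_frankl_subset[OF F(1) FC that(1) H(1) that(2) H(2)] H(3) by blast
  have h3: "\<not> ?C \<subseteq> two_of_three_5 n T" if "d = 2" "T \<subseteq> {1..n}" "card T = 3" for T
  proof
    assume "?C \<subseteq> two_of_three_5 n T"
    then have "subfamily n F (T_5 n)" by (intro two_of_three_5_subset[OF _ F(1) FC that(2,3)]) (use n in simp)
    then show False using H5 that(1) by blast
  qed
  have le: "card F \<le> card ?C" by (rule card_mono[OF fC subset_down_closure])
  have bC: "card ?C + ((n - d - 2) choose d) + ((n - d - 3) choose (d - 1)) \<le> (\<Sum>i\<le>d. n choose i) + ((n - 1) choose d) + 2"
    by (rule odd_bound(1)[OF d n C su _ h1 h2 h3]) (use down_closure_down in blast)+
  then show "card F + ((n - d - 2) choose d) + ((n - d - 3) choose (d - 1)) \<le> (\<Sum>i\<le>d. n choose i) + ((n - 1) choose d) + 2"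
    using le by simp
  show "card F + ((n - d - 2) choose d) + ((n - d - 3) choose (d - 1)) = (\<Sum>i\<le>d. n choose i) + ((n - 1) choose d) + 2 \<longleftrightarrow>
      isomorphic_fam n F (subsets_le n d \<union> \<J>\<^sub>2 n (d + 1) E J x) \<or>
      (d = 3 \<and> (isomorphic_fam n F (W_star_7 n) \<or> isomorphic_fam n F (W_star_star_7 n)))" (is "?eq \<longleftrightarrow> ?iso")
  proof
    assume eq: ?eq
    then have "card F = card ?C" using le bC by linarith
    then have FC: "F = ?C" by (rule card_subset_eq[OF fC subset_down_closure])
    have eqC: "card ?C + ((n - d - 2) choose d) + ((n - d - 3) choose (d - 1)) = (\<Sum>i\<le>d. n choose i) + ((n - 1) choose d) + 2"
      using eq FC by simp
    have "(\<exists>E J x. E \<in> nsets {1..n} d \<and> J \<in> nsets ({1..n} - E) 3 \<and> x \<in> J \<and> ?C = subsets_le n d \<union> \<J>\<^sub>2 n (d + 1) E J x) \<or>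
      (d = 3 \<and> (\<exists>c E. c \<in> {1..n} \<and> E \<subseteq> {1..n} - {c} \<and> (card E = 2 \<or> card E = 3) \<and> ?C = star_7 n c E))"
      by (rule odd_bound(2)[OF d n C su _ h1 h2 h3 eqC]) (use down_closure_down in blast)+
    then show ?iso
    proof
      assume "\<exists>E J x. E \<in> nsets {1..n} d \<and> J \<in> nsets ({1..n} - E) 3 \<and> x \<in> J \<and> ?C = subsets_le n d \<union> \<J>\<^sub>2 n (d + 1) E J x"
      then obtain E' J' x' where A: "E' \<in> nsets {1..n} d \<and> J' \<in> nsets ({1..n} - E') 3 \<and> x' \<in> J' \<and>
        ?C = subsets_le n d \<union> \<J>\<^sub>2 n (d + 1) E' J' x'" by (elim exE)
      then have "isomorphic_fam n (subsets_le n d \<union> \<J>\<^sub>2 n (d + 1) E' J' x') (subsets_le n d \<union> \<J>\<^sub>2 n (d + 1) E J x)"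
        by (intro odd_W_iso W) simp_all
      then show ?thesis using A FC by simp
    next
      assume "d = 3 \<and> (\<exists>c E. c \<in> {1..n} \<and> E \<subseteq> {1..n} - {c} \<and> (card E = 2 \<or> card E = 3) \<and> ?C = star_7 n c E)"
      then obtain c B where B: "d = 3" "c \<in> {1..n}" "B \<subseteq> {1..n} - {c}" "card B = 2 \<or> card B = 3" "?C = star_7 n c B"
        by (elim conjE exE)
      from B(4) have "isomorphic_fam n F (W_star_7 n) \<or> isomorphic_fam n F (W_star_star_7 n)"
      proof
        assume "card B = 2"
        then have "isomorphic_fam n (star_7 n c B) (star_7 n 1 {2, 3})" by (intro star_7_iso) (use B n in auto)
        then show ?thesis using B FC W_star_7_eq by simp
      next
        assume "card B = 3"
        then have "isomorphic_fam n (star_7 n c B) (star_7 n 1 {2, 3, 4})" by (intro star_7_iso) (use B n in auto)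
        then show ?thesis using B FC W_star_7_eq by simp
      qed
      then show ?thesis using B(1) by simp
    qed
  next
    assume ?iso
    then consider "isomorphic_fam n F (subsets_le n d \<union> \<J>\<^sub>2 n (d + 1) E J x)"
      | "d = 3" "isomorphic_fam n F (star_7 n 1 {2, 3}) \<or> isomorphic_fam n F (star_7 n 1 {2, 3, 4})"
      using W_star_7_eq by auto
    then show ?eq
    proof cases
      case 1 then show ?thesis using isomorphic_fam_card[OF 1] card_odd_W[OF d n W] by simp
    next
      case 2
      have c: "card (star_7 n 1 B) + ((n - 5) choose 3) + ((n - 6) choose 2) = (\<Sum>i\<le>3. n choose i) + ((n - 1) choose 3) + 2"
        if "B = {2, 3} \<or> B = {2, 3, 4}" for B
        by (rule card_star_7) (use 2 n that in auto)
      have "card F + ((n - 5) choose 3) + ((n - 6) choose 2) = (\<Sum>i\<le>3. n choose i) + ((n - 1) choose 3) + 2"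
        using 2(2)
      proof
        assume "isomorphic_fam n F (star_7 n 1 {2, 3})"
        then show ?thesis using isomorphic_fam_card[of n F "star_7 n 1 {2, 3}"] c[of "{2, 3}"] by simp
      next
        assume "isomorphic_fam n F (star_7 n 1 {2, 3, 4})"
        then show ?thesis using isomorphic_fam_card[of n F "star_7 n 1 {2, 3, 4}"] c[of "{2, 3, 4}"] by simp
      qed
      then show ?thesis using 2(1) by simp
    qed
  qed
qed

section \<open>Inverting the inductive predicates, with the wrong rule excluded by parity\<close>

lemma katona_evenD:
  assumes "katona n (2 * d) K"
  shows "K = subsets_le n d"
  using assms
proof (cases rule: katona.cases)
  case (katona_odd y d')
  then have False by presburger
  then show ?thesis ..
qed simp

lemma katona_oddD:
  assumes "katona n (2 * d + 1) K"
  shows "\<exists>y\<in>{1..n}. K = odd_katona n d y"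
  using assms
proof (cases rule: katona.cases)
  case (katona_even d')
  then have False by presburger
  then show ?thesis ..
next
  case (katona_odd y d')
  then show ?thesis unfolding odd_katona_def by auto
qed

lemma frankl_evenD:
  assumes "frankl n (2 * d) H"
  shows "\<exists>D\<in>nsets {1..n} (d + 1). H = even_frankl n d D"
  using assms
proof (cases rule: frankl.cases)
  case (frankl_even d' D)
  then show ?thesis unfolding even_frankl_def by auto
next
  case (frankl_odd y d' D)
  then have False by presburger
  then show ?thesis ..
qed

lemma frankl_oddD:
  assumes "frankl n (2 * d + 1) H"
  shows "\<exists>y\<in>{1..n}. \<exists>D\<in>nsets ({1..n} - {y}) (d + 1). H = odd_frankl n d y D"
  using assms
proof (cases rule: frankl.cases)
  case (frankl_even d' D)
  then have False by presburger
  then show ?thesis ..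
next
  case (frankl_odd y D d')
  then have "d' = d" by simp
  then show ?thesis
    using frankl_odd(2-4) unfolding odd_frankl_def by (intro bexI[of _ y] bexI[of _ D]) simp_all
qed

lemma w_family_evenD:
  assumes "w_family n (2 * d) W"
  shows "\<exists>D1 D2. D1 \<in> nsets {1..n} (d + 1) \<and> D2 \<in> nsets {1..n} (d + 1) \<and>
    card (D1 \<inter> D2) = d \<and> W = even_W n d D1 D2"
  using assms
proof (cases rule: w_family.cases)
  case (w_even d' D1 D2)
  then have "d' = d" by simp
  then show ?thesis using w_even(2,4-6) unfolding even_W_def by (intro exI[of _ D1] exI[of _ D2]) simp
next
  case (w_odd d' E J x)
  then have False by presburger
  then show ?thesis ..
qed

lemma w_family_oddD:
  assumes "w_family n (2 * d + 1) W"
  shows "\<exists>E J x. E \<in> nsets {1..n} d \<and> J \<in> nsets ({1..n} - E) 3 \<and> x \<in> J \<and>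
    W = subsets_le n d \<union> \<J>\<^sub>2 n (d + 1) E J x"
  using assms
proof (cases rule: w_family.cases)
  case (w_even d' D1 D2)
  then have False by presburger
  then show ?thesis ..
next
  case (w_odd d' E J x)
  then have "d' = d" by simp
  then show ?thesis using w_odd by (intro exI[of _ E] exI[of _ J] exI[of _ x]) simp
qed

theorem theorem1p7:
  fixes n s :: nat and \<F> \<K> \<H> \<W> :: "nat set set"
  assumes "4 \<le> s" and "s + 2 \<le> n"
    and "\<F> \<subseteq> Pow {1..n}" and "s_union s \<F>"
    and "katona n s \<K>" and "frankl n s \<H>" and "w_family n s \<W>"
    and "\<not> subfamily n \<F> \<K>" and "\<not> subfamily n \<F> \<H>"
  shows
    "(\<forall>d. 2 \<le> d \<and> s = 2 * d \<and> (s = 4 \<longrightarrow> \<not> subfamily n \<F> (H_star_4 n)) \<longrightarrow>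
        (let b = (\<Sum>i\<le>d. int (n choose i)) - int ((n - d - 1) choose d)
                 - int ((n - d - 2) choose (d - 1)) + 2
         in int (card \<F>) \<le> b \<and>
            (s = 6 \<longrightarrow> (int (card \<F>) = b \<longleftrightarrow>
               isomorphic_fam n \<F> \<W> \<or> isomorphic_fam n \<F> (W_star_6 n)
               \<or> isomorphic_fam n \<F> (W_star_star_6 n))) \<and>
            (s \<noteq> 6 \<longrightarrow> (int (card \<F>) = b \<longleftrightarrow> isomorphic_fam n \<F> \<W>))))
     \<and>
     (\<forall>d. 2 \<le> d \<and> s = 2 * d + 1 \<and> (s = 5 \<longrightarrow> \<not> subfamily n \<F> (T_5 n)) \<longrightarrow>
        (let b = (\<Sum>i\<le>d. int (n choose i)) + int ((n - 1) choose d)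
                 - int ((n - d - 2) choose d) - int ((n - d - 3) choose (d - 1)) + 2
         in int (card \<F>) \<le> b \<and>
            (s = 7 \<longrightarrow> (int (card \<F>) = b \<longleftrightarrow>
               isomorphic_fam n \<F> \<W> \<or> isomorphic_fam n \<F> (W_star_7 n)
               \<or> isomorphic_fam n \<F> (W_star_star_7 n))) \<and>
            (s \<noteq> 7 \<longrightarrow> (int (card \<F>) = b \<longleftrightarrow> isomorphic_fam n \<F> \<W>))))"
proof (intro conjI allI impI)
  fix d
  assume d: "2 \<le> d \<and> s = 2 * d \<and> (s = 4 \<longrightarrow> \<not> subfamily n \<F> (H_star_4 n))"
  then have s: "s = 2 * d" and d2: "2 \<le> d" by auto
  have n: "2 * d + 2 \<le> n" using assms(2) s by simp
  obtain D where D: "D \<in> nsets {1..n} (d + 1)" "\<H> = even_frankl n d D"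
    using frankl_evenD assms(6) unfolding s by blast
  obtain D1 D2 where W: "D1 \<in> nsets {1..n} (d + 1)" "D2 \<in> nsets {1..n} (d + 1)" "card (D1 \<inter> D2) = d"
    "\<W> = even_W n d D1 D2"
    using w_family_evenD assms(7) unfolding s by blast
  have "\<not> subfamily n \<F> (subsets_le n d)" using katona_evenD assms(5,8) unfolding s by blast
  moreover have "\<not> subfamily n \<F> (even_frankl n d D)" using assms(9) D by simp
  moreover have "d = 2 \<Longrightarrow> \<not> subfamily n \<F> (H_star_4 n)" using d by simp
  ultimately have E: "card \<F> + ((n - d - 1) choose d) + ((n - d - 2) choose (d - 1)) \<le> (\<Sum>i\<le>d. n choose i) + 2"
    "card \<F> + ((n - d - 1) choose d) + ((n - d - 2) choose (d - 1)) = (\<Sum>i\<le>d. n choose i) + 2 \<longleftrightarrow>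
      isomorphic_fam n \<F> \<W> \<or>
      (d = 3 \<and> (isomorphic_fam n \<F> (W_star_6 n) \<or> isomorphic_fam n \<F> (W_star_star_6 n)))"
    using even_case[OF d2 n assms(3) assms(4)[unfolded s] _ D(1) _ _ W(1-3)] W(4) by simp_all
  define b where "b = (\<Sum>i\<le>d. int (n choose i)) - int ((n - d - 1) choose d)
    - int ((n - d - 2) choose (d - 1)) + 2"
  \<comment> \<open>The binomials are subtracted in \<open>int\<close>, where differences are not
    truncated; moving them to the other side gives the subtraction-free form over \<open>nat\<close>
    used so far.\<close>
  have b: "int (card \<F>) \<le> b \<longleftrightarrow>
      card \<F> + ((n - d - 1) choose d) + ((n - d - 2) choose (d - 1)) \<le> (\<Sum>i\<le>d. n choose i) + 2"
    "int (card \<F>) = b \<longleftrightarrow>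
      card \<F> + ((n - d - 1) choose d) + ((n - d - 2) choose (d - 1)) = (\<Sum>i\<le>d. n choose i) + 2"
    unfolding b_def of_nat_sum[symmetric] by linarith+
  show "let b = (\<Sum>i\<le>d. int (n choose i)) - int ((n - d - 1) choose d)
                 - int ((n - d - 2) choose (d - 1)) + 2
         in int (card \<F>) \<le> b \<and>
            (s = 6 \<longrightarrow> (int (card \<F>) = b \<longleftrightarrow>
               isomorphic_fam n \<F> \<W> \<or> isomorphic_fam n \<F> (W_star_6 n)
               \<or> isomorphic_fam n \<F> (W_star_star_6 n))) \<and>
            (s \<noteq> 6 \<longrightarrow> (int (card \<F>) = b \<longleftrightarrow> isomorphic_fam n \<F> \<W>))"
    unfolding Let_def b_def[symmetric] b E(2) using E(1) s by auto
next
  fix d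
  assume d: "2 \<le> d \<and> s = 2 * d + 1 \<and> (s = 5 \<longrightarrow> \<not> subfamily n \<F> (T_5 n))"
  then have s: "s = 2 * d + 1" and d2: "2 \<le> d" by auto
  have n: "2 * d + 3 \<le> n" using assms(2) s by simp
  obtain y where y: "y \<in> {1..n}" "\<K> = odd_katona n d y"
    using katona_oddD assms(5) unfolding s by blast
  obtain z D where D: "z \<in> {1..n}" "D \<in> nsets ({1..n} - {z}) (d + 1)" "\<H> = odd_frankl n d z D"
    using frankl_oddD assms(6) unfolding s by blast
  obtain E J x where W: "E \<in> nsets {1..n} d" "J \<in> nsets ({1..n} - E) 3" "x \<in> J"
    "\<W> = subsets_le n d \<union> \<J>\<^sub>2 n (d + 1) E J x"
    using w_family_oddD assms(7) unfolding s by blast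
  have "\<not> subfamily n \<F> (odd_katona n d y)" "\<not> subfamily n \<F> (odd_frankl n d z D)"
    using assms(8,9) y D by auto
  moreover have "d = 2 \<Longrightarrow> \<not> subfamily n \<F> (T_5 n)" using d by simp
  ultimately have E: "card \<F> + ((n - d - 2) choose d) + ((n - d - 3) choose (d - 1))
      \<le> (\<Sum>i\<le>d. n choose i) + ((n - 1) choose d) + 2"
    "card \<F> + ((n - d - 2) choose d) + ((n - d - 3) choose (d - 1))
      = (\<Sum>i\<le>d. n choose i) + ((n - 1) choose d) + 2 \<longleftrightarrow>
      isomorphic_fam n \<F> \<W> \<or>
      (d = 3 \<and> (isomorphic_fam n \<F> (W_star_7 n) \<or> isomorphic_fam n \<F> (W_star_star_7 n)))"
    using odd_case[OF d2 n assms(3) assms(4)[unfolded s] y(1) _ D(1,2) _ _ W(1-3)] W(4) by simp_all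
  define b where "b = (\<Sum>i\<le>d. int (n choose i)) + int ((n - 1) choose d)
    - int ((n - d - 2) choose d) - int ((n - d - 3) choose (d - 1)) + 2"
  have b: "int (card \<F>) \<le> b \<longleftrightarrow>
      card \<F> + ((n - d - 2) choose d) + ((n - d - 3) choose (d - 1))
        \<le> (\<Sum>i\<le>d. n choose i) + ((n - 1) choose d) + 2"
    "int (card \<F>) = b \<longleftrightarrow>
      card \<F> + ((n - d - 2) choose d) + ((n - d - 3) choose (d - 1))
        = (\<Sum>i\<le>d. n choose i) + ((n - 1) choose d) + 2"
    unfolding b_def of_nat_sum[symmetric] by linarith+
  show "let b = (\<Sum>i\<le>d. int (n choose i)) + int ((n - 1) choose d)
                 - int ((n - d - 2) choose d) - int ((n - d - 3) choose (d - 1)) + 2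
         in int (card \<F>) \<le> b \<and>
            (s = 7 \<longrightarrow> (int (card \<F>) = b \<longleftrightarrow>
               isomorphic_fam n \<F> \<W> \<or> isomorphic_fam n \<F> (W_star_7 n)
               \<or> isomorphic_fam n \<F> (W_star_star_7 n))) \<and>
            (s \<noteq> 7 \<longrightarrow> (int (card \<F>) = b \<longleftrightarrow> isomorphic_fam n \<F> \<W>))"
    unfolding Let_def b_def[symmetric] b E(2) using E(1) s by auto
qed

end
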